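(* Suppose $0<\lambda<1$, $p\in(1,\infty)$ and $g$ is analytic on $\mathbb{D}$. If $T_g:\mathcal{L}^{2,\lambda}\to B$ is bounded, then $$\|T_g\|_{e,\mathcal{L}^{2,\lambda}\to B}\approx\limsup_{|a|\to1}\Big(\int_{\mathbb{D}}\Big(\frac{1-|a|^2}{|1-\overline{a}z|^2}\Big)^{p+1-\lambda}|g'(z)|^2(1-|z|^2)^p\,dm(z)\Big)^{1/2}.$$
   Context: $\mathbb{D}$ is the open unit disc in $\mathbb{C}$, $\partial\mathbb{D}$ the unit circle, $H(\mathbb{D})$ the space of analytic functions on $\mathbb{D}$, $dm(z)=\frac1\pi dx\,dy$; $a$ ranges over $\mathbb{D}$. For an arc $I\subset\partial\mathbb{D}$, $|I|=\frac1{2\pi}\int_I|d\zeta|$ is its normalized length, $f_I=\frac1{|I|}\int_I f(\zeta)\frac{|d\zeta|}{2\pi}$, and $S(I)=\{z\in\mathbb{D}:1-|I|\le|z|<1,\ z/|z|\in I\}$ is its Carleson box (with $S(\partial\mathbb{D})=\mathbb{D}$). Analytic Morrey space: $\mathcal{L}^{2,\lambda}$ is the set of $f$ in the Hardy space $H^2$ (boundary values are used on $\partial\mathbb{D}$) with $\sup_{I\subset\partial\mathbb{D}}\frac1{|I|^\lambda}\int_I|f(\zeta)-f_I|^2\frac{|d\zeta|}{2\pi}<\infty$. For $0<\lambda<1$ it is known that $f\in H(\mathbb{D})$ lies in $\mathcal{L}^{2,\lambda}$ iff $\|f\|_{\mathcal{L}^{2,\lambda}}=|f(0)|+\sup_{I\subset\partial\mathbb{D}}\big(\frac1{|I|^\lambda}\int_{S(I)}|f'(z)|^2(1-|z|^2)\,dm(z)\big)^{1/2}<\infty$,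 and this is the norm used. Bloch space: $B=\{f\in H(\mathbb{D}):\|f\|_B=\sup_{z\in\mathbb{D}}(1-|z|^2)|f'(z)|<\infty\}$, a Banach space with norm $|f(0)|+\|f\|_B$. For $g\in H(\mathbb{D})$, $T_gf(z)=\int_0^z f(w)g'(w)\,dw$ for $f\in H(\mathbb{D})$, $z\in\mathbb{D}$. That $T_g:X\to Y$ is bounded means it maps $X$ into $Y$ and is a bounded linear operator. The essential norm of a bounded operator $T:X\to Y$ between Banach spaces is $\|T\|_{e,X\to Y}=\inf\{\|T-K\|_{X\to Y}: K:X\to Y \text{ compact}\}$. $F\approx G$ means $C^{-1}G\le F\le CG$ with a constant $C>0$ depending only on $p,\lambda$. *)

theory Defs
  imports "HOL-Complex_Analysis.Complex_Analysis"
begin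

section \<open>Analytic functions on the unit disc\<close>

abbreviation disc :: "complex set"
  where "disc \<equiv> ball 0 1"

text \<open>
  The space \<open>H(\<bbbD>)\<close>. An analytic function on the disc is represented by the total function
  that vanishes off the disc, so that equality of elements is equality of functions.
\<close>

definition analytic_disc :: "(complex \<Rightarrow> complex) set"
  where "analytic_disc = {f. f holomorphic_on disc \<and> (\<forall>z. z \<notin> disc \<longrightarrow> f z = 0)}"

text \<open>Integral over \<open>A\<close> against \<open>dm = dx dy / \<pi>\<close>.\<close>

definition area_integral :: "complex set \<Rightarrow> (complex \<Rightarrow> real) \<Rightarrow> ennreal"
  where "area_integral A F = ennreal (1 / pi) * (\<integral>\<^sup>+z\<in>A. ennreal (F z) \<partial>lborel)"

definition esqrt :: "ennreal \<Rightarrow> ennreal"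
  where "esqrt x = (if x = \<infinity> then \<infinity> else ennreal (sqrt (enn2real x)))"


section \<open>Hardy space and boundary values\<close>

definition hardy2 :: "(complex \<Rightarrow> complex) set"
  where "hardy2 = {f \<in> analytic_disc.
     (SUP r\<in>{0<..<1}. ennreal (1 / (2 * pi)) *
        (\<integral>\<^sup>+t\<in>{0..2 * pi}. ennreal ((cmod (f (of_real r * cis t)))\<^sup>2) \<partial>lborel)) < \<infinity>}"

text \<open>
  Radial boundary value at \<open>e\<^sup>i\<^sup>t\<close>. For \<open>f\<close> in the Hardy space the limit exists for almost
  every \<open>t\<close>; elsewhere the value is an unspecified constant, which no integral sees.
\<close>

definition bdry :: "(complex \<Rightarrow> complex) \<Rightarrow> real \<Rightarrow> complex"
  where "bdry f t = Lim (at_left 1) (\<lambda>r::real. f (of_real r * cis t))"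


section \<open>The analytic Morrey space\<close>

text \<open>
  Arcs are given by an initial angle \<open>\<theta>\<close> and a normalized length \<open>h \<in> (0, 1]\<close>; in the
  angle variable the arc is the interval from \<open>\<theta>\<close> to \<open>\<theta> + 2\<pi>h\<close>.
\<close>

definition arc_angles :: "real \<Rightarrow> real \<Rightarrow> real set"
  where "arc_angles \<theta> h = {\<theta>..\<theta> + 2 * pi * h}"

definition arc_mean :: "(complex \<Rightarrow> complex) \<Rightarrow> real \<Rightarrow> real \<Rightarrow> complex"
  where "arc_mean f \<theta> h =
     (LINT t:arc_angles \<theta> h|lborel. bdry f t) / of_real (2 * pi * h)"

definition arc_oscillation :: "real \<Rightarrow> (complex \<Rightarrow> complex) \<Rightarrow> real \<Rightarrow> real \<Rightarrow> ennreal"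
  where "arc_oscillation lam f \<theta> h = ennreal (1 / (h powr lam)) * (ennreal (1 / (2 * pi)) *
     (\<integral>\<^sup>+t\<in>arc_angles \<theta> h. ennreal ((cmod (bdry f t - arc_mean f \<theta> h))\<^sup>2) \<partial>lborel))"

definition morrey :: "real \<Rightarrow> (complex \<Rightarrow> complex) set"
  where "morrey lam = {f \<in> hardy2. (SUP \<theta>. SUP h\<in>{0<..1}. arc_oscillation lam f \<theta> h) < \<infinity>}"

definition carleson_box :: "real \<Rightarrow> real \<Rightarrow> complex set"
  where "carleson_box \<theta> h =
     (if h = 1 then disc
      else {z \<in> disc. 1 - h \<le> cmod z \<and> z / of_real (cmod z) \<in> cis ` arc_angles \<theta> h})"

text \<open>
  Norms take values in \<open>[0, \<infinity>]\<close>, so that no supremum has to be known to be finite in advance.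
\<close>

definition morrey_norm :: "real \<Rightarrow> (complex \<Rightarrow> complex) \<Rightarrow> ennreal"
  where "morrey_norm lam f = ennreal (cmod (f 0)) +
     (SUP \<theta>. SUP h\<in>{0<..1}. esqrt (ennreal (1 / (h powr lam)) *
        area_integral (carleson_box \<theta> h) (\<lambda>z. (cmod (deriv f z))\<^sup>2 * (1 - (cmod z)\<^sup>2))))"


section \<open>The Bloch space\<close>

definition bloch_seminorm :: "(complex \<Rightarrow> complex) \<Rightarrow> ennreal"
  where "bloch_seminorm f = (SUP z\<in>disc. ennreal ((1 - (cmod z)\<^sup>2) * cmod (deriv f z)))"

definition bloch :: "(complex \<Rightarrow> complex) set"
  where "bloch = {f \<in> analytic_disc. bloch_seminorm f < \<infinity>}"

definition bloch_norm :: "(complex \<Rightarrow> complex) \<Rightarrow> ennreal"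
  where "bloch_norm f = ennreal (cmod (f 0)) + bloch_seminorm f"


section \<open>Bounded and compact operators between function spaces\<close>

text \<open>A normed space is given by its carrier and its norm; only values on the carrier matter.\<close>

type_synonym fn = "complex \<Rightarrow> complex"

definition linear_between :: "fn set \<Rightarrow> fn set \<Rightarrow> (fn \<Rightarrow> fn) \<Rightarrow> bool"
  where "linear_between X Y T \<longleftrightarrow>
     (\<forall>f\<in>X. T f \<in> Y) \<and>
     (\<forall>f\<in>X. \<forall>g\<in>X. T (\<lambda>z. f z + g z) = (\<lambda>z. T f z + T g z)) \<and>
     (\<forall>c. \<forall>f\<in>X. T (\<lambda>z. c * f z) = (\<lambda>z. c * T f z))"

definition bounded_operator ::
    "fn set \<Rightarrow> (fn \<Rightarrow> ennreal) \<Rightarrow> fn set \<Rightarrow> (fn \<Rightarrow> ennreal) \<Rightarrow> (fn \<Rightarrow> fn) \<Rightarrow> bool"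
  where "bounded_operator X NX Y NY T \<longleftrightarrow>
     linear_between X Y T \<and> (\<exists>C::real. \<forall>f\<in>X. NY (T f) \<le> ennreal C * NX f)"

definition compact_operator ::
    "fn set \<Rightarrow> (fn \<Rightarrow> ennreal) \<Rightarrow> fn set \<Rightarrow> (fn \<Rightarrow> ennreal) \<Rightarrow> (fn \<Rightarrow> fn) \<Rightarrow> bool"
  where "compact_operator X NX Y NY T \<longleftrightarrow>
     linear_between X Y T \<and>
     (\<forall>F :: nat \<Rightarrow> fn. (\<forall>n. F n \<in> X) \<and> (\<exists>C::real. \<forall>n. NX (F n) \<le> ennreal C) \<longrightarrow>
        (\<exists>s h. strict_mono (s :: nat \<Rightarrow> nat) \<and> h \<in> Y \<and>
           (\<lambda>n. NY (\<lambda>z. T (F (s n)) z - h z)) \<longlonglongrightarrow> 0))"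

definition operator_norm ::
    "fn set \<Rightarrow> (fn \<Rightarrow> ennreal) \<Rightarrow> (fn \<Rightarrow> ennreal) \<Rightarrow> (fn \<Rightarrow> fn) \<Rightarrow> ennreal"
  where "operator_norm X NX NY T = (SUP f\<in>{f \<in> X. NX f \<le> 1}. NY (T f))"

definition essential_norm ::
    "fn set \<Rightarrow> (fn \<Rightarrow> ennreal) \<Rightarrow> fn set \<Rightarrow> (fn \<Rightarrow> ennreal) \<Rightarrow> (fn \<Rightarrow> fn) \<Rightarrow> ennreal"
  where "essential_norm X NX Y NY T =
     (INF K\<in>{K. compact_operator X NX Y NY K}. operator_norm X NX NY (\<lambda>f z. T f z - K f z))"


section \<open>The integral operator\<close>

definition T_op :: "fn \<Rightarrow> fn \<Rightarrow> fn"
  where "T_op g f z =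
     (if z \<in> disc then contour_integral (linepath 0 z) (\<lambda>w. f w * deriv g w) else 0)"

end

theory Submission
  imports Defs
begin

text \<open>
  Put \<open>\<alpha> = (1 + \<lambda>) / 2\<close> and \<open>w(z) = (1 - |z|\<^sup>2)\<^sup>\<alpha> |g'(z)|\<close>. Both sides are comparable to the
  upper limit of \<open>w(z)\<close> as \<open>|z| \<rightarrow> 1\<close>. For the integral, the sub-mean value property on the disc of
  radius \<open>(1 - |a|) / 2\<close> about \<open>a\<close> gives the lower estimate and the Forelli--Rudin integral the
  upper one. For the essential norm, subtract the compact operators \<open>f \<mapsto> T\<^sub>g(f(r \<sqdot>))\<close> and use the
  growth \<open>|f(z)| \<lesssim> (1 - |z|)\<^sup>\<alpha>\<^sup>-\<^sup>1\<close> in the Morrey space; conversely, test on the functions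
  \<open>f\<^sub>a(z) = (1 - |a|\<^sup>2)\<^sup>\<alpha> / (1 - a\<^sup>* z)\<close>, which are bounded in the Morrey space. No weak convergence
  of \<open>f\<^sub>a\<close> is needed: a compact operator makes \<open>K f\<^sub>a - K f\<^sub>b\<close> small along a subsequence, while
  \<open>f\<^sub>b\<close> for fixed \<open>b\<close> does not contribute near \<open>a\<close>, because \<open>(1 - |z|\<^sup>2) |g'(z)| \<rightarrow> 0\<close>.
\<close>


section \<open>Rotation invariance and the sub-mean value property\<close>

text \<open>The exponent \<alpha> is forced from both sides: the growth power \<alpha> - 1 plus one
  power from the Bloch weight gives (1 - |z|)^\<alpha> |g'(z)|, and (1 - |a|^2) f_a(a) equals (1 -
  |a|^2)^\<alpha> exactly. The parameter p cancels: near a the kernel contributes the power -(p + 1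
  - lam) of 1 - |a|, the weight p and the area 2, which add up to 2 \<alpha>. Three points shape the
  proof. The comparison constants may depend on p and lam only, so each of them is obtained before g
  is named. Area estimates avoid polar coordinates: the circle mean is integrated against rotations
  of Lebesgue measure, and weighted integrals are summed over dyadic pieces whose area comes from
  counting balls. Finally, membership in \<open>morrey\<close> is phrased by boundary oscillation
  but its norm by Carleson boxes, so a test function needs two separate verifications before an
  operator, known only on the carrier, may be applied to it.\<close>

lemma lborel_complex_eq_distr:
  "(lborel :: complex measure) = distr (lborel \<Otimes>\<^sub>M lborel) borel (\<lambda>(x, y). Complex x y)"
proof (rule lborel_eqI)
  fix l u :: complex
  assume le: "\<And>b. b \<in> Basis \<Longrightarrow> l \<bullet> b \<le> u \<bullet> b"
  have le': "Re l \<le> Re u" "Im l \<le> Im u"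
    using le[of 1] le[of \<i>] by (auto simp: Basis_complex_def)
  have [measurable]: "(\<lambda>(x, y). Complex x y) \<in> (lborel \<Otimes>\<^sub>M lborel) \<rightarrow>\<^sub>M borel"
    unfolding Complex_eq by measurable
  have pre: "(\<lambda>(x, y). Complex x y) -` box l u \<inter> space (lborel \<Otimes>\<^sub>M lborel) =
      {Re l<..<Re u} \<times> {Im l<..<Im u}"
    by (auto simp: box_def Basis_complex_def space_pair_measure)
  have "emeasure (distr (lborel \<Otimes>\<^sub>M lborel) borel (\<lambda>(x, y). Complex x y)) (box l u) =
      emeasure (lborel \<Otimes>\<^sub>M lborel) ({Re l<..<Re u} \<times> {Im l<..<Im u})"
    by (subst emeasure_distr) (auto simp: pre)
  also have "\<dots> = ennreal (Re u - Re l) * ennreal (Im u - Im l)"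
    using le' by (subst lborel.emeasure_pair_measure_Times) auto
  also have "\<dots> = (\<Prod>b\<in>Basis. (u - l) \<bullet> b)"
    using le' by (simp add: Basis_complex_def ennreal_mult)
  finally show "emeasure (distr (lborel \<Otimes>\<^sub>M lborel) borel (\<lambda>(x, y). Complex x y)) (box l u) =
      (\<Prod>b\<in>Basis. (u - l) \<bullet> b)" .
qed simp

lemma nn_integral_lborel_complex:
  assumes [measurable]: "F \<in> borel_measurable borel"
  shows "(\<integral>\<^sup>+z. F z \<partial>lborel) = (\<integral>\<^sup>+x. \<integral>\<^sup>+y. F (Complex x y) \<partial>lborel \<partial>lborel)"
proof -
  have [measurable]: "(\<lambda>(x, y). Complex x y) \<in> (lborel \<Otimes>\<^sub>M lborel) \<rightarrow>\<^sub>M borel"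
    unfolding Complex_eq by measurable
  have "(\<integral>\<^sup>+z. F z \<partial>lborel) = (\<integral>\<^sup>+p. F (case p of (x, y) \<Rightarrow> Complex x y) \<partial>(lborel \<Otimes>\<^sub>M lborel))"
    by (subst lborel_complex_eq_distr, subst nn_integral_distr) auto
  also have "\<dots> = (\<integral>\<^sup>+x. \<integral>\<^sup>+y. F (Complex x y) \<partial>lborel \<partial>lborel)"
    by (subst lborel.nn_integral_fst[symmetric]) auto
  finally show ?thesis .
qed

text \<open>A rotation is a product of two affine substitutions, one in each real variable, with Jacobians
  \<open>1 / \<alpha>\<close> and \<open>\<alpha>\<close>; this needs \<open>\<alpha> = Re c \<noteq> 0\<close>.\<close>

lemma nn_integral_lborel_rotate_nonvertical:
  assumes [measurable]: "F \<in> borel_measurable borel" and c: "cmod c = 1" "Re c \<noteq> 0"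
  shows "(\<integral>\<^sup>+z. F (c * z) \<partial>lborel) = (\<integral>\<^sup>+z. F z \<partial>lborel)"
proof -
  define \<alpha> \<beta> where "\<alpha> = Re c" and "\<beta> = Im c"
  have \<alpha>: "\<alpha> \<noteq> 0" and sq: "\<alpha>\<^sup>2 + \<beta>\<^sup>2 = 1"
    using c by (auto simp: \<alpha>_def \<beta>_def cmod_def)
  have [measurable]: "(\<lambda>p. Complex (f p) (g p)) \<in> M \<rightarrow>\<^sub>M borel"
    if "f \<in> borel_measurable M" "g \<in> borel_measurable M" for f g and M :: "'x measure"
    using that unfolding Complex_eq by measurable
  \<comment> \<open>With x = (\<beta> y + u) / \<alpha> the first coordinate of the rotated point is
    u; the relation \<alpha>^2 + \<beta>^2 = 1 collapses the second one to (\<beta> u + y) /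
    \<alpha>, which is again affine in y.\<close>
  have shear: "\<beta> * (\<beta> * y / \<alpha> + u / \<alpha>) + \<alpha> * y = \<beta> * u / \<alpha> + y / \<alpha>" for u y
  proof -
    have "\<beta> * (\<beta> * y / \<alpha> + u / \<alpha>) + \<alpha> * y = (\<beta> * u + (\<alpha>\<^sup>2 + \<beta>\<^sup>2) * y) / \<alpha>"
      using \<alpha> by (simp add: field_simps power2_eq_square)
    then show ?thesis using sq by (simp add: add_divide_distrib)
  qed
  have swap: "(\<integral>\<^sup>+y. \<integral>\<^sup>+u. F (Complex u (\<beta> * u / \<alpha> + y / \<alpha>)) \<partial>lborel \<partial>lborel) =
      (\<integral>\<^sup>+u. \<integral>\<^sup>+y. F (Complex u (\<beta> * u / \<alpha> + y / \<alpha>)) \<partial>lborel \<partial>lborel)"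
    by (rule lborel_pair.Fubini') measurable
  have "(\<integral>\<^sup>+z. F (c * z) \<partial>lborel) =
      (\<integral>\<^sup>+x. \<integral>\<^sup>+y. F (Complex (\<alpha> * x - \<beta> * y) (\<beta> * x + \<alpha> * y)) \<partial>lborel \<partial>lborel)"
    by (subst nn_integral_lborel_complex) (auto simp: \<alpha>_def \<beta>_def complex_eq_iff
        intro!: nn_integral_cong arg_cong[where f = F])
  also have "\<dots> = (\<integral>\<^sup>+y. \<integral>\<^sup>+x. F (Complex (\<alpha> * x - \<beta> * y) (\<beta> * x + \<alpha> * y)) \<partial>lborel \<partial>lborel)"
    by (rule lborel_pair.Fubini'[symmetric]) measurable
  also have "\<dots> = (\<integral>\<^sup>+y. \<bar>1 / \<alpha>\<bar> * (\<integral>\<^sup>+u. F (Complex u (\<beta> * u / \<alpha> + y / \<alpha>)) \<partial>lborel) \<partial>lborel)"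
  proof (rule nn_integral_cong)
    fix y :: real
    have "(\<integral>\<^sup>+x. F (Complex (\<alpha> * x - \<beta> * y) (\<beta> * x + \<alpha> * y)) \<partial>lborel) =
        \<bar>1 / \<alpha>\<bar> * (\<integral>\<^sup>+u. F (Complex (\<alpha> * (\<beta> * y / \<alpha> + 1 / \<alpha> * u) - \<beta> * y)
          (\<beta> * (\<beta> * y / \<alpha> + 1 / \<alpha> * u) + \<alpha> * y)) \<partial>lborel)"
      by (rule nn_integral_real_affine) (use \<alpha> in auto)
    also have "(\<lambda>u. Complex (\<alpha> * (\<beta> * y / \<alpha> + 1 / \<alpha> * u) - \<beta> * y)
        (\<beta> * (\<beta> * y / \<alpha> + 1 / \<alpha> * u) + \<alpha> * y)) = (\<lambda>u. Complex u (\<beta> * u / \<alpha> + y / \<alpha>))"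
      using shear \<alpha> by (auto simp: fun_eq_iff distrib_left)
    then have "(\<integral>\<^sup>+u. F (Complex (\<alpha> * (\<beta> * y / \<alpha> + 1 / \<alpha> * u) - \<beta> * y)
          (\<beta> * (\<beta> * y / \<alpha> + 1 / \<alpha> * u) + \<alpha> * y)) \<partial>lborel) =
        (\<integral>\<^sup>+u. F (Complex u (\<beta> * u / \<alpha> + y / \<alpha>)) \<partial>lborel)"
      by (simp add: fun_eq_iff)
    finally show "(\<integral>\<^sup>+x. F (Complex (\<alpha> * x - \<beta> * y) (\<beta> * x + \<alpha> * y)) \<partial>lborel) =
        \<bar>1 / \<alpha>\<bar> * (\<integral>\<^sup>+u. F (Complex u (\<beta> * u / \<alpha> + y / \<alpha>)) \<partial>lborel)" .
  qed
  also have "\<dots> = \<bar>1 / \<alpha>\<bar> * (\<integral>\<^sup>+y. \<integral>\<^sup>+u. F (Complex u (\<beta> * u / \<alpha> + y / \<alpha>)) \<partial>lborel \<partial>lborel)"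
    by (rule nn_integral_cmult) measurable
  also have "\<dots> = \<bar>1 / \<alpha>\<bar> * (\<integral>\<^sup>+u. \<integral>\<^sup>+y. F (Complex u (\<beta> * u / \<alpha> + y / \<alpha>)) \<partial>lborel \<partial>lborel)"
    by (subst swap) (rule refl)
  also have "\<dots> = (\<integral>\<^sup>+u. \<bar>1 / \<alpha>\<bar> * (\<integral>\<^sup>+y. F (Complex u (\<beta> * u / \<alpha> + y / \<alpha>)) \<partial>lborel) \<partial>lborel)"
    by (rule nn_integral_cmult[symmetric]) measurable
  also have "\<dots> = (\<integral>\<^sup>+u. \<integral>\<^sup>+y. F (Complex u y) \<partial>lborel \<partial>lborel)"
  proof (rule nn_integral_cong)
    fix u :: real
    have "(\<integral>\<^sup>+y. F (Complex u y) \<partial>lborel) =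
        \<bar>1 / \<alpha>\<bar> * (\<integral>\<^sup>+y. F (Complex u (\<beta> * u / \<alpha> + 1 / \<alpha> * y)) \<partial>lborel)"
      by (rule nn_integral_real_affine) (use \<alpha> in auto)
    then show "\<bar>1 / \<alpha>\<bar> * (\<integral>\<^sup>+y. F (Complex u (\<beta> * u / \<alpha> + y / \<alpha>)) \<partial>lborel) =
        (\<integral>\<^sup>+y. F (Complex u y) \<partial>lborel)"
      by simp
  qed
  also have "\<dots> = (\<integral>\<^sup>+z. F z \<partial>lborel)"
    by (rule nn_integral_lborel_complex[symmetric]) simp
  finally show ?thesis .
qed

text \<open>If the real part of c vanishes, a square root of c has modulus 1 and nonzero real part,
  and rotating by it twice is rotating by c.\<close>

lemma nn_integral_lborel_rotate:
  assumes [measurable]: "F \<in> borel_measurable borel" and c: "cmod c = 1"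
  shows "(\<integral>\<^sup>+z. F (c * z) \<partial>lborel) = (\<integral>\<^sup>+z. F z \<partial>lborel)"
proof (cases "Re c = 0")
  case False
  then show ?thesis by (intro nn_integral_lborel_rotate_nonvertical) (use c in auto)
next
  case True
  define w where "w = csqrt c"
  have ww: "w * w = c" by (simp add: w_def power2_eq_square[symmetric])
  have nw: "cmod w = 1"
    using c by (simp add: w_def)
  have "(Re w)\<^sup>2 - (Im w)\<^sup>2 = 0" "(Re w)\<^sup>2 + (Im w)\<^sup>2 = 1"
    using True nw by (auto simp flip: ww simp: power2_eq_square cmod_def)
  then have "Re w \<noteq> 0" by auto
  note rot = nn_integral_lborel_rotate_nonvertical[OF _ nw this]
  have "(\<integral>\<^sup>+z. F (c * z) \<partial>lborel) = (\<integral>\<^sup>+z. F (w * (w * z)) \<partial>lborel)"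
    by (simp add: ww flip: mult.assoc)
  also have "\<dots> = (\<integral>\<^sup>+z. F (w * z) \<partial>lborel)"
    by (rule rot[of "\<lambda>z. F (w * z)"]) measurable
  also have "\<dots> = (\<integral>\<^sup>+z. F z \<partial>lborel)" by (rule rot) measurable
  finally show ?thesis .
qed

lemma nn_integral_lborel_translate:
  fixes a :: complex
  assumes [measurable]: "F \<in> borel_measurable borel"
  shows "(\<integral>\<^sup>+z. F (a + z) \<partial>lborel) = (\<integral>\<^sup>+z. F z \<partial>lborel)"
proof -
  have "(\<integral>\<^sup>+z. F z \<partial>distr lborel borel ((+) a)) = (\<integral>\<^sup>+z. F (a + z) \<partial>lborel)"
    by (subst nn_integral_distr) auto
  then show ?thesis by (simp add: lborel_distr_plus)
qed

section \<open>Areas of discs and mean value inequalities\<close>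

lemma emeasure_lborel_complex_ball:
  assumes "0 \<le> r"
  shows "emeasure lborel (ball (a::complex) r) = ennreal (pi * r\<^sup>2)"
    and "emeasure lborel (cball (a::complex) r) = ennreal (pi * r\<^sup>2)"
  using assms by (simp_all add: emeasure_ball emeasure_cball unit_ball_vol_numeral(1)[of "num.One"] eval_unit_ball_vol)

lemma cmod_center_le_circle_mean:
  assumes "G holomorphic_on cball 0 1"
  shows "ennreal (cmod (G 0)) \<le> (\<integral>\<^sup>+t\<in>{0..1}. ennreal (cmod (G (cis (2 * pi * t)))) \<partial>lborel)"
proof -
  have contG: "continuous_on (cball 0 1) G"
    using assms by (rule holomorphic_on_imp_continuous_on)
  have "((\<lambda>u. G u / (u - 0)) has_contour_integral 2 * of_real pi * \<i> * G 0) (circlepath 0 1)"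
    by (rule Cauchy_integral_circlepath[OF contG])
      (use assms in \<open>auto intro: holomorphic_on_subset\<close>)
  then have "((\<lambda>t. 2 * of_real pi * \<i> * G (cis (2 * pi * t))) has_integral 2 * of_real pi * \<i> * G 0) {0..1}"
    unfolding has_contour_integral_def
  proof (rule has_integral_eq[rotated])
    fix t :: real assume "t \<in> {0..1}"
    then show "G (circlepath 0 1 t) / (circlepath 0 1 t - 0) * vector_derivative (circlepath 0 1) (at t within {0..1}) =
        2 * of_real pi * \<i> * G (cis (2 * pi * t))"
      by (subst vector_derivative_circlepath01) (auto simp: circlepath cis_conv_exp mult_ac)
  qed
  then have "((\<lambda>t. inverse (2 * of_real pi * \<i>) * (2 * of_real pi * \<i> * G (cis (2 * pi * t))))
      has_integral inverse (2 * of_real pi * \<i>) * (2 * of_real pi * \<i> * G 0)) {0..1}"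
    by (rule has_integral_mult_right)
  then have I: "((\<lambda>t. G (cis (2 * pi * t))) has_integral G 0) {0..1}"
    by (simp add: field_simps)
  have cont: "continuous_on {0..1} (\<lambda>t. cmod (G (cis (2 * pi * t))))"
    by (intro continuous_intros continuous_on_compose2[OF contG]) auto
  then have N: "((\<lambda>t. cmod (G (cis (2 * pi * t)))) has_integral
      integral {0..1} (\<lambda>t. cmod (G (cis (2 * pi * t))))) {0..1}"
    by (intro integrable_integral integrable_continuous_interval)
  have "cmod (G 0) \<le> integral {0..1} (\<lambda>t. cmod (G (cis (2 * pi * t))))"
    using I N
    by (metis integral_norm_bound_integral has_integral_integrable integral_unique order_refl)
  also have "ennreal \<dots> = (\<integral>\<^sup>+t\<in>{0..1}. ennreal (cmod (G (cis (2 * pi * t)))) \<partial>lborel)"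
    by (rule nn_integral_has_integral_lebesgue'[symmetric, OF _ N]) simp
  finally show ?thesis by (simp add: ennreal_leI)
qed

text \<open>For each z in the centred ball, the circle mean applied to the square of F bounds
  |F(a)|^2 by the average of |F|^2 over the circle through a + z. Integrating over z and exchanging
  the integrals leaves, for each angle, the area integral of a rotated function, which is
  independent of the angle.\<close>

lemma cmod_square_center_le_area:
  assumes F: "F holomorphic_on ball a r" and "0 < r"
  shows "ennreal (pi * r\<^sup>2 * (cmod (F a))\<^sup>2) \<le> (\<integral>\<^sup>+z\<in>ball a r. ennreal ((cmod (F z))\<^sup>2) \<partial>lborel)"
proof -
  \<comment> \<open>F is only known on the ball. Moving the centre to 0 and extending by zero gives
    a Borel function on the whole plane, to which Fubini and the rotation invariance apply.\<close>
  define H where "H z = ennreal ((cmod (indicator (ball 0 r) z *\<^sub>R F (a + z)))\<^sup>2)" for z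
  have "continuous_on (ball 0 r) (\<lambda>z. F (a + z))"
    by (rule continuous_on_compose2[OF holomorphic_on_imp_continuous_on[OF F]])
      (auto intro!: continuous_intros)
  then have "(\<lambda>z. indicator (ball 0 r) z *\<^sub>R F (a + z)) \<in> borel_measurable borel"
    by (intro borel_measurable_continuous_on_indicator) auto
  then have H[measurable]: "H \<in> borel_measurable borel"
    unfolding H_def[abs_def] by measurable
  have circ: "H' \<le> (\<integral>\<^sup>+t\<in>{0..1}. H (cis (2 * pi * t) * z) \<partial>lborel)"
    if "H' = ennreal ((cmod (F a))\<^sup>2) * indicator (ball 0 r) z" for z H'
  proof (cases "z \<in> ball 0 r")
    case True
    have "(\<lambda>w. (F (a + z * w))\<^sup>2) holomorphic_on cball 0 1"
    proof (intro holomorphic_intros holomorphic_on_compose_gen[OF _ F, unfolded o_def])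
      show "(\<lambda>w. a + z * w) ` cball 0 1 \<subseteq> ball a r"
      proof clarsimp
        fix w assume "cmod w \<le> 1"
        then have "cmod (z * w) \<le> cmod z * 1"
          unfolding norm_mult by (intro mult_left_mono) auto
        also have "\<dots> < r" using True by simp
        finally show "dist a (a + z * w) < r" by (simp add: dist_norm)
      qed
    qed
    from cmod_center_le_circle_mean[OF this]
    have "ennreal ((cmod (F a))\<^sup>2) \<le>
        (\<integral>\<^sup>+t\<in>{0..1}. ennreal ((cmod (F (a + z * cis (2 * pi * t))))\<^sup>2) \<partial>lborel)"
      by (simp add: norm_power)
    also have "\<dots> = (\<integral>\<^sup>+t\<in>{0..1}. H (cis (2 * pi * t) * z) \<partial>lborel)"
      using True by (auto simp: H_def norm_mult mult.commute intro!: nn_integral_cong)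
    finally show ?thesis using True by (simp add: that)
  qed (simp add: that)
  have "ennreal (pi * r\<^sup>2 * (cmod (F a))\<^sup>2) =
      (\<integral>\<^sup>+(z::complex). ennreal ((cmod (F a))\<^sup>2) * indicator (ball 0 r) z \<partial>lborel)"
    using \<open>0 < r\<close> emeasure_lborel_complex_ball(1)[of r 0]
    by (subst nn_integral_cmult_indicator) (auto simp: mult_ac simp flip: ennreal_mult')
  also have "\<dots> \<le> (\<integral>\<^sup>+z. (\<integral>\<^sup>+t\<in>{0..1}. H (cis (2 * pi * t) * z) \<partial>lborel) \<partial>lborel)"
    by (intro nn_integral_mono circ) simp
  also have "\<dots> = (\<integral>\<^sup>+t. (\<integral>\<^sup>+z. H (cis (2 * pi * t) * z) * indicator {0..1} t \<partial>lborel) \<partial>lborel)"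
  proof (rule lborel_pair.Fubini')
    have "continuous_on UNIV (\<lambda>t. cis (2 * pi * t))" by (intro continuous_intros)
    then have [measurable]: "(\<lambda>t. cis (2 * pi * t)) \<in> borel_measurable borel"
      by (rule borel_measurable_continuous_onI)
    show "(\<lambda>(t, z). H (cis (2 * pi * t) * z) * indicator {0..1} t)
        \<in> borel_measurable (lborel \<Otimes>\<^sub>M lborel)"
      by measurable
  qed
  also have "\<dots> = (\<integral>\<^sup>+(t::real). (\<integral>\<^sup>+z. H z \<partial>lborel) * indicator {0..1} t \<partial>lborel)"
  proof (rule nn_integral_cong)
    fix t :: real
    have "(\<integral>\<^sup>+z. H (cis (2 * pi * t) * z) * indicator {0..1} t \<partial>lborel) =
        (\<integral>\<^sup>+z. H (cis (2 * pi * t) * z) \<partial>lborel) * indicator {0..1} t"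
      by (rule nn_integral_multc) measurable
    then show "(\<integral>\<^sup>+z. H (cis (2 * pi * t) * z) * indicator {0..1} t \<partial>lborel) =
        (\<integral>\<^sup>+z. H z \<partial>lborel) * indicator {0..1} t"
      by (simp add: nn_integral_lborel_rotate[OF H])
  qed
  also have "\<dots> = (\<integral>\<^sup>+z. H z \<partial>lborel)"
    by (subst nn_integral_cmult_indicator) auto
  also have "\<dots> = (\<integral>\<^sup>+z. ennreal ((cmod (indicator (ball a r) (a + z) *\<^sub>R F (a + z)))\<^sup>2) \<partial>lborel)"
    by (auto simp: H_def indicator_def dist_norm intro!: nn_integral_cong)
  also have "\<dots> = (\<integral>\<^sup>+z. ennreal ((cmod (indicator (ball a r) z *\<^sub>R F z))\<^sup>2) \<partial>lborel)"
  proof (rule nn_integral_lborel_translate)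
    have "(\<lambda>z. indicator (ball a r) z *\<^sub>R F z) \<in> borel_measurable borel"
      using F by (intro borel_measurable_continuous_on_indicator holomorphic_on_imp_continuous_on) auto
    then show "(\<lambda>z. ennreal ((cmod (indicator (ball a r) z *\<^sub>R F z))\<^sup>2)) \<in> borel_measurable borel"
      by measurable
  qed
  also have "\<dots> = (\<integral>\<^sup>+z\<in>ball a r. ennreal ((cmod (F z))\<^sup>2) \<partial>lborel)"
    by (auto simp: indicator_def intro!: nn_integral_cong)
  finally show ?thesis .
qed

section \<open>Forelli--Rudin estimates\<close>

lemma sin_ge_third:
  assumes "0 \<le> x" "x \<le> pi / 2"
  shows "x / 3 \<le> sin (x::real)"
\<comment> \<open>Beyond pi / 3 the sine is at least sqrt 3 / 2, while x / 3 stays below 2 / 3. Up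
  to pi / 3 the mean value theorem gives sin x = x cos z with cos z at least 1 / 2.\<close>
proof (cases "x = 0 \<or> pi / 3 < x")
  case True
  have "8 / 5 \<le> sqrt 3" by (rule real_le_rsqrt) (simp add: power2_eq_square)
  moreover have "sin (pi / 3) \<le> sin x" if "pi / 3 < x"
    using that assms by (intro sin_monotone_2pi_le) auto
  ultimately show ?thesis using True assms pi_less_4 by (auto simp: sin_60)
next
  case False
  then have x: "0 < x" "x \<le> pi / 3" using assms by auto
  then obtain z where z: "0 < z" "z < x" "sin x = x * cos z"
    using MVT2[of 0 x sin cos] by (force intro: derivative_eq_intros)
  have "1 / 2 \<le> cos z"
    using cos_monotone_0_pi_le[of z "pi / 3"] z x by (simp add: cos_60)
  then have "x * (1 / 2) \<le> x * cos z" using x by (intro mult_left_mono) auto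
  then show ?thesis using z x by simp
qed

lemma cmod_cis_diff: "cmod (cis s - cis t) = 2 * \<bar>sin ((s - t) / 2)\<bar>"
proof -
  have "cis s - cis t = cis t * (exp (\<i> * of_real (s - t)) - 1)"
    by (simp add: cis_conv_exp algebra_simps flip: exp_add)
  then show ?thesis by (simp only: norm_mult dist_exp_i_1 norm_cis mult_1)
qed

lemma cmod_cis_diff_le: "cmod (cis s - cis t) \<le> \<bar>s - t\<bar>"
  using abs_sin_x_le_abs_x[of "(s - t) / 2"] by (simp add: cmod_cis_diff)

text \<open>A weak form of Jordan's inequality. What matters is that the factor 3 lies below pi:
  this is how a point close to a is later placed in an arc of half-angle pi h.\<close>

lemma abs_le_cmod_cis_diff_1:
  assumes "\<bar>s\<bar> \<le> pi"
  shows "\<bar>s\<bar> \<le> 3 * cmod (cis s - 1)"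
proof -
  have "\<bar>s\<bar> / 2 / 3 \<le> sin (\<bar>s\<bar> / 2)" using assms by (intro sin_ge_third) auto
  also have "\<dots> \<le> \<bar>sin (s / 2)\<bar>" by (cases "s \<ge> 0") auto
  finally show ?thesis using cmod_cis_diff[of s 0] by simp
qed

text \<open>The cap is covered by about \<open>R / \<epsilon>\<close> balls of radius \<open>2\<epsilon>\<close> centred on the unit circle.\<close>

lemma emeasure_cap_le:
  assumes \<zeta>: "cmod \<zeta> = 1" and \<epsilon>: "0 < \<epsilon>" "\<epsilon> \<le> R"
  shows "emeasure lborel {z \<in> disc. cmod (z - \<zeta>) < R \<and> 1 - cmod z \<le> \<epsilon>} \<le> ennreal (68 * pi * R * \<epsilon>)"
proof -
  \<comment> \<open>A point of the cap has angle at most 6 R relative to \<zeta>, and rounding this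
    angle to a multiple of \<epsilon> costs at most one further step.\<close>
  define N where "N = \<lceil>6 * R / \<epsilon>\<rceil> + 1"
  have N: "6 * R / \<epsilon> + 1 \<le> N" "N \<le> 6 * R / \<epsilon> + 2" unfolding N_def by linarith+
  have RE: "R / \<epsilon> \<ge> 1" using \<epsilon> by simp
  define c where "c k = \<zeta> * cis (of_int k * \<epsilon>)" for k
  have cover: "{z \<in> disc. cmod (z - \<zeta>) < R \<and> 1 - cmod z \<le> \<epsilon>} \<subseteq> (\<Union>k\<in>{-N..N}. cball (c k) (2 * \<epsilon>))"
  proof clarsimp
    fix z assume z: "cmod z < 1" "cmod (z - \<zeta>) < R" "1 - cmod z \<le> \<epsilon>"
    \<comment> \<open>The angle is at most three times the chord |w - 1|. The chord is at most 2 R,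
      since radial projection moves z by 1 - |z| \<le> \<epsilon> \<le> R. For z = 0 the direction
      is arbitrary.\<close>
    obtain s where s: "\<bar>s\<bar> \<le> 6 * R" "z = cmod z *\<^sub>R (\<zeta> * cis s)"
    proof (cases "z = 0")
      case True
      then show ?thesis using that[of 0] \<epsilon> by simp
    next
      case False
      define w where "w = z / (cmod z *\<^sub>R \<zeta>)"
      have "\<zeta> \<noteq> 0" using \<zeta> by auto
      have w: "cmod w = 1" "z = cmod z *\<^sub>R (\<zeta> * w)"
        using False \<zeta> \<open>\<zeta> \<noteq> 0\<close> by (auto simp: w_def norm_divide norm_mult scaleR_conv_of_real)
      have "w \<noteq> 0" using w(1) by force
      then have ws: "w = cis (Arg w)" using w(1) cis_Arg[of w] by (simp add: sgn_div_norm)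
      have "cmod (w - 1) = cmod (\<zeta> * w - \<zeta>)"
        using \<zeta> norm_mult[of \<zeta> "w - 1"] by (simp add: algebra_simps)
      also have "\<dots> \<le> cmod (\<zeta> * w - z) + cmod (z - \<zeta>)"
        using norm_triangle_ineq[of "\<zeta> * w - z" "z - \<zeta>"] by simp
      also have "\<zeta> * w - z = (1 - cmod z) *\<^sub>R (\<zeta> * w)" by (metis w(2) scaleR_diff_left scaleR_one)
      also have "cmod \<dots> = 1 - cmod z" using z \<zeta> w(1) by (simp add: norm_mult)
      finally have "cmod (w - 1) \<le> 2 * R" using z \<epsilon> by simp
      moreover have "\<bar>Arg w\<bar> \<le> 3 * cmod (w - 1)"
        using abs_le_cmod_cis_diff_1[of "Arg w"] Arg_bounded[of w] ws by auto
      ultimately show ?thesis using that[of "Arg w"] w(2) ws by auto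
    qed
    define k where "k = \<lfloor>s / \<epsilon>\<rfloor>"
    have k: "\<bar>s / \<epsilon> - k\<bar> \<le> 1" unfolding k_def by linarith
    have "\<bar>s / \<epsilon>\<bar> \<le> 6 * R / \<epsilon>" using s \<epsilon> by (simp add: divide_right_mono)
    then have "\<bar>real_of_int k\<bar> \<le> real_of_int N" using k N by linarith
    then have kN: "k \<in> {-N..N}" by (simp add: abs_le_iff flip: of_int_abs)
    have "\<bar>s - k * \<epsilon>\<bar> = \<bar>s / \<epsilon> - k\<bar> * \<epsilon>"
    proof -
      have "s - k * \<epsilon> = (s / \<epsilon> - k) * \<epsilon>" using \<epsilon> by (simp add: field_simps)
      then show ?thesis using \<epsilon> by (simp add: abs_mult)
    qed
    also have "\<dots> \<le> \<epsilon>" using k \<epsilon> by simp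
    finally have d: "cmod (cis s - cis (k * \<epsilon>)) \<le> \<epsilon>" using cmod_cis_diff_le order_trans by blast
    have "cmod (z - c k) \<le> cmod (z - \<zeta> * cis s) + cmod (\<zeta> * cis s - c k)"
      using norm_triangle_ineq[of "z - \<zeta> * cis s" "\<zeta> * cis s - c k"] by simp
    also have "z - \<zeta> * cis s = - ((1 - cmod z) *\<^sub>R (\<zeta> * cis s))" by (metis s(2) scaleR_diff_left scaleR_one minus_diff_eq)
    also have "cmod \<dots> = 1 - cmod z" using z \<zeta> by (simp add: norm_mult)
    also have "cmod (\<zeta> * cis s - c k) = cmod (cis s - cis (k * \<epsilon>))"
      using \<zeta> unfolding c_def by (simp add: norm_mult flip: right_diff_distrib)
    finally have "cmod (z - c k) \<le> 2 * \<epsilon>" using d z by simp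
    then show "\<exists>k\<in>{-N..N}. dist (c k) z \<le> 2 * \<epsilon>" using kN by (auto simp: dist_norm norm_minus_commute)
  qed
  have "emeasure lborel {z \<in> disc. cmod (z - \<zeta>) < R \<and> 1 - cmod z \<le> \<epsilon>} \<le>
      emeasure lborel (\<Union>k\<in>{-N..N}. cball (c k) (2 * \<epsilon>))"
    by (intro emeasure_mono cover) auto
  also have "\<dots> \<le> (\<Sum>k\<in>{-N..N}. emeasure lborel (cball (c k) (2 * \<epsilon>)))"
    by (intro emeasure_subadditive_finite) auto
  also have "\<dots> = (\<Sum>k\<in>{-N..N}. ennreal (pi * (2 * \<epsilon>)\<^sup>2))"
    using \<epsilon> by (intro sum.cong refl emeasure_lborel_complex_ball) auto
  also have "\<dots> = ennreal (real (card {-N..N}) * (pi * (2 * \<epsilon>)\<^sup>2))"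
    by (simp add: ennreal_mult ennreal_of_nat_eq_real_of_nat)
  also have "\<dots> \<le> ennreal (68 * pi * R * \<epsilon>)"
  proof (rule ennreal_leI)
    \<comment> \<open>The count is at most 12 R / \<epsilon> + 5, and 1 \<le> R / \<epsilon> turns
      this into 17 R / \<epsilon>. Each ball has area 4 pi \<epsilon>^2, which gives the constant
      68.\<close>
    have "real (card {-N..N}) = 2 * N + 1" using N RE by (simp add: N_def)
    also have "\<dots> \<le> 17 * (R / \<epsilon>)" using N RE by simp
    finally have "real (card {-N..N}) * (pi * (2 * \<epsilon>)\<^sup>2) \<le> 17 * (R / \<epsilon>) * (pi * (2 * \<epsilon>)\<^sup>2)"
      by (intro mult_right_mono) auto
    also have "\<dots> = 68 * pi * R * \<epsilon>" using \<epsilon> by (simp add: power2_eq_square)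
    finally show "real (card {-N..N}) * (pi * (2 * \<epsilon>)\<^sup>2) \<le> 68 * pi * R * \<epsilon>" .
  qed
  finally show ?thesis .
qed

section \<open>Dyadic decompositions\<close>

lemma dyadic_scale:
  assumes "0 < y" "y \<le> (R::real)"
  shows "\<exists>j. R / 2 ^ Suc j < y \<and> y \<le> R / 2 ^ j"
proof -
  have "\<exists>n. R / y < 2 ^ n" by (rule real_arch_pow) simp
  define n where "n = (LEAST n. R / y < 2 ^ n)"
  have n: "R / y < 2 ^ n" unfolding n_def by (rule LeastI_ex) fact
  have "n \<noteq> 0" using n assms by (cases n) (auto simp: field_simps)
  then obtain j where j: "n = Suc j" by (cases n) auto
  have "\<not> R / y < 2 ^ j" using not_less_Least[of j "\<lambda>n. R / y < 2 ^ n"] j n_def by simp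
  then show ?thesis using n j assms by (intro exI[of _ j]) (auto simp: field_simps)
qed

text \<open>Each value of F is dominated by a single term, hence by the sum of all
  \<open>G j\<close>. The pieces of a decomposition may therefore overlap, and only the geometric
  decay of their integrals has to be checked.\<close>

lemma nn_integral_le_geometric:
  assumes meas: "\<And>j. G j \<in> borel_measurable M"
    and le: "\<And>z. \<exists>j. F z \<le> G j z"
    and int: "\<And>j. (\<integral>\<^sup>+z. G j z \<partial>M) \<le> ennreal (B * q ^ j)"
    and q: "0 \<le> q" "q < 1" and B: "0 \<le> B"
  shows "(\<integral>\<^sup>+z. F z \<partial>M) \<le> ennreal (B / (1 - q))"
proof -
  have "(\<integral>\<^sup>+z. F z \<partial>M) \<le> (\<integral>\<^sup>+z. (\<Sum>j. G j z) \<partial>M)"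
  proof (rule nn_integral_mono)
    fix z
    obtain j where "F z \<le> G j z" using le by blast
    also have "\<dots> \<le> (\<Sum>j. G j z)" using sum_le_suminf[of "\<lambda>j. G j z" "{j}"] by simp
    finally show "F z \<le> (\<Sum>j. G j z)" .
  qed
  also have "\<dots> = (\<Sum>j. (\<integral>\<^sup>+z. G j z \<partial>M))"
    using meas by (rule nn_integral_suminf)
  also have "\<dots> \<le> (\<Sum>j. ennreal (B * q ^ j))"
    by (intro suminf_le int) auto
  also have "\<dots> = ennreal (\<Sum>j. B * q ^ j)"
    using q B by (intro suminf_ennreal2 summable_mult summable_geometric) auto
  also have "(\<Sum>j. B * q ^ j) = B / (1 - q)"
    using q by (simp add: suminf_mult suminf_geometric)
  finally show ?thesis .
qed

text \<open>On one dyadic scale y and R agree up to a factor 2; the absolute value in the constant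
  covers exponents of either sign.\<close>

lemma powr_dyadic_le:
  assumes "R / 2 < y" "y \<le> R" "0 < (R::real)"
  shows "y powr t \<le> 2 powr \<bar>t\<bar> * R powr t"
proof (cases "0 \<le> t")
  case True
  then have "y powr t \<le> R powr t" using assms by (intro powr_mono2) auto
  also have "\<dots> \<le> 2 powr \<bar>t\<bar> * R powr t"
    using mult_right_mono[of 1 "2 powr \<bar>t\<bar>" "R powr t"] by (simp add: ge_one_powr_ge_zero)
  finally show ?thesis .
next
  case False
  then have "y powr t \<le> (R / 2) powr t" using assms by (intro powr_mono2') auto
  also have "\<dots> = 2 powr \<bar>t\<bar> * R powr t" using False assms powr_minus_divide[of 2 t] by (simp add: powr_divide)
  finally show ?thesis .
qed

text \<open>In the cap 1 - |z| is below R, so the scales R / 2^j exhaust it. The j-th layer has area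
  of order R^2 / 2^j and weight of order (R / 2^j)^t, so the terms decay with ratio 2^-(t + 1),
  which is below 1 exactly when t > -1.\<close>

lemma cap_weight_integral_le:
  assumes t: "-1 < t"
  obtains C where "0 < C"
    "\<And>\<zeta> R. cmod \<zeta> = 1 \<Longrightarrow> 0 < R \<Longrightarrow>
      (\<integral>\<^sup>+z\<in>{z \<in> disc. cmod (z - \<zeta>) < R}. ennreal ((1 - cmod z) powr t) \<partial>lborel) \<le> ennreal (C * R powr (t + 2))"
proof -
  define q :: real where "q = 2 powr - (t + 1)"
  have "(2::real) powr - (t + 1) < 2 powr 0" using t by (intro powr_less_mono) auto
  then have q: "0 < q" "q < 1" by (auto simp: q_def)
  define K where "K = 2 powr \<bar>t\<bar> * (68 * pi)"
  have K: "0 < K" by (simp add: K_def)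
  show ?thesis
  proof (rule that[of "K / (1 - q)"])
    show "0 < K / (1 - q)" using K q by simp
    fix \<zeta> :: complex and R :: real
    assume \<zeta>: "cmod \<zeta> = 1" and R: "0 < R"
    define A where "A j = {z \<in> disc. cmod (z - \<zeta>) < R \<and> 1 - cmod z \<le> R / 2 ^ j}" for j :: nat
    define c where "c j = 2 powr \<bar>t\<bar> * (R / 2 ^ j) powr t" for j :: nat
    have [measurable]: "A j \<in> sets borel" for j
      unfolding A_def by measurable
    have "(\<integral>\<^sup>+z\<in>{z \<in> disc. cmod (z - \<zeta>) < R}. ennreal ((1 - cmod z) powr t) \<partial>lborel) \<le>
        ennreal ((K * R powr (t + 2)) / (1 - q))"
    proof (rule nn_integral_le_geometric[where G = "\<lambda>j z. ennreal (c j) * indicator (A j) z"])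
      fix z
      show "\<exists>j. ennreal ((1 - cmod z) powr t) * indicator {z \<in> disc. cmod (z - \<zeta>) < R} z \<le>
          ennreal (c j) * indicator (A j) z"
      proof (cases "z \<in> disc \<and> cmod (z - \<zeta>) < R")
        case True
        have "cmod \<zeta> \<le> cmod z + cmod (z - \<zeta>)" using norm_triangle_sub[of \<zeta> z] by (simp add: norm_minus_commute)
        then obtain j where j: "R / 2 ^ Suc j < 1 - cmod z" "1 - cmod z \<le> R / 2 ^ j"
          using dyadic_scale[of "1 - cmod z" R] True \<zeta> by auto
        have "(1 - cmod z) powr t \<le> c j"
          unfolding c_def using j R by (intro powr_dyadic_le) (auto simp: field_simps)
        then show ?thesis using j True by (intro exI[of _ j]) (auto simp: A_def ennreal_leI)
      qed auto
    next
      fix j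
      have Rj: "0 < R / 2 ^ j" "R / 2 ^ j \<le> R" using R by (auto simp: field_simps)
      have "(\<integral>\<^sup>+z. ennreal (c j) * indicator (A j) z \<partial>lborel) = ennreal (c j) * emeasure lborel (A j)"
        by (rule nn_integral_cmult_indicator) simp
      also have "\<dots> \<le> ennreal (c j) * ennreal (68 * pi * R * (R / 2 ^ j))"
        unfolding A_def by (intro mult_left_mono emeasure_cap_le \<zeta> Rj) auto
      also have "\<dots> = ennreal (c j * (68 * pi * R * (R / 2 ^ j)))"
        using R by (intro ennreal_mult[symmetric]) (auto simp: c_def)
      also have "c j * (68 * pi * R * (R / 2 ^ j)) = K * (R * ((R / 2 ^ j) powr t * (R / 2 ^ j) powr 1))"
        using Rj by (simp add: c_def K_def)
      also have "(R / 2 ^ j) powr t * (R / 2 ^ j) powr 1 = (R / 2 ^ j) powr (t + 1)"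
        by (simp add: powr_add)
      also have "\<dots> = R powr (t + 1) * q ^ j"
      proof -
        have "R / 2 ^ j = R * 2 powr - real j" by (simp add: powr_minus powr_realpow divide_inverse)
        then have "(R / 2 ^ j) powr (t + 1) = R powr (t + 1) * 2 powr (- real j * (t + 1))"
          using R by (simp add: powr_mult powr_powr)
        also have "- real j * (t + 1) = real j * - (t + 1)" by (simp add: algebra_simps)
        finally show ?thesis by (simp only: q_def powr_power)
      qed
      also have "K * (R * (R powr (t + 1) * q ^ j)) = K * R powr (t + 2) * q ^ j"
      proof -
        have "R powr (t + 2) = R powr (1 + (t + 1))" by (rule arg_cong[where f = "(powr) R"]) simp
        also have "\<dots> = R powr 1 * R powr (t + 1)" by (rule powr_add)
        finally show ?thesis using R by (simp only: powr_one mult_ac)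
      qed
      finally show "(\<integral>\<^sup>+z. ennreal (c j) * indicator (A j) z \<partial>lborel) \<le> ennreal (K * R powr (t + 2) * q ^ j)" .
    qed (use q K R in auto)
    then show "(\<integral>\<^sup>+z\<in>{z \<in> disc. cmod (z - \<zeta>) < R}. ennreal ((1 - cmod z) powr t) \<partial>lborel) \<le>
        ennreal (K / (1 - q) * R powr (t + 2))" by simp
  qed
qed

section \<open>Integrals of powers of the kernel \<open>1 - cnj a * z\<close>\<close>

lemma disc_kernel_pos:
  assumes "cmod a < 1" "cmod z < 1"
  shows "1 - cmod a \<le> cmod (1 - cnj a * z)" "1 - cmod z \<le> cmod (1 - cnj a * z)" "0 < cmod (1 - cnj a * z)"
proof -
  have "1 - cmod (cnj a * z) \<le> cmod (1 - cnj a * z)"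
    using norm_triangle_ineq2[of 1 "cnj a * z"] by simp
  moreover have "cmod (cnj a * z) \<le> cmod a" "cmod (cnj a * z) \<le> cmod z"
    using assms by (auto simp: norm_mult mult_left_le mult_left_le_one_le)
  ultimately show "1 - cmod a \<le> cmod (1 - cnj a * z)" "1 - cmod z \<le> cmod (1 - cnj a * z)" by auto
  then show "0 < cmod (1 - cnj a * z)" using assms by linarith
qed

text \<open>The disc is cut according to the dyadic size 2^k (1 - |a|) of the kernel. Such a piece
  lies in a cap of comparable radius about the radial projection \<zeta> of a, so the cap estimate
  bounds its share by a multiple of (2^k (1 - |a|))^(t + 2 - s); the series converges because s > t
  + 2. For a = 0 any \<zeta> on the circle serves.\<close>

lemma forelli_rudin:
  assumes t: "-1 < t" and s: "t + 2 < s"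
  obtains C where "0 < C"
    "\<And>a. cmod a < 1 \<Longrightarrow>
      (\<integral>\<^sup>+z\<in>disc. ennreal ((1 - cmod z) powr t * cmod (1 - cnj a * z) powr - s) \<partial>lborel)
        \<le> ennreal (C * (1 - cmod a) powr (t + 2 - s))"
proof -
  obtain C1 where C1: "0 < C1"
    "\<And>\<zeta> R. cmod \<zeta> = 1 \<Longrightarrow> 0 < R \<Longrightarrow>
      (\<integral>\<^sup>+z\<in>{z \<in> disc. cmod (z - \<zeta>) < R}. ennreal ((1 - cmod z) powr t) \<partial>lborel) \<le> ennreal (C1 * R powr (t + 2))"
    using cap_weight_integral_le[OF t] by blast
  define q :: real where "q = 2 powr (t + 2 - s)"
  have "(2::real) powr (t + 2 - s) < 2 powr 0" using s by (intro powr_less_mono) auto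
  then have q: "0 < q" "q < 1" by (auto simp: q_def)
  define K where "K = C1 * 4 powr (t + 2)"
  have K: "0 < K" using C1 by (simp add: K_def)
  show ?thesis
  proof (rule that[of "K / (1 - q)"])
    show "0 < K / (1 - q)" using K q by simp
    fix a :: complex assume a: "cmod a < 1"
    define \<delta> where "\<delta> = 1 - cmod a"
    have \<delta>: "0 < \<delta>" using a by (simp add: \<delta>_def)
    obtain \<zeta> where \<zeta>: "cmod \<zeta> = 1" "a = cmod a *\<^sub>R \<zeta>"
    proof (cases "a = 0")
      case False
      then show ?thesis by (intro that[of "sgn a"]) (simp_all add: norm_sgn sgn_div_norm)
    qed (use that[of 1] in simp)
    define D where "D k = {z \<in> disc. cmod (z - \<zeta>) < 2 ^ (k + 2) * \<delta>}" for k :: nat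
    define w where "w k = (2 ^ k * \<delta>) powr - s" for k :: nat
    have [measurable]: "D j \<in> sets borel" for j
      unfolding D_def by measurable
    have "(\<integral>\<^sup>+z\<in>disc. ennreal ((1 - cmod z) powr t * cmod (1 - cnj a * z) powr - s) \<partial>lborel) \<le>
        ennreal ((K * \<delta> powr (t + 2 - s)) / (1 - q))"
    proof (rule nn_integral_le_geometric
        [where G = "\<lambda>k z. ennreal (w k) * (ennreal ((1 - cmod z) powr t) * indicator (D k) z)"])
      fix z
      show "\<exists>k. ennreal ((1 - cmod z) powr t * cmod (1 - cnj a * z) powr - s) * indicator disc z \<le>
          ennreal (w k) * (ennreal ((1 - cmod z) powr t) * indicator (D k) z)"
      proof (cases "z \<in> disc")
        case True
        define x where "x = cmod (1 - cnj a * z)"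
        have x: "\<delta> \<le> x" "0 < x" using disc_kernel_pos[OF a, of z] True by (auto simp: x_def \<delta>_def)
        \<comment> \<open>The scale lemma is used with the smaller number \<delta> as its argument
          and x as its top scale. Rearranged, it says that x lies between 2^k \<delta> and 2^(k+1)
          \<delta>.\<close>
        then obtain k where k: "x / 2 ^ Suc k < \<delta>" "\<delta> \<le> x / 2 ^ k"
          using dyadic_scale[of \<delta> x] \<delta> by auto
        have "cmod (z - \<zeta>) = cmod (1 - cnj \<zeta> * z)"
        proof -
          have "cmod (z - \<zeta>) = cmod (cnj \<zeta> * (\<zeta> - z))" using \<zeta>(1) by (simp add: norm_mult norm_minus_commute)
          also have "cnj \<zeta> * (\<zeta> - z) = 1 - cnj \<zeta> * z"
            using complex_norm_square[of \<zeta>] \<zeta>(1) by (simp add: algebra_simps)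
          finally show ?thesis .
        qed
        also have "1 - cnj \<zeta> * z = (1 - cnj a * z) - (1 - cmod a) *\<^sub>R (cnj \<zeta> * z)"
          by (subst \<zeta>(2)) (simp add: algebra_simps scaleR_conv_of_real)
        also have "cmod \<dots> \<le> x + cmod ((1 - cmod a) *\<^sub>R (cnj \<zeta> * z))"
          unfolding x_def by (rule norm_triangle_ineq4)
        also have "\<dots> \<le> x + \<delta>" using True \<zeta>(1) a by (simp add: \<delta>_def norm_mult mult_left_le)
        \<comment> \<open>Replacing a by \<zeta> changes the kernel by at most \<delta>, so the
          radius is below 2^(k+1) \<delta> + 2^k \<delta>; hence the shift by 2 in
          \<open>D\<close>.\<close>
        also have "\<dots> < 2 ^ (k + 2) * \<delta>"
        proof -
          have "x < 2 * (2 ^ k * \<delta>)" using k by (simp add: field_simps)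
          moreover have "\<delta> \<le> 2 ^ k * \<delta>" using \<delta> by simp
          ultimately have "x + \<delta> < 4 * (2 ^ k * \<delta>)" using \<delta> by linarith
          then show ?thesis by simp
        qed
        finally have zD: "z \<in> D k" using True by (simp add: D_def)
        have "x powr - s \<le> w k"
          unfolding w_def using k \<delta> s t by (intro powr_mono2') (auto simp: field_simps)
        then have "(1 - cmod z) powr t * x powr - s \<le> w k * (1 - cmod z) powr t"
          by (subst mult.commute) (intro mult_right_mono, auto)
        then show ?thesis using zD True
          by (intro exI[of _ k]) (auto simp: x_def w_def ennreal_leI simp flip: ennreal_mult)
      qed auto
    next
      fix k
      have "(\<integral>\<^sup>+z. ennreal (w k) * (ennreal ((1 - cmod z) powr t) * indicator (D k) z) \<partial>lborel) =
          ennreal (w k) * (\<integral>\<^sup>+z\<in>D k. ennreal ((1 - cmod z) powr t) \<partial>lborel)"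
        by (rule nn_integral_cmult) measurable
      also have "\<dots> \<le> ennreal (w k) * ennreal (C1 * (2 ^ (k + 2) * \<delta>) powr (t + 2))"
        unfolding D_def using \<delta> by (intro mult_left_mono C1 \<zeta>(1)) auto
      also have "\<dots> = ennreal (w k * (C1 * (2 ^ (k + 2) * \<delta>) powr (t + 2)))"
        using C1 by (intro ennreal_mult[symmetric]) (auto simp: w_def)
      also have "(2 ^ (k + 2) * \<delta>) powr (t + 2) = 4 powr (t + 2) * (2 ^ k * \<delta>) powr (t + 2)"
        using \<delta> by (subst powr_mult[symmetric]) (auto simp: mult_ac)
      also have "w k * (C1 * (4 powr (t + 2) * (2 ^ k * \<delta>) powr (t + 2))) =
          K * (2 ^ k * \<delta>) powr (t + 2 - s)"
        by (simp add: w_def K_def flip: powr_add)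
      also have "(2 ^ k * \<delta>) powr (t + 2 - s) = \<delta> powr (t + 2 - s) * q ^ k"
      proof -
        have "(2 ^ k * \<delta>) powr (t + 2 - s) = (2 powr real k * \<delta>) powr (t + 2 - s)" by (simp add: powr_realpow)
        also have "\<dots> = \<delta> powr (t + 2 - s) * 2 powr (real k * (t + 2 - s))"
          using \<delta> by (simp add: powr_mult powr_powr)
        finally show ?thesis by (simp only: q_def powr_power)
      qed
      finally show "(\<integral>\<^sup>+z. ennreal (w k) * (ennreal ((1 - cmod z) powr t) * indicator (D k) z) \<partial>lborel)
          \<le> ennreal (K * \<delta> powr (t + 2 - s) * q ^ k)" by (simp add: mult_ac)
    qed (use q K \<delta> in auto)
    then show "(\<integral>\<^sup>+z\<in>disc. ennreal ((1 - cmod z) powr t * cmod (1 - cnj a * z) powr - s) \<partial>lborel)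
        \<le> ennreal (K / (1 - q) * (1 - cmod a) powr (t + 2 - s))" by (simp add: \<delta>_def)
  qed
qed

section \<open>Growth of functions in the Morrey space\<close>

lemma esqrt_ennreal: "0 \<le> x \<Longrightarrow> esqrt (ennreal x) = ennreal (sqrt x)"
  by (simp add: esqrt_def)

lemma esqrt_le_iff:
  assumes "0 \<le> y"
  shows "esqrt x \<le> ennreal y \<longleftrightarrow> x \<le> ennreal (y\<^sup>2)"
proof (cases x)
  case (real r)
  then have "esqrt x \<le> ennreal y \<longleftrightarrow> sqrt r \<le> y" using assms by (simp add: esqrt_ennreal ennreal_le_iff)
  also have "\<dots> \<longleftrightarrow> r \<le> y\<^sup>2" using assms real by (simp add: real_sqrt_le_iff')
  finally show ?thesis using real by (simp add: ennreal_le_iff)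
qed (simp add: esqrt_def top_unique)

lemma area_integral_mono:
  assumes "A \<subseteq> B" "\<And>z. z \<in> A \<Longrightarrow> F z \<le> G z"
  shows "area_integral A F \<le> area_integral B G"
  unfolding area_integral_def using assms
  by (intro mult_left_mono nn_integral_mono) (auto simp: indicator_def ennreal_leI)

text \<open>The form in which the sub-mean value property is applied, to a Carleson box and to the
  whole disc. A lower bound c of the weight on the ball is absorbed into the function as a factor
  sqrt c, and the pi of the area cancels against the normalization of dm.\<close>

lemma area_integral_ge_center:
  assumes F: "F holomorphic_on ball a r" and r: "0 < r" and c: "0 \<le> c"
    and A: "ball a r \<subseteq> A" and le: "\<And>z. z \<in> ball a r \<Longrightarrow> c * (cmod (F z))\<^sup>2 \<le> G z"
  shows "ennreal (c * r\<^sup>2 * (cmod (F a))\<^sup>2) \<le> area_integral A G"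
proof -
  have sc: "(cmod (of_real (sqrt c) * F z))\<^sup>2 = c * (cmod (F z))\<^sup>2" for z
    using c by (simp add: norm_mult power_mult_distrib)
  have "ennreal (pi * r\<^sup>2 * (c * (cmod (F a))\<^sup>2)) \<le>
      (\<integral>\<^sup>+z\<in>ball a r. ennreal (c * (cmod (F z))\<^sup>2) \<partial>lborel)"
    using cmod_square_center_le_area[of "\<lambda>z. of_real (sqrt c) * F z" a r] F r
    unfolding sc by (simp add: holomorphic_intros)
  then have "ennreal (1 / pi) * ennreal (pi * r\<^sup>2 * (c * (cmod (F a))\<^sup>2)) \<le>
      area_integral (ball a r) (\<lambda>z. c * (cmod (F z))\<^sup>2)"
    unfolding area_integral_def by (rule mult_left_mono) simp
  also have "\<dots> \<le> area_integral A G"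
    using A le by (rule area_integral_mono)
  finally show ?thesis
    using c by (simp add: mult_ac flip: ennreal_mult)
qed

lemma ball_in_disc:
  assumes "cmod a < 1"
  shows "ball a ((1 - cmod a) / 2) \<subseteq> disc"
    and "z \<in> ball a ((1 - cmod a) / 2) \<Longrightarrow> (1 - cmod a) / 2 \<le> 1 - (cmod z)\<^sup>2"
proof -
  have *: "cmod z < cmod a + (1 - cmod a) / 2" if "z \<in> ball a ((1 - cmod a) / 2)" for z
    using that norm_triangle_sub[of z a] by (simp add: dist_norm norm_minus_commute field_simps)
  show "ball a ((1 - cmod a) / 2) \<subseteq> disc"
    using * assms by (force simp: field_simps)
  assume z: "z \<in> ball a ((1 - cmod a) / 2)"
  have "(cmod z)\<^sup>2 \<le> cmod z * 1"
    unfolding power2_eq_square using *[OF z] assms by (intro mult_left_mono) (auto simp: field_simps)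
  then show "(1 - cmod a) / 2 \<le> 1 - (cmod z)\<^sup>2" using *[OF z] by (simp add: field_simps)
qed

text \<open>The arc is centred at the argument of a. Length 2 (1 - |a|) leaves room radially, since
  |z| drops by at most half of 1 - |a|, and angularly, since the angle between z and a is at most 3
  h, below the half-angle pi h. For |a| \<le> 1 / 2 the box is the whole disc.\<close>

lemma ball_in_carleson_box:
  assumes a: "cmod a < 1"
  defines "h \<equiv> min 1 (2 * (1 - cmod a))"
  shows "ball a ((1 - cmod a) / 2) \<subseteq> carleson_box (Arg a - pi * h) h"
proof (cases "h = 1")
  case True
  then show ?thesis using ball_in_disc(1)[OF a] by (simp add: carleson_box_def)
next
  case False
  define \<delta> where "\<delta> = 1 - cmod a"
  have h: "h = 2 * \<delta>" and \<delta>: "0 < \<delta>" "\<delta> < 1 / 2"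
    using False a by (auto simp: h_def \<delta>_def min_def split: if_splits)
  show ?thesis
  proof
    fix z assume z: "z \<in> ball a ((1 - cmod a) / 2)"
    have za: "cmod (z - a) < \<delta> / 2" using z by (simp add: \<delta>_def dist_norm norm_minus_commute)
    have ca: "cmod a > 1 / 2" using \<delta> by (simp add: \<delta>_def)
    have dz: "\<bar>cmod z - cmod a\<bar> \<le> cmod (z - a)" by (rule norm_triangle_ineq3)
    then have zl: "1 - h \<le> cmod z" "0 < cmod z" using za \<delta> h by (auto simp: \<delta>_def)
    have nz: "z \<noteq> 0" "a \<noteq> 0" using zl ca by auto
    define w where "w = (z / cmod z) / (a / cmod a)"
    have w: "cmod w = 1" "w \<noteq> 0" using nz by (auto simp: w_def norm_divide norm_mult)
    have "z / cmod z = w * (a / cmod a)" using nz by (simp add: w_def)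
    then have "z / cmod z - a / cmod a = (w - 1) * (a / cmod a)" by (simp only: left_diff_distrib mult_1)
    then have "cmod (z / cmod z - a / cmod a) = cmod (w - 1) * cmod (a / cmod a)" by (simp only: norm_mult)
    also have "cmod (a / cmod a) = 1" using nz by (simp add: norm_divide)
    finally have "cmod (w - 1) = cmod (z / cmod z - a / cmod a)" by (simp only: mult_1_right)
    \<comment> \<open>The first summand is the error in the modulus, the second the displacement
      itself. Each is at most |z - a| / |a|, which is below \<delta> because |z - a| < \<delta> / 2
      and |a| > 1 / 2.\<close>
    also have "z / cmod z - a / cmod a = (z / cmod z) * of_real ((cmod a - cmod z) / cmod a) + (z - a) / cmod a"
      using nz by (simp add: field_simps)
    also have "cmod \<dots> \<le> cmod ((z / cmod z) * of_real ((cmod a - cmod z) / cmod a)) + cmod ((z - a) / cmod a)"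
      by (rule norm_triangle_ineq)
    also have "\<dots> = \<bar>cmod a - cmod z\<bar> / cmod a + cmod (z - a) / cmod a"
      using nz by (simp add: norm_mult norm_divide del: of_real_diff)
    also have "\<dots> \<le> cmod (z - a) / cmod a + cmod (z - a) / cmod a"
      using dz by (intro add_mono divide_right_mono) auto
    also have "\<dots> \<le> 2 * \<delta>"
    proof -
      have "2 * cmod (z - a) \<le> 2 * \<delta> * cmod a"
        using mult_strict_left_mono[OF ca, of "2 * \<delta>"] za \<delta> by linarith
      moreover have "0 < cmod a" using ca by linarith
      ultimately show ?thesis by (simp add: pos_divide_le_eq flip: add_divide_distrib)
    qed
    finally have w1: "cmod (w - 1) \<le> 2 * \<delta>" .
    have ws: "cis (Arg w) = w" using cis_Arg[of w] w by (simp add: sgn_div_norm)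
    have as: "cis (Arg a) = a / cmod a" using cis_Arg[of a] nz by (simp add: sgn_div_norm scaleR_conv_of_real field_simps)
    have "\<bar>Arg w\<bar> \<le> 3 * cmod (w - 1)"
      using abs_le_cmod_cis_diff_1[of "Arg w"] Arg_bounded[of w] ws by auto
    then have "\<bar>Arg w\<bar> \<le> 3 * h" using w1 h by simp
    also have "\<dots> \<le> pi * h" using pi_gt3 h \<delta> by (intro mult_right_mono) auto
    finally have "Arg a + Arg w \<in> arc_angles (Arg a - pi * h) h"
      by (auto simp: arc_angles_def abs_le_iff)
    moreover have "z / cmod z = cis (Arg a + Arg w)"
    proof -
      have "cis (Arg a + Arg w) = (a / cmod a) * w" by (simp only: ws as flip: cis_mult)
      also have "\<dots> = z / cmod z" using nz by (simp add: w_def)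
      finally show ?thesis ..
    qed
    ultimately have "z / cmod z \<in> cis ` arc_angles (Arg a - pi * h) h" by blast
    then show "z \<in> carleson_box (Arg a - pi * h) h"
      using False zl ball_in_disc(1)[OF a] z by (auto simp: carleson_box_def)
  qed
qed

section \<open>From the Morrey norm to pointwise growth\<close>

lemma morrey_norm_le_imp:
  assumes "morrey_norm lam f \<le> ennreal N" and N: "0 \<le> N"
  shows "cmod (f 0) \<le> N"
    and "0 < h \<Longrightarrow> h \<le> 1 \<Longrightarrow>
      area_integral (carleson_box \<theta> h) (\<lambda>z. (cmod (deriv f z))\<^sup>2 * (1 - (cmod z)\<^sup>2)) \<le> ennreal (N\<^sup>2 * h powr lam)"
proof -
  let ?S = "SUP \<theta>. SUP h\<in>{0<..1}. esqrt (ennreal (1 / (h powr lam)) *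
        area_integral (carleson_box \<theta> h) (\<lambda>z. (cmod (deriv f z))\<^sup>2 * (1 - (cmod z)\<^sup>2)))"
  have le: "ennreal (cmod (f 0)) + ?S \<le> ennreal N" using assms(1) unfolding morrey_norm_def .
  have "ennreal (cmod (f 0)) \<le> ennreal N" by (rule order_trans[OF _ le]) simp
  then show "cmod (f 0) \<le> N" using N by simp
  assume h: "0 < h" "h \<le> 1"
  let ?I = "area_integral (carleson_box \<theta> h) (\<lambda>z. (cmod (deriv f z))\<^sup>2 * (1 - (cmod z)\<^sup>2))"
  have "esqrt (ennreal (1 / (h powr lam)) * ?I) \<le> (SUP h\<in>{0<..1}. esqrt (ennreal (1 / (h powr lam)) *
        area_integral (carleson_box \<theta> h) (\<lambda>z. (cmod (deriv f z))\<^sup>2 * (1 - (cmod z)\<^sup>2))))"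
    using h by (intro SUP_upper) auto
  also have "\<dots> \<le> ?S" by (rule SUP_upper) simp
  also have "\<dots> \<le> ennreal N" by (rule order_trans[OF _ le]) simp
  finally have "ennreal (1 / (h powr lam)) * ?I \<le> ennreal (N\<^sup>2)" using N by (simp add: esqrt_le_iff)
  then have "ennreal (h powr lam) * (ennreal (1 / (h powr lam)) * ?I) \<le> ennreal (h powr lam) * ennreal (N\<^sup>2)"
    by (rule mult_left_mono) simp
  moreover have "ennreal (h powr lam) * (ennreal (1 / (h powr lam)) * ?I) = ?I"
    using h by (simp flip: mult.assoc ennreal_mult)
  ultimately show "?I \<le> ennreal (N\<^sup>2 * h powr lam)" by (simp add: mult.commute flip: ennreal_mult)
qed

text \<open>With \<delta> = 1 - |a|, the ball about a carries weight at least \<delta> / 2 and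
  radius \<delta> / 2, so \<delta>^3 |f'(a)|^2 / 8 is at most the integral over a box with h \<le> 2
  \<delta>. That integral is at most 2 N^2 \<delta>^lam; taking roots gives the factor 4 and the
  exponent.\<close>

lemma morrey_deriv_growth:
  assumes f: "f holomorphic_on disc" and lam: "0 < lam" "lam < 1"
    and norm: "morrey_norm lam f \<le> ennreal N" and N: "0 \<le> N" and a: "cmod a < 1"
  shows "cmod (deriv f a) \<le> 4 * N * (1 - cmod a) powr ((lam - 3) / 2)"
proof -
  define \<delta> where "\<delta> = 1 - cmod a"
  define h where "h = min 1 (2 * \<delta>)"
  have \<delta>: "0 < \<delta>" using a by (simp add: \<delta>_def)
  have "ennreal (\<delta> / 2 * (\<delta> / 2)\<^sup>2 * (cmod (deriv f a))\<^sup>2) \<le>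
      area_integral (carleson_box (Arg a - pi * h) h) (\<lambda>z. (cmod (deriv f z))\<^sup>2 * (1 - (cmod z)\<^sup>2))"
  proof (rule area_integral_ge_center[where F = "deriv f"])
    show "deriv f holomorphic_on ball a (\<delta> / 2)"
      using holomorphic_deriv[OF f] ball_in_disc(1)[OF a] by (auto simp: \<delta>_def intro: holomorphic_on_subset)
    show "ball a (\<delta> / 2) \<subseteq> carleson_box (Arg a - pi * h) h"
      using ball_in_carleson_box[OF a] by (simp add: \<delta>_def h_def)
    show "\<delta> / 2 * (cmod (deriv f z))\<^sup>2 \<le> (cmod (deriv f z))\<^sup>2 * (1 - (cmod z)\<^sup>2)" if "z \<in> ball a (\<delta> / 2)" for z
      using ball_in_disc(2)[OF a] that by (subst mult.commute, intro mult_left_mono) (auto simp: \<delta>_def)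
  qed (use \<delta> in auto)
  also have "\<dots> \<le> ennreal (N\<^sup>2 * h powr lam)"
    using \<delta> by (intro morrey_norm_le_imp(2)[OF norm N]) (auto simp: h_def)
  finally have "\<delta> / 2 * (\<delta> / 2)\<^sup>2 * (cmod (deriv f a))\<^sup>2 \<le> N\<^sup>2 * h powr lam"
    by (simp add: ennreal_le_iff)
  also have "\<dots> \<le> N\<^sup>2 * (2 * \<delta> powr lam)"
  proof (rule mult_left_mono)
    have "h powr lam \<le> (2 * \<delta>) powr lam" using \<delta> lam by (intro powr_mono2) (auto simp: h_def)
    also have "\<dots> = 2 powr lam * \<delta> powr lam" using \<delta> by (simp add: powr_mult)
    also have "\<dots> \<le> 2 powr 1 * \<delta> powr lam" using lam by (intro mult_right_mono powr_mono) auto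
    finally show "h powr lam \<le> 2 * \<delta> powr lam" by simp
  qed simp
  finally have "\<delta> ^ 3 * (cmod (deriv f a))\<^sup>2 \<le> 16 * N\<^sup>2 * \<delta> powr lam"
    by (simp add: power2_eq_square power3_eq_cube)
  then have "(cmod (deriv f a))\<^sup>2 \<le> 16 * N\<^sup>2 * (\<delta> powr lam / \<delta> ^ 3)"
    using \<delta> by (simp add: field_simps)
  also have "\<delta> powr lam / \<delta> ^ 3 = (\<delta> powr ((lam - 3) / 2))\<^sup>2"
  proof -
    have "\<delta> powr lam / \<delta> ^ 3 = \<delta> powr lam / \<delta> powr 3" using \<delta> by simp
    also have "\<dots> = \<delta> powr (lam - 3)" by (rule powr_diff[symmetric])
    finally show ?thesis by (simp add: power2_eq_square flip: powr_add)
  qed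
  also have "16 * N\<^sup>2 * (\<delta> powr ((lam - 3) / 2))\<^sup>2 = (4 * N * \<delta> powr ((lam - 3) / 2))\<^sup>2"
    by (simp add: power_mult_distrib)
  finally show ?thesis
    using N by (simp add: \<delta>_def abs_le_square_iff[symmetric])
qed

text \<open>The derivative bound is integrated along the radius from 0 to a. The value at 0 is
  absorbed by the factor (1 - |a|)^((lam - 1) / 2), which is at least 1 since lam < 1.\<close>

lemma morrey_growth:
  assumes f: "f holomorphic_on disc" and lam: "0 < lam" "lam < 1"
    and norm: "morrey_norm lam f \<le> ennreal N" and N: "0 \<le> N" and a: "cmod a < 1"
  shows "cmod (f a) \<le> (1 + 8 / (1 - lam)) * N * (1 - cmod a) powr ((lam - 1) / 2)"
proof -
  define r where "r = cmod a"
  have r: "0 \<le> r" "r < 1" using a by (auto simp: r_def)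
  \<comment> \<open>The constant makes the derivative of \<phi> equal to the majorant of the
    derivative of f along the segment: K (1 - lam) / 2 = 4 N.\<close>
  define K where "K = 8 * N / (1 - lam)"
  define \<phi> where "\<phi> t = K * (1 - r * t) powr ((lam - 1) / 2)" for t
  have rt: "0 < 1 - r * t" if "t \<in> {0..1}" for t
    using that r mult_left_le[of t r] by auto
  have "norm (f (of_real 1 * a) - f (of_real 0 * a)) \<le> \<phi> 1 - \<phi> 0"
  proof (rule differentiable_bound_general[where f' = "\<lambda>t. a * deriv f (of_real t * a)"
      and \<phi>' = "\<lambda>t. r * (4 * N * (1 - r * t) powr ((lam - 3) / 2))" and f = "\<lambda>t. f (of_real t * a)"])
    have ta: "of_real t * a \<in> disc" if "t \<in> {0..1}" for t
      using rt[OF that] that by (simp add: norm_mult r_def mult.commute)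
    show "continuous_on {0..1} \<phi>"
    proof -
      have "1 - r * t \<noteq> 0" if "t \<in> {0..1}" for t using rt[OF that] by simp
      then show ?thesis unfolding \<phi>_def by (intro continuous_intros) auto
    qed
    show "continuous_on {0..1} (\<lambda>t. f (of_real t * a))"
      using ta by (intro continuous_on_compose2[OF holomorphic_on_imp_continuous_on[OF f]] continuous_intros) auto
    fix t :: real assume t: "0 < t" "t < 1"
    have t': "t \<in> {0..1}" using t by simp
    have "(\<phi> has_real_derivative r * (4 * N * (1 - r * t) powr ((lam - 3) / 2))) (at t)"
    proof -
      have "(\<phi> has_real_derivative K *
          ((lam - 1) / 2 * (1 - r * t) powr ((lam - 1) / 2 - 1) * (- r))) (at t)"
        unfolding \<phi>_def[abs_def] using rt[OF t'] by (auto intro!: derivative_eq_intros)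
      also have "(lam - 1) / 2 - 1 = (lam - 3) / 2" by (simp add: field_simps)
      also have "K * ((lam - 1) / 2 * (1 - r * t) powr ((lam - 3) / 2) * (- r)) =
          r * (4 * N * (1 - r * t) powr ((lam - 3) / 2))"
        using lam by (simp add: K_def field_simps)
      finally show ?thesis .
    qed
    then show "(\<phi> has_vector_derivative r * (4 * N * (1 - r * t) powr ((lam - 3) / 2))) (at t)"
      by (simp add: has_real_derivative_iff_has_vector_derivative)
    have "(f has_field_derivative deriv f (of_real t * a)) (at (of_real t * a))"
      using ta[OF t'] by (intro holomorphic_derivI[OF f]) auto
    moreover have "((\<lambda>t. of_real t * a) has_vector_derivative a) (at t)"
    proof -
      have "((\<lambda>t. t *\<^sub>R a) has_vector_derivative a) (at t)" by (auto intro!: derivative_eq_intros)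
      then show ?thesis by (simp add: scaleR_conv_of_real)
    qed
    ultimately show "((\<lambda>t. f (of_real t * a)) has_vector_derivative a * deriv f (of_real t * a)) (at t)"
      using field_vector_diff_chain_at[of "\<lambda>t. of_real t * a"] by (simp add: o_def)
    have "cmod (deriv f (of_real t * a)) \<le> 4 * N * (1 - cmod (of_real t * a)) powr ((lam - 3) / 2)"
      using ta[OF t'] by (intro morrey_deriv_growth[OF f lam norm N]) auto
    also have "cmod (of_real t * a) = r * t" using t by (simp add: norm_mult r_def)
    finally show "norm (a * deriv f (of_real t * a)) \<le> r * (4 * N * (1 - r * t) powr ((lam - 3) / 2))"
      unfolding norm_mult r_def by (intro mult_left_mono) auto
  qed auto
  also have "\<dots> \<le> \<phi> 1" unfolding \<phi>_def K_def using lam N by simp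
  finally have "cmod (f a - f 0) \<le> \<phi> 1" by simp
  moreover have "cmod (f a) \<le> cmod (f 0) + cmod (f a - f 0)" by (rule norm_triangle_sub)
  moreover have "cmod (f 0) \<le> N" by (rule morrey_norm_le_imp(1)[OF norm N])
  ultimately have "cmod (f a) \<le> N * 1 + 8 * N / (1 - lam) * (1 - r) powr ((lam - 1) / 2)"
    by (simp add: \<phi>_def K_def)
  also have "\<dots> \<le> N * (1 - r) powr ((lam - 1) / 2) + 8 * N / (1 - lam) * (1 - r) powr ((lam - 1) / 2)"
  proof -
    have "1 powr ((lam - 1) / 2) \<le> (1 - r) powr ((lam - 1) / 2)"
      using lam r by (intro powr_mono2') auto
    then show ?thesis using N by (intro add_right_mono mult_left_mono) auto
  qed
  also have "\<dots> = (1 + 8 / (1 - lam)) * N * (1 - r) powr ((lam - 1) / 2)"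
    by (simp add: algebra_simps)
  finally show ?thesis by (simp add: r_def)
qed

section \<open>The integral operator and the upper bound for its essential norm\<close>

lemma T_op_has_field_derivative:
  assumes f: "f holomorphic_on disc" and g: "g holomorphic_on disc" and z: "z \<in> disc"
  shows "(T_op g f has_field_derivative f z * deriv g z) (at z)"
proof -
  have "(\<lambda>w. f w * deriv g w) holomorphic_on disc"
    using f g by (intro holomorphic_intros holomorphic_deriv) auto
  then obtain G where G: "\<And>x. x \<in> disc \<Longrightarrow> (G has_field_derivative f x * deriv g x) (at x within disc)"
    using holomorphic_convex_primitive'[of disc] by auto
  have eq: "T_op g f x = G x - G 0" if "x \<in> disc" for x
  proof -
    have "((\<lambda>w. f w * deriv g w) has_contour_integral (G (pathfinish (linepath 0 x)) - G (pathstart (linepath 0 x))))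
        (linepath 0 x)"
      using that by (intro contour_integral_primitive[OF G]) (auto simp: closed_segment_subset)
    then show ?thesis using that by (simp add: T_op_def contour_integral_unique)
  qed
  have "((\<lambda>x. G x - G 0) has_field_derivative f z * deriv g z) (at z)"
    using G[OF z] z by (auto simp: at_within_open[of _ disc] intro!: derivative_eq_intros)
  then show ?thesis
    by (rule has_field_derivative_transform_within_open[of _ _ _ disc]) (use z eq in auto)
qed

lemma T_op_analytic:
  assumes "f holomorphic_on disc" "g holomorphic_on disc"
  shows "T_op g f \<in> analytic_disc"
  using T_op_has_field_derivative[OF assms]
  by (auto simp: analytic_disc_def T_op_def holomorphic_on_open intro!: exI)

lemma T_op_0 [simp]: "T_op g f 0 = 0"
  by (simp add: T_op_def)

lemma T_op_integrand_integrable: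
  assumes u: "u holomorphic_on disc" and g: "g holomorphic_on disc" and z: "z \<in> disc"
  shows "(\<lambda>w. u w * deriv g w) contour_integrable_on linepath 0 z"
proof (rule contour_integrable_continuous_linepath)
  have "closed_segment 0 z \<subseteq> disc" using z by (intro closed_segment_subset) auto
  moreover have "(\<lambda>w. u w * deriv g w) holomorphic_on disc"
    using u g by (intro holomorphic_intros holomorphic_deriv) auto
  ultimately show "continuous_on (closed_segment 0 z) (\<lambda>w. u w * deriv g w)"
    by (intro continuous_on_subset[OF holomorphic_on_imp_continuous_on])
qed

lemma T_op_add:
  assumes "f holomorphic_on disc" "f' holomorphic_on disc" "g holomorphic_on disc"
  shows "T_op g (\<lambda>z. f z + f' z) = (\<lambda>z. T_op g f z + T_op g f' z)"
  using assms by (auto simp: T_op_def fun_eq_iff distrib_right contour_integral_add T_op_integrand_integrable)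

lemma T_op_cmult:
  assumes "f holomorphic_on disc" "g holomorphic_on disc"
  shows "T_op g (\<lambda>z. c * f z) = (\<lambda>z. c * T_op g f z)"
  using assms by (auto simp: T_op_def fun_eq_iff mult.assoc contour_integral_lmul T_op_integrand_integrable)

lemma continuous_on_compact_bound:
  fixes f :: "'a::topological_space \<Rightarrow> 'b::real_normed_vector"
  assumes "compact K" "continuous_on K f"
  obtains b where "0 \<le> b" "\<And>z. z \<in> K \<Longrightarrow> norm (f z) \<le> b"
proof -
  obtain b where b: "\<forall>z\<in>f ` K. norm z \<le> b"
    using compact_imp_bounded[OF compact_continuous_image[OF assms(2,1)]] by (auto simp: bounded_iff)
  have "norm (f z) \<le> max b 0" if "z \<in> K" for z using b that by (simp add: le_max_iff_disj)
  then show thesis by (intro that[of "max b 0"]) auto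
qed

lemma one_minus_square_bounds:
  fixes x :: real
  assumes "0 \<le> x" "x \<le> 1"
  shows "1 - x \<le> 1 - x\<^sup>2" "1 - x\<^sup>2 \<le> 2 * (1 - x)" "0 \<le> 1 - x\<^sup>2" "1 - x\<^sup>2 \<le> 1"
proof -
  have "1 - x\<^sup>2 = (1 - x) * (1 + x)" by (simp add: power2_eq_square algebra_simps)
  moreover have "(1 - x) * 1 \<le> (1 - x) * (1 + x)" "(1 - x) * (1 + x) \<le> (1 - x) * 2"
    using assms by (intro mult_left_mono; simp)+
  ultimately show "1 - x \<le> 1 - x\<^sup>2" "1 - x\<^sup>2 \<le> 2 * (1 - x)" by auto
  then show "0 \<le> 1 - x\<^sup>2" using assms by linarith
qed simp

lemma bloch_seminorm_le:
  assumes "\<And>z. z \<in> disc \<Longrightarrow> (1 - (cmod z)\<^sup>2) * cmod (deriv u z) \<le> b"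
  shows "bloch_seminorm u \<le> ennreal b"
  unfolding bloch_seminorm_def using assms by (intro SUP_least ennreal_leI) auto

lemma T_op_in_bloch:
  assumes u: "u holomorphic_on disc" and g: "g holomorphic_on disc"
    and le: "\<And>z. z \<in> disc \<Longrightarrow> (1 - (cmod z)\<^sup>2) * cmod (u z * deriv g z) \<le> b"
  shows "T_op g u \<in> bloch"
proof -
  have "bloch_seminorm (T_op g u) \<le> ennreal b"
    by (rule bloch_seminorm_le)
      (simp only: DERIV_imp_deriv[OF T_op_has_field_derivative[OF u g]] le)
  then show ?thesis
    using T_op_analytic[OF u g] by (auto simp: bloch_def intro: le_less_trans)
qed

text \<open>Both images vanish at 0, so the Bloch norm of the difference is its seminorm, and
  differentiation removes the integral.\<close>

lemma bloch_norm_T_op_diff_le: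
  assumes u: "u holomorphic_on disc" and v: "v holomorphic_on disc" and g: "g holomorphic_on disc"
    and le: "\<And>z. z \<in> disc \<Longrightarrow> (1 - (cmod z)\<^sup>2) * (cmod (u z - v z) * cmod (deriv g z)) \<le> b"
  shows "bloch_norm (\<lambda>z. T_op g u z - T_op g v z) \<le> ennreal b"
proof -
  have "deriv (\<lambda>z. T_op g u z - T_op g v z) z = (u z - v z) * deriv g z" if "z \<in> disc" for z
    by (rule DERIV_imp_deriv)
      (use T_op_has_field_derivative[OF u g that] T_op_has_field_derivative[OF v g that]
        in \<open>auto intro!: derivative_eq_intros simp: algebra_simps\<close>)
  then have "bloch_seminorm (\<lambda>z. T_op g u z - T_op g v z) \<le> ennreal b"
    using le by (intro bloch_seminorm_le) (simp add: norm_mult)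
  then show ?thesis by (simp add: bloch_norm_def)
qed

lemma tendsto_0_ennrealI:
  assumes "\<And>e. 0 < e \<Longrightarrow> eventually (\<lambda>x. f x \<le> ennreal e) F"
  shows "(f \<longlongrightarrow> 0) F"
proof (rule order_tendstoI)
  fix a :: ennreal assume "0 < a"
  then obtain b where b: "0 < b" "b < a" using dense by blast
  then obtain e where e: "b = ennreal e" "0 < e" by (cases b) (auto simp: top_unique)
  show "eventually (\<lambda>x. f x < a) F"
    using assms[OF e(2)] by eventually_elim (use b e in auto)
qed simp

section \<open>Dilations and the compact approximants\<close>

lemma holomorphic_on_disc_dilate:
  assumes "f holomorphic_on disc" "0 \<le> r" "r < 1"
  shows "(\<lambda>z. f (of_real r * z)) holomorphic_on disc"
proof (rule holomorphic_on_compose_gen[OF _ assms(1), unfolded o_def])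
  show "(*) (complex_of_real r) ` disc \<subseteq> disc"
  proof clarsimp
    fix z assume "cmod z < 1"
    then have "r * cmod z \<le> cmod z" using assms by (intro mult_left_le_one_le) auto
    then show "cmod (of_real r * z) < 1" using \<open>cmod z < 1\<close> assms by (simp add: norm_mult)
  qed
qed (auto intro!: holomorphic_intros)

lemma dilate_mem_cball:
  assumes "z \<in> disc" "0 \<le> r"
  shows "of_real r * z \<in> cball 0 r"
  using assms by (simp add: norm_mult mult_left_le)

text \<open>A norm-bounded sequence is locally bounded by the growth estimate, so Montel's theorem
  extracts a locally uniform limit. After dilation only its values on the compact disc of radius r
  enter, and there the convergence is uniform; the Bloch bound B of g turns it into convergence in
  Bloch norm.\<close>

lemma dilated_T_op_compact:
  assumes g: "g holomorphic_on disc" and lam: "0 < lam" "lam < 1" and r: "0 \<le> r" "r < 1"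
    and B: "\<And>z. z \<in> disc \<Longrightarrow> (1 - (cmod z)\<^sup>2) * cmod (deriv g z) \<le> B"
  shows "compact_operator (morrey lam) (morrey_norm lam) bloch bloch_norm (\<lambda>f. T_op g (\<lambda>z. f (of_real r * z)))"
proof -
  have B0: "0 \<le> B" using B[of 0] by (simp add: order_trans[OF norm_ge_zero])
  have hol: "f holomorphic_on disc" if "f \<in> morrey lam" for f
    using that by (simp add: morrey_def hardy2_def analytic_disc_def)
  note dil = holomorphic_on_disc_dilate[OF _ r]
  have weight: "(1 - (cmod z)\<^sup>2) * (b * cmod (deriv g z)) \<le> c * B" if "z \<in> disc" "b \<le> c" "0 \<le> b" for z b c
  proof -
    have "(1 - (cmod z)\<^sup>2) * (b * cmod (deriv g z)) = b * ((1 - (cmod z)\<^sup>2) * cmod (deriv g z))" by simp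
    also have "\<dots> \<le> c * B" using that B B0 one_minus_square_bounds(3)[of "cmod z"]
      by (intro mult_mono) auto
    finally show ?thesis .
  qed
  \<comment> \<open>Stated for every holomorphic f, because it is also applied to the Montel limit,
    for which only holomorphy is at hand.\<close>
  have mem: "T_op g (\<lambda>z. f (of_real r * z)) \<in> bloch" if f: "f holomorphic_on disc" for f
  proof -
    have "continuous_on (cball 0 r) f"
      using f r by (intro continuous_on_subset[OF holomorphic_on_imp_continuous_on]) auto
    then obtain b where b: "\<And>z. z \<in> cball 0 r \<Longrightarrow> cmod (f z) \<le> b"
      using continuous_on_compact_bound[OF compact_cball] by blast
    show ?thesis
    proof (rule T_op_in_bloch[OF dil[OF f] g])
      fix z :: complex assume z: "z \<in> disc"
      show "(1 - (cmod z)\<^sup>2) * cmod (f (of_real r * z) * deriv g z) \<le> b * B"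
        unfolding norm_mult using b[OF dilate_mem_cball[OF z r(1)]] z by (intro weight) auto
    qed
  qed
  show ?thesis unfolding compact_operator_def
  proof (intro conjI allI impI)
    show "linear_between (morrey lam) bloch (\<lambda>f. T_op g (\<lambda>z. f (of_real r * z)))"
      unfolding linear_between_def
      using mem hol T_op_add[OF dil dil g] T_op_cmult[OF dil g] by blast
    fix F :: "nat \<Rightarrow> fn"
    assume "(\<forall>n. F n \<in> morrey lam) \<and> (\<exists>C::real. \<forall>n. morrey_norm lam (F n) \<le> ennreal C)"
    then obtain C where F: "\<And>n. F n \<in> morrey lam" and C: "\<And>n. morrey_norm lam (F n) \<le> ennreal C"
      by auto
    have C': "morrey_norm lam (F n) \<le> ennreal (max C 0)" for n
      by (rule order_trans[OF C]) (simp add: ennreal_leI)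
    have bdd: "\<exists>b. \<forall>h\<in>range F. \<forall>z\<in>K. cmod (h z) \<le> b" if K: "compact K" "K \<subseteq> disc" for K
    proof -
      have "continuous_on K (\<lambda>z. (1 + 8 / (1 - lam)) * max C 0 * (1 - cmod z) powr ((lam - 1) / 2))"
        using K by (intro continuous_intros) auto
      then obtain b where b: "\<And>z. z \<in> K \<Longrightarrow>
          \<bar>(1 + 8 / (1 - lam)) * max C 0 * (1 - cmod z) powr ((lam - 1) / 2)\<bar> \<le> b"
        unfolding real_norm_def[symmetric] using continuous_on_compact_bound[OF K(1)] by blast
      have "cmod (F n z) \<le> b" if "z \<in> K" for n z
        using morrey_growth[OF hol[OF F[of n]] lam C', of z] b[OF that] that K by auto
      then show ?thesis by auto
    qed
    obtain f s where f: "f holomorphic_on disc" and s: "strict_mono (s :: nat \<Rightarrow> nat)"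
      and lim: "\<And>K. compact K \<Longrightarrow> K \<subseteq> disc \<Longrightarrow> uniform_limit K (F \<circ> s) f sequentially"
      by (rule Montel[of disc "range F" F]) (use bdd hol F in auto)
    show "\<exists>s h. strict_mono (s :: nat \<Rightarrow> nat) \<and> h \<in> bloch \<and>
        (\<lambda>n. bloch_norm (\<lambda>z. T_op g (\<lambda>z. F (s n) (of_real r * z)) z - h z)) \<longlonglongrightarrow> 0"
    proof (intro exI conjI)
      show "T_op g (\<lambda>z. f (of_real r * z)) \<in> bloch" by (rule mem[OF f])
      show "(\<lambda>n. bloch_norm (\<lambda>z. T_op g (\<lambda>z. F (s n) (of_real r * z)) z
          - T_op g (\<lambda>z. f (of_real r * z)) z)) \<longlonglongrightarrow> 0"
      proof (rule tendsto_0_ennrealI)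
        fix e :: real assume e: "0 < e"
        have "uniform_limit (cball 0 r) (F \<circ> s) f sequentially" using r by (intro lim) auto
        then have "\<forall>\<^sub>F n in sequentially. \<forall>z\<in>cball 0 r. dist ((F \<circ> s) n z) (f z) < e / (B + 1)"
          by (rule uniform_limitD) (use e B0 in auto)
        then show "\<forall>\<^sub>F n in sequentially. bloch_norm (\<lambda>z. T_op g (\<lambda>z. F (s n) (of_real r * z)) z
          - T_op g (\<lambda>z. f (of_real r * z)) z) \<le> ennreal e"
        proof eventually_elim
          case (elim n)
          show ?case
          proof (rule bloch_norm_T_op_diff_le[OF dil[OF hol[OF F]] dil[OF f] g])
            fix z :: complex assume z: "z \<in> disc"
            have "(1 - (cmod z)\<^sup>2) * (cmod (F (s n) (of_real r * z) - f (of_real r * z)) * cmod (deriv g z))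
                \<le> e / (B + 1) * B"
              using elim dilate_mem_cball[OF z r(1)] z by (intro weight) (auto simp: dist_norm intro: less_imp_le)
            also have "\<dots> \<le> e" using e B0 by (simp add: field_simps)
            finally show "(1 - (cmod z)\<^sup>2) * (cmod (F (s n) (of_real r * z) - f (of_real r * z)) * cmod (deriv g z)) \<le> e" .
          qed
        qed
      qed
    qed (fact s)
  qed
qed

text \<open>Subtracting the dilated operator leaves f(z) - f(rz) in place of f(z). For |z| \<le> s
  this is at most a multiple of 1 - r, uniformly over the unit ball, and r close to 1 makes it
  harmless; for |z| > s the assumed bound on g' takes over.\<close>

lemma essential_norm_T_op_le:
  assumes g: "g holomorphic_on disc" and lam: "0 < lam" "lam < 1" and s: "0 \<le> s" "s < 1" and M: "0 < M"
    and gM: "\<And>z. s < cmod z \<Longrightarrow> cmod z < 1 \<Longrightarrow> (1 - cmod z) powr ((1 + lam) / 2) * cmod (deriv g z) \<le> M"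
  shows "essential_norm (morrey lam) (morrey_norm lam) bloch bloch_norm (T_op g)
    \<le> ennreal (4 * (1 + 8 / (1 - lam)) * M)"
proof -
  define C where "C = 1 + 8 / (1 - lam)"
  have C: "1 \<le> C" using lam by (simp add: C_def)
  have dg: "deriv g holomorphic_on disc" using g by (intro holomorphic_deriv) auto
  have "continuous_on (cball 0 s) (deriv g)"
    using dg s by (intro continuous_on_subset[OF holomorphic_on_imp_continuous_on]) auto
  then obtain b where b0: "0 \<le> b" and "\<And>z. z \<in> cball 0 s \<Longrightarrow> cmod (deriv g z) \<le> b"
    using continuous_on_compact_bound[OF compact_cball] by blast
  then have b: "cmod (deriv g z) \<le> b" if "cmod z \<le> s" for z using that by simp
  \<comment> \<open>Bounds the derivative on the closed disc of radius s for every f of norm at most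
    1.\<close>
  define D where "D = 4 * (1 - s) powr ((lam - 3) / 2)"
  have D: "0 < D" using s by (simp add: D_def)
  \<comment> \<open>Chosen so that (1 - r) D b \<le> M, where D b bounds the product of the two
    derivatives for |z| \<le> s. The added 1 keeps the denominator positive if b = 0.\<close>
  define r where "r = max 0 (1 - M / (D * b + 1))"
  have Db: "0 < D * b + 1" using D b0 by (intro add_nonneg_pos mult_nonneg_nonneg) auto
  have r: "0 \<le> r" "r < 1" "(1 - r) * (D * b) \<le> M"
  proof -
    have "1 - r \<le> M / (D * b + 1)" by (simp add: r_def)
    then have "(1 - r) * (D * b) \<le> M / (D * b + 1) * (D * b)"
      using D b0 by (intro mult_right_mono) auto
    also have "\<dots> \<le> M" using M Db by (simp add: field_simps)
    finally show "(1 - r) * (D * b) \<le> M" .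
  qed (use M Db in \<open>auto simp: r_def\<close>)
  \<comment> \<open>The exponent (1 + lam) / 2 is below 1, so the assumed weight dominates 1 - |z|.
    Hence g has finite Bloch seminorm, as the compactness of the approximant requires.\<close>
  have B: "(1 - (cmod z)\<^sup>2) * cmod (deriv g z) \<le> max (b) (2 * M)" if z: "z \<in> disc" for z
  proof (cases "cmod z \<le> s")
    case True
    then have "(1 - (cmod z)\<^sup>2) * cmod (deriv g z) \<le> 1 * b"
      using z b[OF True] one_minus_square_bounds[of "cmod z"] by (intro mult_mono) auto
    then show ?thesis by simp
  next
    case False
    have "1 - (cmod z)\<^sup>2 \<le> 2 * (1 - cmod z)" using z by (intro one_minus_square_bounds) auto
    also have "(1 - cmod z) \<le> (1 - cmod z) powr ((1 + lam) / 2)"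
      using z lam powr_mono'[of "(1 + lam) / 2" 1 "1 - cmod z"] by simp
    finally have "(1 - (cmod z)\<^sup>2) * cmod (deriv g z) \<le> (2 * (1 - cmod z) powr ((1 + lam) / 2)) * cmod (deriv g z)"
      by (intro mult_right_mono) auto
    also have "\<dots> \<le> 2 * M" using gM[of z] False z by simp
    finally show ?thesis by simp
  qed
  define K where "K f = T_op g (\<lambda>z. f (of_real r * z))" for f
  have K: "compact_operator (morrey lam) (morrey_norm lam) bloch bloch_norm K"
    unfolding K_def[abs_def] by (rule dilated_T_op_compact[OF g lam r(1,2) B])
  have "operator_norm (morrey lam) (morrey_norm lam) bloch_norm (\<lambda>f z. T_op g f z - K f z) \<le> ennreal (4 * C * M)"
    unfolding operator_norm_def
  proof (rule SUP_least)
    fix f assume "f \<in> {f \<in> morrey lam. morrey_norm lam f \<le> 1}"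
    then have f: "f holomorphic_on disc" and f1: "morrey_norm lam f \<le> ennreal 1"
      by (auto simp: morrey_def hardy2_def analytic_disc_def)
    note fg = morrey_growth[OF f lam f1, folded C_def, simplified]
      and fd = morrey_deriv_growth[OF f lam f1, simplified]
    show "bloch_norm (\<lambda>z. T_op g f z - K f z) \<le> ennreal (4 * C * M)"
      unfolding K_def
    proof (rule bloch_norm_T_op_diff_le[OF f holomorphic_on_disc_dilate[OF f r(1,2)] g])
      fix z :: complex assume z: "z \<in> disc"
      have rz: "cmod (of_real r * z) \<le> cmod z"
        using r z by (simp add: norm_mult mult_left_le_one_le)
      show "(1 - (cmod z)\<^sup>2) * (cmod (f z - f (of_real r * z)) * cmod (deriv g z)) \<le> 4 * C * M"
      proof (cases "cmod z \<le> s")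
        case True
        have "cmod (f z - f (of_real r * z)) \<le> D * cmod (z - of_real r * z)"
        proof (rule field_differentiable_bound[of "cball 0 s" f "deriv f" D])
          fix w :: complex assume w: "w \<in> cball 0 s"
          then have wd: "w \<in> disc" using s by auto
          show "(f has_field_derivative deriv f w) (at w within cball 0 s)"
            by (rule has_field_derivative_at_within[OF holomorphic_derivI[OF f open_ball wd]])
          have "cmod (deriv f w) \<le> 4 * (1 - cmod w) powr ((lam - 3) / 2)" using fd[of w] wd by simp
          also have "\<dots> \<le> D" unfolding D_def using w s lam
            by (intro mult_left_mono powr_mono2') auto
          finally show "cmod (deriv f w) \<le> D" .
        qed (use True rz in auto)
        also have "z - of_real r * z = of_real (1 - r) * z" by (simp add: algebra_simps)
        also have "cmod \<dots> \<le> (1 - r) * 1"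
          unfolding norm_mult norm_of_real using r z by (intro mult_mono) auto
        finally have "cmod (f z - f (of_real r * z)) \<le> (1 - r) * D" using D by (simp add: mult.commute)
        then have "(1 - (cmod z)\<^sup>2) * (cmod (f z - f (of_real r * z)) * cmod (deriv g z)) \<le>
            1 * (((1 - r) * D) * b)"
          using z b[OF True] one_minus_square_bounds[of "cmod z"] r D
          by (intro mult_mono) (auto intro!: mult_nonneg_nonneg)
        also have "\<dots> \<le> M" using r(3) by (simp add: mult.assoc)
        also have "\<dots> \<le> 4 * C * M" using C M by simp
        finally show ?thesis .
      next
        case False
        \<comment> \<open>No cancellation is used here: f(z) and f(rz) both obey the growth bound at
          radius |z|. This costs a factor 2, and passing from 1 - |z|^2 to 1 - |z| another
          2.\<close>
        define x where "x = 1 - cmod z"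
        have x: "0 < x" "x \<le> 1" using z by (auto simp: x_def)
        have "cmod (f (of_real r * z)) \<le> C * (1 - cmod (of_real r * z)) powr ((lam - 1) / 2)"
          using fg[of "of_real r * z"] rz z by simp
        also have "\<dots> \<le> C * x powr ((lam - 1) / 2)"
          using rz x lam C by (intro mult_left_mono powr_mono2') (auto simp: x_def)
        finally have "cmod (f z - f (of_real r * z)) \<le> 2 * C * x powr ((lam - 1) / 2)"
          using fg[of z] z norm_triangle_ineq4[of "f z" "f (of_real r * z)"] by (simp add: x_def)
        then have "(1 - (cmod z)\<^sup>2) * (cmod (f z - f (of_real r * z)) * cmod (deriv g z)) \<le>
            (2 * x) * ((2 * C * x powr ((lam - 1) / 2)) * cmod (deriv g z))"
          using z C x one_minus_square_bounds[of "cmod z"]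
          by (intro mult_mono) (auto simp: x_def)
        also have "\<dots> = 4 * C * ((x powr 1 * x powr ((lam - 1) / 2)) * cmod (deriv g z))"
          using x by simp
        also have "x powr 1 * x powr ((lam - 1) / 2) = x powr ((1 + lam) / 2)"
          by (simp only: powr_add[symmetric]) (simp add: field_simps)
        also have "4 * C * (x powr ((1 + lam) / 2) * cmod (deriv g z)) \<le> 4 * C * M"
          unfolding x_def using gM[of z] False z C by (intro mult_left_mono) auto
        finally show ?thesis .
      qed
    qed
  qed
  moreover have "essential_norm (morrey lam) (morrey_norm lam) bloch bloch_norm (T_op g) \<le>
      operator_norm (morrey lam) (morrey_norm lam) bloch_norm (\<lambda>f z. T_op g f z - K f z)"
    unfolding essential_norm_def by (rule INF_lower) (simp add: K)
  ultimately show ?thesis unfolding C_def by (rule order_trans[rotated])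
qed

section \<open>Test functions\<close>

text \<open>Members of \<open>analytic_disc\<close> are set to 0 on the circle itself, so boundary
  values are read off from a continuous extension U.\<close>

lemma bdry_eq_of_continuous:
  assumes U: "continuous_on (cball 0 1) U" and eq: "\<And>z. z \<in> disc \<Longrightarrow> u z = U z"
  shows "bdry u t = U (cis t)"
proof -
  have "continuous_on {0..1} (\<lambda>r::real. U (of_real r * cis t))"
    by (intro continuous_on_compose2[OF U] continuous_intros) (auto simp: norm_mult)
  then have "((\<lambda>r::real. U (of_real r * cis t)) \<longlongrightarrow> U (of_real 1 * cis t)) (at 1 within {0..1})"
    unfolding continuous_on_def by (rule bspec) simp
  then have "((\<lambda>r::real. U (of_real r * cis t)) \<longlongrightarrow> U (cis t)) (at_left 1)"
    by (simp add: at_within_Icc_at_left)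
  moreover have "eventually (\<lambda>r::real. r \<in> {0<..<1}) (at_left 1)" by (rule eventually_at_left_real) simp
  then have "eventually (\<lambda>r::real. U (of_real r * cis t) = u (of_real r * cis t)) (at_left 1)"
    by eventually_elim (auto simp: eq norm_mult)
  ultimately have "((\<lambda>r::real. u (of_real r * cis t)) \<longlongrightarrow> U (cis t)) (at_left 1)"
    by (rule Lim_transform_eventually)
  then show ?thesis unfolding bdry_def by (intro tendsto_Lim) auto
qed

text \<open>If the boundary values are bounded by B, the oscillation over an arc is at most (2 B)^2
  h, and h / h^lam \<le> 1 for lam < 1. This settles membership only; B depends on the function, so
  uniform norm bounds come from the Carleson boxes.\<close>

lemma morrey_of_continuous:
  assumes u: "u \<in> analytic_disc" and lam: "lam < 1"
    and U: "continuous_on (cball 0 1) U" and eq: "\<And>z. z \<in> disc \<Longrightarrow> u z = U z"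
  shows "u \<in> morrey lam"
proof -
  obtain B where B0: "0 \<le> B" and B: "\<And>z. z \<in> cball 0 1 \<Longrightarrow> cmod (U z) \<le> B"
    using continuous_on_compact_bound[OF compact_cball U] by blast
  have bd: "cmod (bdry u t) \<le> B" for t
  proof -
    have "bdry u t = U (cis t)" by (rule bdry_eq_of_continuous[OF U]) (rule eq)
    then show ?thesis using B[of "cis t"] by simp
  qed
  have "(SUP r\<in>{0<..<1}. ennreal (1 / (2 * pi)) *
        (\<integral>\<^sup>+t\<in>{0..2 * pi}. ennreal ((cmod (u (of_real r * cis t)))\<^sup>2) \<partial>lborel)) \<le> ennreal (B\<^sup>2)"
  proof (rule SUP_least)
    fix r :: real assume r: "r \<in> {0<..<1}"
    have "(\<integral>\<^sup>+t\<in>{0..2 * pi}. ennreal ((cmod (u (of_real r * cis t)))\<^sup>2) \<partial>lborel) \<le>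
        (\<integral>\<^sup>+t\<in>{0..2 * pi}. ennreal (B\<^sup>2) \<partial>lborel)"
      using r by (intro nn_integral_mono mult_right_mono ennreal_leI power_mono)
        (auto simp: eq norm_mult intro!: B)
    also have "\<dots> = ennreal (B\<^sup>2 * (2 * pi))"
      by (subst nn_integral_cmult_indicator) (auto simp: ennreal_mult)
    finally have "ennreal (1 / (2 * pi)) * (\<integral>\<^sup>+t\<in>{0..2 * pi}. ennreal ((cmod (u (of_real r * cis t)))\<^sup>2) \<partial>lborel)
        \<le> ennreal (1 / (2 * pi)) * ennreal (B\<^sup>2 * (2 * pi))" by (rule mult_left_mono) simp
    then show "ennreal (1 / (2 * pi)) * (\<integral>\<^sup>+t\<in>{0..2 * pi}. ennreal ((cmod (u (of_real r * cis t)))\<^sup>2) \<partial>lborel)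
        \<le> ennreal (B\<^sup>2)" by (simp flip: ennreal_mult)
  qed
  then have hardy: "u \<in> hardy2" using u by (auto simp: hardy2_def intro: le_less_trans)
  have "(SUP \<theta>. SUP h\<in>{0<..1}. arc_oscillation lam u \<theta> h) \<le> ennreal (4 * B\<^sup>2)"
  proof (intro SUP_least)
    fix \<theta> h :: real assume h: "h \<in> {0<..1}"
    have "cmod (LINT t:arc_angles \<theta> h|lborel. bdry u t) \<le>
        (\<integral>t. norm (indicator (arc_angles \<theta> h) t *\<^sub>R bdry u t) \<partial>lborel)"
      unfolding set_lebesgue_integral_def by (rule integral_norm_bound)
    also have "\<dots> \<le> (\<integral>t. indicator (arc_angles \<theta> h) t * B \<partial>lborel)"
    proof (rule integral_mono')
      have "integrable lborel (indicator (arc_angles \<theta> h) :: real \<Rightarrow> real)"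
        using h by (intro integrable_real_indicator) (auto simp: arc_angles_def)
      then show "integrable lborel (\<lambda>t. indicator (arc_angles \<theta> h) t * B)" by (rule integrable_mult_left)
    qed (use bd B0 in \<open>auto simp: indicator_def\<close>)
    also have "\<dots> = 2 * pi * h * B"
      using h by (simp add: arc_angles_def)
    finally have "cmod (arc_mean u \<theta> h) \<le> B"
      using h by (simp add: arc_mean_def norm_divide norm_mult field_simps)
    then have "cmod (bdry u t - arc_mean u \<theta> h) \<le> 2 * B" for t
      using bd[of t] norm_triangle_ineq4[of "bdry u t" "arc_mean u \<theta> h"] by simp
    then have "(\<integral>\<^sup>+t\<in>arc_angles \<theta> h. ennreal ((cmod (bdry u t - arc_mean u \<theta> h))\<^sup>2) \<partial>lborel) \<le>
        (\<integral>\<^sup>+t\<in>arc_angles \<theta> h. ennreal ((2 * B)\<^sup>2) \<partial>lborel)"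
      by (intro nn_integral_mono mult_right_mono ennreal_leI power_mono) auto
    also have "\<dots> = ennreal ((2 * B)\<^sup>2) * ennreal (2 * pi * h)"
      using h by (subst nn_integral_cmult_indicator) (auto simp: arc_angles_def)
    also have "\<dots> = ennreal ((2 * B)\<^sup>2 * (2 * pi * h))"
      using h by (intro ennreal_mult[symmetric]) auto
    finally have "arc_oscillation lam u \<theta> h \<le>
        ennreal (1 / (h powr lam)) * (ennreal (1 / (2 * pi)) * ennreal ((2 * B)\<^sup>2 * (2 * pi * h)))"
      unfolding arc_oscillation_def by (intro mult_left_mono) auto
    also have "\<dots> = ennreal (1 / (h powr lam) * (1 / (2 * pi) * ((2 * B)\<^sup>2 * (2 * pi * h))))"
      using h by (simp flip: ennreal_mult)
    also have "1 / (h powr lam) * (1 / (2 * pi) * ((2 * B)\<^sup>2 * (2 * pi * h))) = 4 * B\<^sup>2 * (h powr 1 / h powr lam)"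
      using h by (simp add: field_simps)
    also have "h powr 1 / h powr lam = h powr (1 - lam)" by (rule powr_diff[symmetric])
    also have "ennreal (4 * B\<^sup>2 * h powr (1 - lam)) \<le> ennreal (4 * B\<^sup>2)"
      using h lam by (intro ennreal_leI mult_left_le powr_le1) auto
    finally show "arc_oscillation lam u \<theta> h \<le> ennreal (4 * B\<^sup>2)" .
  qed
  then show ?thesis using hardy by (auto simp: morrey_def intro: le_less_trans)
qed

section \<open>Tools for bounding the Morrey norm from above\<close>

lemma morrey_norm_leI:
  assumes x: "cmod (f 0) \<le> x" and y: "0 \<le> y"
    and le: "\<And>\<theta> h. 0 < h \<Longrightarrow> h \<le> 1 \<Longrightarrow>
      area_integral (carleson_box \<theta> h) (\<lambda>z. (cmod (deriv f z))\<^sup>2 * (1 - (cmod z)\<^sup>2)) \<le> ennreal (y\<^sup>2 * h powr lam)"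
  shows "morrey_norm lam f \<le> ennreal (x + y)"
proof -
  have "(SUP \<theta>. SUP h\<in>{0<..1}. esqrt (ennreal (1 / (h powr lam)) *
        area_integral (carleson_box \<theta> h) (\<lambda>z. (cmod (deriv f z))\<^sup>2 * (1 - (cmod z)\<^sup>2)))) \<le> ennreal y"
  proof (intro SUP_least)
    fix \<theta> h :: real assume h: "h \<in> {0<..1}"
    have "ennreal (1 / (h powr lam)) *
        area_integral (carleson_box \<theta> h) (\<lambda>z. (cmod (deriv f z))\<^sup>2 * (1 - (cmod z)\<^sup>2)) \<le>
        ennreal (1 / (h powr lam)) * ennreal (y\<^sup>2 * h powr lam)"
      using h by (intro mult_left_mono le) auto
    also have "\<dots> = ennreal (y\<^sup>2)" using h by (simp flip: ennreal_mult)
    finally show "esqrt (ennreal (1 / (h powr lam)) *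
        area_integral (carleson_box \<theta> h) (\<lambda>z. (cmod (deriv f z))\<^sup>2 * (1 - (cmod z)\<^sup>2))) \<le> ennreal y"
      using y by (simp add: esqrt_le_iff)
  qed
  then have "morrey_norm lam f \<le> ennreal x + ennreal y"
    unfolding morrey_norm_def using x by (intro add_mono ennreal_leI) auto
  also have "\<dots> = ennreal (x + y)" using x y order_trans[OF norm_ge_zero x] by simp
  finally show ?thesis .
qed

lemma carleson_box_measurable [measurable]: "carleson_box \<theta> h \<in> sets borel"
proof -
  have "compact (cis ` arc_angles \<theta> h)"
    unfolding arc_angles_def by (intro compact_continuous_image continuous_intros compact_Icc)
  then have [measurable]: "cis ` arc_angles \<theta> h \<in> sets borel" by (rule borel_compact)
  show ?thesis
  proof (cases "h = 1")
    case False
    have "{z \<in> disc. 1 - h \<le> cmod z \<and> z / of_real (cmod z) \<in> cis ` arc_angles \<theta> h} \<in> sets borel"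
      by measurable
    then show ?thesis using False by (simp add: carleson_box_def)
  qed (simp add: carleson_box_def)
qed

lemma carleson_box_subset_disc: "carleson_box \<theta> h \<subseteq> disc"
  by (auto simp: carleson_box_def)

text \<open>The centre is the initial point of the arc. Radial projection moves z by at most h, and
  the arc has length 2 pi h, below 8 h.\<close>

lemma carleson_box_subset_cball:
  assumes h: "0 < h" "h < 1"
  shows "carleson_box \<theta> h \<subseteq> cball (cis \<theta>) (9 * h)"
proof
  fix z assume "z \<in> carleson_box \<theta> h"
  then obtain t where z: "cmod z < 1" "1 - h \<le> cmod z" and t: "t \<in> arc_angles \<theta> h" "z / cmod z = cis t"
    using h by (auto simp: carleson_box_def)
  have "z \<noteq> 0" using z h by auto
  then have "z - cis t = of_real (cmod z - 1) * cis t" using t by (simp add: field_simps flip: t(2))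
  then have "cmod (z - cis t) = \<bar>cmod z - 1\<bar>" by (simp only: norm_mult norm_of_real norm_cis mult_1_right)
  moreover have "cmod (cis t - cis \<theta>) \<le> 2 * pi * h"
    using cmod_cis_diff_le[of t \<theta>] t by (auto simp: arc_angles_def)
  moreover have "2 * pi * h \<le> 8 * h" using pi_less_4 h by simp
  moreover have "cmod (z - cis \<theta>) \<le> cmod (z - cis t) + cmod (cis t - cis \<theta>)"
    using norm_triangle_ineq[of "z - cis t" "cis t - cis \<theta>"] by simp
  ultimately have "cmod (z - cis \<theta>) \<le> 9 * h" using z h by linarith
  then show "z \<in> cball (cis \<theta>) (9 * h)" by (simp add: dist_norm norm_minus_commute)
qed

lemma area_integral_add:
  assumes [measurable]: "A \<in> sets borel" "F \<in> borel_measurable borel" "G \<in> borel_measurable borel"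
    and "\<And>z. z \<in> A \<Longrightarrow> 0 \<le> F z" "\<And>z. z \<in> A \<Longrightarrow> 0 \<le> G z"
  shows "area_integral A (\<lambda>z. F z + G z) = area_integral A F + area_integral A G"
proof -
  have "(\<integral>\<^sup>+z\<in>A. ennreal (F z + G z) \<partial>lborel) =
      (\<integral>\<^sup>+z. ennreal (F z) * indicator A z + ennreal (G z) * indicator A z \<partial>lborel)"
    using assms by (intro nn_integral_cong) (auto simp: indicator_def)
  also have "\<dots> = (\<integral>\<^sup>+z\<in>A. ennreal (F z) \<partial>lborel) + (\<integral>\<^sup>+z\<in>A. ennreal (G z) \<partial>lborel)"
    by (intro nn_integral_add) auto
  finally show ?thesis by (simp add: area_integral_def distrib_left)
qed

lemma area_integral_cmult:
  assumes [measurable]: "A \<in> sets borel" "F \<in> borel_measurable borel" and c: "0 \<le> c"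
  shows "area_integral A (\<lambda>z. c * F z) = ennreal c * area_integral A F"
proof -
  have "(\<integral>\<^sup>+z\<in>A. ennreal (c * F z) \<partial>lborel) = (\<integral>\<^sup>+z. ennreal c * (ennreal (F z) * indicator A z) \<partial>lborel)"
    using c by (simp add: ennreal_mult' mult.assoc)
  also have "\<dots> = ennreal c * (\<integral>\<^sup>+z\<in>A. ennreal (F z) \<partial>lborel)"
    by (intro nn_integral_cmult) auto
  finally show ?thesis by (simp add: area_integral_def mult_ac)
qed

text \<open>A Cauchy kernel, cut off outside the disc to fit the encoding of the space. The exponent
  is the largest power of 1 - |a| that the diagonal values may carry under the growth estimate,
  after the kernel has been evaluated at a.\<close>

definition test_fun :: "real \<Rightarrow> complex \<Rightarrow> complex \<Rightarrow> complex"
  where "test_fun lam a z =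
    (if z \<in> disc then of_real ((1 - (cmod a)\<^sup>2) powr ((1 + lam) / 2)) / (1 - cnj a * z) else 0)"

text \<open>An upper bound for the integrand of the Morrey norm of the test function. The factor 8
  pays for replacing 1 - |a|^2 and 1 - |z|^2 by 1 - |a| and 1 - |z|; the \<open>powr\<close> form
  matches the Forelli-Rudin integral with t = 1 and s = 4.\<close>

definition test_majorant :: "real \<Rightarrow> complex \<Rightarrow> complex \<Rightarrow> real"
  where "test_majorant lam a z = 8 * (1 - cmod a) powr (1 + lam) * ((1 - cmod z) powr 1 * cmod (1 - cnj a * z) powr - 4)"

lemma kernel_denominator_nonzero:
  assumes "cmod a < 1" "cmod z \<le> 1"
  shows "1 - cnj a * z \<noteq> 0"
proof
  assume "1 - cnj a * z = 0"
  then have "cmod a * cmod z = 1" by (metis norm_mult norm_one complex_mod_cnj eq_iff_diff_eq_0)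
  moreover have "cmod a * cmod z \<le> cmod a" using assms by (intro mult_left_le) auto
  ultimately show False using assms by simp
qed

lemma test_fun_deriv:
  assumes a: "cmod a < 1" and z: "z \<in> disc"
  shows "(test_fun lam a has_field_derivative
    of_real ((1 - (cmod a)\<^sup>2) powr ((1 + lam) / 2)) * cnj a / (1 - cnj a * z)\<^sup>2) (at z)"
proof -
  have "((\<lambda>z. of_real ((1 - (cmod a)\<^sup>2) powr ((1 + lam) / 2)) / (1 - cnj a * z)) has_field_derivative
      of_real ((1 - (cmod a)\<^sup>2) powr ((1 + lam) / 2)) * cnj a / (1 - cnj a * z)\<^sup>2) (at z)"
    using kernel_denominator_nonzero[OF a, of z] z
    by (auto intro!: derivative_eq_intros simp: power2_eq_square)
  then show ?thesis
    by (rule has_field_derivative_transform_within_open[of _ _ _ disc]) (use z in \<open>auto simp: test_fun_def\<close>)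
qed

lemma test_fun_deriv_le:
  assumes a: "cmod a < 1" and z: "z \<in> disc" and lam: "0 < lam" "lam < 1"
  shows "(cmod (deriv (test_fun lam a) z))\<^sup>2 * (1 - (cmod z)\<^sup>2) \<le> test_majorant lam a z"
proof -
  define A where "A = (1 - (cmod a)\<^sup>2) powr ((1 + lam) / 2)"
  define x where "x = cmod (1 - cnj a * z)"
  have x: "0 < x" using disc_kernel_pos[OF a, of z] z by (simp add: x_def)
  have a2: "0 \<le> 1 - (cmod a)\<^sup>2" "1 - (cmod a)\<^sup>2 \<le> 2 * (1 - cmod a)"
    using a by (intro one_minus_square_bounds; simp)+
  have "A\<^sup>2 = (1 - (cmod a)\<^sup>2) powr (1 + lam)"
    unfolding A_def by (simp add: power2_eq_square flip: powr_add)
  also have "\<dots> \<le> (2 * (1 - cmod a)) powr (1 + lam)" using a2 lam by (intro powr_mono2) auto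
  also have "\<dots> = 2 powr (1 + lam) * (1 - cmod a) powr (1 + lam)" by (rule powr_mult)
  also have "\<dots> \<le> 2 powr 2 * (1 - cmod a) powr (1 + lam)" using lam by (intro mult_right_mono powr_mono) auto
  finally have A2: "A\<^sup>2 \<le> 4 * (1 - cmod a) powr (1 + lam)" by simp
  have "(cmod (deriv (test_fun lam a) z))\<^sup>2 = A\<^sup>2 * (cmod a)\<^sup>2 / x ^ 4"
    by (simp add: DERIV_imp_deriv[OF test_fun_deriv[OF a z]] norm_mult norm_divide norm_power A_def x_def
        power_mult_distrib power_divide flip: power_mult)
  also have "\<dots> \<le> A\<^sup>2 * 1 / x ^ 4"
    using a by (intro divide_right_mono mult_left_mono) (auto simp: abs_square_le_1)
  also have "\<dots> \<le> 4 * (1 - cmod a) powr (1 + lam) / x ^ 4"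
    using A2 by (intro divide_right_mono) auto
  finally have "(cmod (deriv (test_fun lam a) z))\<^sup>2 * (1 - (cmod z)\<^sup>2) \<le>
      4 * (1 - cmod a) powr (1 + lam) / x ^ 4 * (2 * (1 - cmod z))"
    using z one_minus_square_bounds[of "cmod z"] by (intro mult_mono) auto
  also have "\<dots> = test_majorant lam a z"
    using z x powr_minus_divide[of x 4] by (simp add: test_majorant_def x_def)
  finally show ?thesis .
qed

lemma test_majorant_measurable [measurable]: "test_majorant lam a \<in> borel_measurable borel"
  unfolding test_majorant_def[abs_def] by measurable

lemma test_majorant_nonneg: "0 \<le> test_majorant lam a z"
  by (simp add: test_majorant_def)

text \<open>Let \<delta> = 1 - |a|. If \<delta> \<le> h, the integral over the whole disc is of
  order \<delta>^(1 + lam) / \<delta> = \<delta>^lam. If h < \<delta>, the kernel is at least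
  \<delta>, 1 - |z| is at most h and the box has area of order h^2, which gives h^3 \<delta>^(lam -
  3), again at most of order h^lam.\<close>

lemma test_majorant_box_le:
  assumes lam: "0 < lam" "lam < 1"
  obtains C where "0 < C" "\<And>a \<theta> h. cmod a < 1 \<Longrightarrow> 0 < h \<Longrightarrow> h \<le> 1 \<Longrightarrow>
    area_integral (carleson_box \<theta> h) (test_majorant lam a) \<le> ennreal (C * h powr lam)"
proof -
  obtain C0 where C0: "0 < C0" "\<And>a. cmod a < 1 \<Longrightarrow>
      (\<integral>\<^sup>+z\<in>disc. ennreal ((1 - cmod z) powr 1 * cmod (1 - cnj a * z) powr - 4) \<partial>lborel)
        \<le> ennreal (C0 * (1 - cmod a) powr (1 + 2 - 4))"
    by (rule forelli_rudin[of 1 4]) auto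
  have "area_integral (carleson_box \<theta> h) (test_majorant lam a) \<le> ennreal ((8 * C0 + 648) * h powr lam)"
    if a: "cmod a < 1" and h: "0 < h" "h \<le> 1" for a \<theta> h
  proof -
    define \<delta> where "\<delta> = 1 - cmod a"
    have \<delta>: "0 < \<delta>" "\<delta> \<le> 1" using a by (auto simp: \<delta>_def)
    show ?thesis
    proof (cases "\<delta> \<le> h")
      case True
      have "area_integral (carleson_box \<theta> h) (test_majorant lam a) \<le> area_integral disc (test_majorant lam a)"
        by (intro area_integral_mono carleson_box_subset_disc) auto
      also have "\<dots> = ennreal (8 * \<delta> powr (1 + lam)) *
          area_integral disc (\<lambda>z. (1 - cmod z) powr 1 * cmod (1 - cnj a * z) powr - 4)"
        unfolding test_majorant_def[abs_def] \<delta>_def by (rule area_integral_cmult) auto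
      also have "\<dots> \<le> ennreal (8 * \<delta> powr (1 + lam)) * (ennreal (1 / pi) * ennreal (C0 * \<delta> powr - 1))"
        unfolding area_integral_def \<delta>_def using C0(2)[OF a] by (intro mult_left_mono) auto
      also have "\<dots> = ennreal (8 * C0 / pi * (\<delta> powr (1 + lam) * \<delta> powr - 1))"
        using C0 by (simp add: mult_ac flip: ennreal_mult)
      also have "\<delta> powr (1 + lam) * \<delta> powr - 1 = \<delta> powr lam" by (simp only: powr_add[symmetric]) simp
      also have "8 * C0 / pi * \<delta> powr lam \<le> (8 * C0 + 648) * h powr lam"
      proof (rule mult_mono)
        have "8 * C0 / pi \<le> 8 * C0 / 1" using C0 pi_gt3 by (intro divide_left_mono) auto
        then show "8 * C0 / pi \<le> 8 * C0 + 648" by simp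
        show "\<delta> powr lam \<le> h powr lam" using True \<delta> lam by (intro powr_mono2) auto
      qed (use C0 in auto)
      finally show ?thesis by (simp add: ennreal_leI)
    next
      case False
      define c where "c = 8 * \<delta> powr (1 + lam) * (h * \<delta> powr - 4)"
      have "area_integral (carleson_box \<theta> h) (test_majorant lam a) \<le>
          area_integral (cball (cis \<theta>) (9 * h)) (\<lambda>_. c)"
      proof (rule area_integral_mono)
        show "carleson_box \<theta> h \<subseteq> cball (cis \<theta>) (9 * h)"
          using False \<delta> h by (intro carleson_box_subset_cball) auto
        fix z assume "z \<in> carleson_box \<theta> h"
        then have z: "cmod z < 1" "1 - cmod z \<le> h"
          using False \<delta> h by (auto simp: carleson_box_def)
        have "cmod (1 - cnj a * z) powr - 4 \<le> \<delta> powr - 4"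
          using disc_kernel_pos[OF a z(1)] \<delta> by (intro powr_mono2') (auto simp: \<delta>_def)
        then show "test_majorant lam a z \<le> c"
          unfolding test_majorant_def c_def \<delta>_def[symmetric] using z h
          by (intro mult_left_mono mult_mono) auto
      qed
      also have "\<dots> = ennreal (1 / pi) * (ennreal c * ennreal (pi * (9 * h)\<^sup>2))"
        unfolding area_integral_def using h
        by (subst nn_integral_cmult_indicator) (auto simp: emeasure_lborel_complex_ball)
      also have "\<dots> = ennreal (1 / pi * (c * (pi * (9 * h)\<^sup>2)))"
        using h by (simp add: c_def flip: ennreal_mult)
      also have "1 / pi * (c * (pi * (9 * h)\<^sup>2)) = 648 * (h ^ 3 * (\<delta> powr (1 + lam) * \<delta> powr - 4))"
        by (simp add: c_def power2_eq_square power3_eq_cube)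
      also have "\<delta> powr (1 + lam) * \<delta> powr - 4 = \<delta> powr (lam - 3)" by (simp flip: powr_add)
      also have "h ^ 3 = h powr lam * h powr (3 - lam)"
        using h by (simp flip: powr_add)
      also have "648 * (h powr lam * h powr (3 - lam) * \<delta> powr (lam - 3)) \<le>
          648 * (h powr lam * \<delta> powr (3 - lam) * \<delta> powr (lam - 3))"
        using False h lam by (intro mult_left_mono mult_right_mono powr_mono2) auto
      also have "\<dots> = 648 * h powr lam * (\<delta> powr (3 - lam) * \<delta> powr (lam - 3))" by simp
      also have "\<delta> powr (3 - lam) * \<delta> powr (lam - 3) = 1" using \<delta> by (simp flip: powr_add)
      also have "648 * h powr lam * 1 \<le> (8 * C0 + 648) * h powr lam" using C0(1) by (simp add: distrib_right)
      finally show ?thesis by (simp add: ennreal_leI)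
    qed
  qed
  then show thesis using C0 by (intro that[of "8 * C0 + 648"]) auto
qed

lemma test_fun_analytic: "cmod a < 1 \<Longrightarrow> test_fun lam a \<in> analytic_disc"
  using test_fun_deriv[of a _ lam] by (auto simp: analytic_disc_def holomorphic_on_open test_fun_def intro!: exI)

lemma test_fun_continuous_extension:
  assumes "cmod a < 1"
  shows "continuous_on (cball 0 1) (\<lambda>z. of_real ((1 - (cmod a)\<^sup>2) powr ((1 + lam) / 2)) / (1 - cnj a * z))"
  using kernel_denominator_nonzero[OF assms] by (intro continuous_intros) auto

lemma cmod_test_fun_0_le:
  assumes a: "cmod a < 1" and lam: "0 < lam" "lam < 1"
  shows "cmod (test_fun lam a 0) \<le> 1"
  using a lam one_minus_square_bounds[of "cmod a"] by (auto simp: test_fun_def intro!: powr_le1)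

text \<open>Differences come already scaled into the unit ball, ready for the supremum that defines
  the operator norm. Subtraction is written with the factor -1 because linearity is given through
  sums and scalar multiples.\<close>

lemma test_fun_morrey:
  assumes lam: "0 < lam" "lam < 1"
  obtains C where "0 < C"
    "\<And>a c. cmod a < 1 \<Longrightarrow> (\<lambda>z. c * test_fun lam a z) \<in> morrey lam"
    "\<And>a. cmod a < 1 \<Longrightarrow> morrey_norm lam (test_fun lam a) \<le> ennreal C"
    "\<And>a b. cmod a < 1 \<Longrightarrow> cmod b < 1 \<Longrightarrow>
      (\<lambda>z. of_real (1 / C) * (test_fun lam a z + (- 1) * test_fun lam b z)) \<in> morrey lam"
    "\<And>a b. cmod a < 1 \<Longrightarrow> cmod b < 1 \<Longrightarrow>
      morrey_norm lam (\<lambda>z. of_real (1 / C) * (test_fun lam a z + (- 1) * test_fun lam b z)) \<le> 1"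
proof -
  obtain K where K: "0 < K" "\<And>a \<theta> h. cmod a < 1 \<Longrightarrow> 0 < h \<Longrightarrow> h \<le> 1 \<Longrightarrow>
    area_integral (carleson_box \<theta> h) (test_majorant lam a) \<le> ennreal (K * h powr lam)"
    using test_majorant_box_le[OF lam] by blast
  \<comment> \<open>The value makes the scaled difference fit exactly: its value at 0 costs 2 / C
    and its derivative part 2 sqrt K / C. It also dominates 1 + sqrt (2 K), the bound for a single
    test function.\<close>
  define C where "C = 2 + 2 * sqrt K"
  have C: "0 < C" using K by (auto simp: C_def intro!: add_pos_nonneg)
  \<comment> \<open>Two majorants are allowed so that one estimate serves both cases; a single test
    function uses it with b = a.\<close>
  have le: "morrey_norm lam u \<le> ennreal (x + y * sqrt (2 * K))"
    if u: "\<And>z. z \<in> disc \<Longrightarrow> (cmod (deriv u z))\<^sup>2 * (1 - (cmod z)\<^sup>2) \<le> y\<^sup>2 * (test_majorant lam a z + test_majorant lam b z)"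
      and x: "cmod (u 0) \<le> x" and y: "0 \<le> y" and ab: "cmod a < 1" "cmod b < 1" for u x y a b
  proof (rule morrey_norm_leI[where f = u, OF x])
    show "0 \<le> y * sqrt (2 * K)" using y K by simp
    fix \<theta> h :: real assume h: "0 < h" "h \<le> 1"
    have "area_integral (carleson_box \<theta> h) (\<lambda>z. (cmod (deriv u z))\<^sup>2 * (1 - (cmod z)\<^sup>2)) \<le>
        area_integral (carleson_box \<theta> h) (\<lambda>z. y\<^sup>2 * (test_majorant lam a z + test_majorant lam b z))"
      by (rule area_integral_mono[OF order_refl], rule u, erule subsetD[OF carleson_box_subset_disc])
    also have "\<dots> = ennreal (y\<^sup>2) * (area_integral (carleson_box \<theta> h) (test_majorant lam a) +
        area_integral (carleson_box \<theta> h) (test_majorant lam b))"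
      by (subst area_integral_cmult) (auto simp: area_integral_add test_majorant_nonneg)
    also have "\<dots> \<le> ennreal (y\<^sup>2) * (ennreal (K * h powr lam) + ennreal (K * h powr lam))"
      using h ab by (intro mult_left_mono add_mono K) auto
    also have "\<dots> = ennreal ((y * sqrt (2 * K))\<^sup>2 * h powr lam)"
      using K by (simp add: power_mult_distrib mult_ac flip: ennreal_mult ennreal_plus)
    finally show "area_integral (carleson_box \<theta> h) (\<lambda>z. (cmod (deriv u z))\<^sup>2 * (1 - (cmod z)\<^sup>2)) \<le>
        ennreal ((y * sqrt (2 * K))\<^sup>2 * h powr lam)" .
  qed
  show ?thesis
  proof (rule that[OF C])
    fix a :: complex assume a: "cmod a < 1"
    show "(\<lambda>z. c * test_fun lam a z) \<in> morrey lam" for c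
    proof (rule morrey_of_continuous[OF _ lam(2)])
      show "(\<lambda>z. c * test_fun lam a z) \<in> analytic_disc"
        using test_fun_analytic[OF a, of lam] by (auto simp: analytic_disc_def intro!: holomorphic_intros)
      show "continuous_on (cball 0 1) (\<lambda>z. c * (of_real ((1 - (cmod a)\<^sup>2) powr ((1 + lam) / 2)) / (1 - cnj a * z)))"
        by (intro continuous_on_mult continuous_on_const test_fun_continuous_extension a)
    qed (simp add: test_fun_def)
    have "morrey_norm lam (test_fun lam a) \<le> ennreal (1 + 1 * sqrt (2 * K))"
      using a lam by (intro le[of _ 1 a a] cmod_test_fun_0_le)
        (auto intro!: order_trans[OF test_fun_deriv_le] simp: test_majorant_nonneg)
    also have "\<dots> \<le> ennreal C"
    proof (rule ennreal_leI)
      have "sqrt (2 * K) \<le> sqrt (4 * K)" using K by simp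
      then show "1 + 1 * sqrt (2 * K) \<le> C" by (simp add: C_def real_sqrt_mult)
    qed
    finally show "morrey_norm lam (test_fun lam a) \<le> ennreal C" .
    fix b :: complex assume b: "cmod b < 1"
    let ?u = "\<lambda>z. of_real (1 / C) * (test_fun lam a z + (- 1) * test_fun lam b z)"
    have an: "?u \<in> analytic_disc"
      using test_fun_analytic[OF a, of lam] test_fun_analytic[OF b, of lam]
      unfolding analytic_disc_def by (auto intro!: holomorphic_intros)
    show "?u \<in> morrey lam"
    proof (rule morrey_of_continuous[OF an lam(2)])
      show "continuous_on (cball 0 1) (\<lambda>z. of_real (1 / C) *
          (of_real ((1 - (cmod a)\<^sup>2) powr ((1 + lam) / 2)) / (1 - cnj a * z) +
           (- 1) * (of_real ((1 - (cmod b)\<^sup>2) powr ((1 + lam) / 2)) / (1 - cnj b * z))))"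
        by (intro continuous_on_mult continuous_on_add continuous_on_const
            test_fun_continuous_extension a b)
    qed (simp add: test_fun_def)
    have du: "deriv ?u z = of_real (1 / C) * (deriv (test_fun lam a) z + (- 1) * deriv (test_fun lam b) z)"
      if z: "z \<in> disc" for z
    proof -
      have "test_fun lam c field_differentiable at z" if "cmod c < 1" for c
        using test_fun_deriv[OF that z] field_differentiable_def by blast
      then have "(test_fun lam c has_field_derivative deriv (test_fun lam c) z) (at z)" if "cmod c < 1" for c
        using that by (simp add: DERIV_deriv_iff_field_differentiable)
      from this[OF a] this[OF b] show ?thesis
        using C by (intro DERIV_imp_deriv) (auto intro!: derivative_eq_intros)
    qed
    have "morrey_norm lam ?u \<le> ennreal (2 / C + sqrt 2 / C * sqrt (2 * K))"
    proof (rule le[OF _ _ _ a b])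
      have "cmod (test_fun lam a 0 + (- 1) * test_fun lam b 0) \<le> 2"
        using cmod_test_fun_0_le[OF a lam] cmod_test_fun_0_le[OF b lam]
          norm_triangle_ineq4[of "test_fun lam a 0" "test_fun lam b 0"] by simp
      then show "cmod (?u 0) \<le> 2 / C" using C by (simp add: norm_mult norm_divide divide_right_mono)
      show "0 \<le> sqrt 2 / C" using C by simp
      fix z assume z: "z \<in> disc"
      define p q where "p = cmod (deriv (test_fun lam a) z)" and "q = cmod (deriv (test_fun lam b) z)"
      have z2: "0 \<le> 1 - (cmod z)\<^sup>2" using z by (intro one_minus_square_bounds) auto
      have "cmod (deriv (test_fun lam a) z + (- 1) * deriv (test_fun lam b) z) \<le> p + q"
        using norm_triangle_ineq4 unfolding p_def q_def by (metis mult_minus1 uminus_add_conv_diff add.commute)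
      then have "(cmod (deriv ?u z))\<^sup>2 \<le> (1 / C * (p + q))\<^sup>2"
        unfolding du[OF z] norm_mult norm_of_real using C by (intro power_mono mult_mono) auto
      also have "\<dots> \<le> (1 / C)\<^sup>2 * (2 * (p\<^sup>2 + q\<^sup>2))"
        unfolding power_mult_distrib using sum_squares_bound[of p q]
        by (intro mult_left_mono) (auto simp: power2_sum)
      finally have "(cmod (deriv ?u z))\<^sup>2 * (1 - (cmod z)\<^sup>2) \<le> (1 / C)\<^sup>2 * (2 * (p\<^sup>2 + q\<^sup>2)) * (1 - (cmod z)\<^sup>2)"
        using z2 by (rule mult_right_mono)
      also have "\<dots> = (1 / C)\<^sup>2 * 2 * (p\<^sup>2 * (1 - (cmod z)\<^sup>2) + q\<^sup>2 * (1 - (cmod z)\<^sup>2))"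
        by (simp only: distrib_right mult.assoc)
      also have "(1 / C)\<^sup>2 * 2 = (sqrt 2 / C)\<^sup>2" by (simp add: power_divide)
      also have "(sqrt 2 / C)\<^sup>2 * (p\<^sup>2 * (1 - (cmod z)\<^sup>2) + q\<^sup>2 * (1 - (cmod z)\<^sup>2)) \<le>
          (sqrt 2 / C)\<^sup>2 * (test_majorant lam a z + test_majorant lam b z)"
        unfolding p_def q_def by (intro mult_left_mono add_mono test_fun_deriv_le a b z lam) auto
      finally show "(cmod (deriv ?u z))\<^sup>2 * (1 - (cmod z)\<^sup>2) \<le>
          (sqrt 2 / C)\<^sup>2 * (test_majorant lam a z + test_majorant lam b z)" .
    qed
    also have "2 / C + sqrt 2 / C * sqrt (2 * K) = 1"
    proof -
      have "sqrt 2 * sqrt (2 * K) = 2 * sqrt K" by (simp add: real_sqrt_mult)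
      then have "2 / C + sqrt 2 / C * sqrt (2 * K) = C / C"
        by (simp add: C_def flip: add_divide_distrib)
      then show ?thesis using C by simp
    qed
    finally show "morrey_norm lam ?u \<le> 1" by simp
  qed
qed

section \<open>The lower bound for the essential norm\<close>

lemma bloch_norm_le_imp:
  assumes "bloch_norm u \<le> ennreal b" "0 \<le> b" "z \<in> disc"
  shows "(1 - (cmod z)\<^sup>2) * cmod (deriv u z) \<le> b"
proof -
  have "ennreal ((1 - (cmod z)\<^sup>2) * cmod (deriv u z)) \<le> bloch_seminorm u"
    unfolding bloch_seminorm_def using assms(3) by (rule SUP_upper)
  also have "\<dots> \<le> bloch_norm u" by (simp add: bloch_norm_def)
  also note assms(1)
  finally show ?thesis using assms(2) by (simp add: ennreal_le_iff)
qed

lemma test_fun_diag: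
  assumes "cmod a < 1"
  shows "(1 - (cmod a)\<^sup>2) * cmod (test_fun lam a a) = (1 - (cmod a)\<^sup>2) powr ((1 + lam) / 2)"
proof -
  have "1 - cnj a * a = of_real (1 - (cmod a)\<^sup>2)"
    using complex_norm_square[of a] by (simp add: mult.commute)
  moreover have "0 < 1 - (cmod a)\<^sup>2" using assms by (simp add: abs_square_less_1)
  ultimately show ?thesis
    using assms by (simp add: test_fun_def norm_divide del: of_real_diff)
qed

text \<open>The operator T - K is applied to a scaled difference of two test functions and its
  derivative is evaluated at the parameter z of the first one. There the first function yields the
  weight W z exactly, and everything else is controlled: the norm of T - K, two distances to the
  limit of K along the subsequence, and the value at z of the fixed second function.\<close>

lemma essential_norm_T_op_lower:
  assumes lam: "0 < lam" "lam < 1"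
  obtains C where "0 < C"
    "\<And>g N. g holomorphic_on disc \<Longrightarrow>
      bounded_operator (morrey lam) (morrey_norm lam) bloch bloch_norm (T_op g) \<Longrightarrow>
      essential_norm (morrey lam) (morrey_norm lam) bloch bloch_norm (T_op g) < ennreal N \<Longrightarrow>
      \<exists>s<1. \<forall>z. s < cmod z \<and> cmod z < 1 \<longrightarrow> (1 - (cmod z)\<^sup>2) powr ((1 + lam) / 2) * cmod (deriv g z) \<le> C * N"
proof -
  obtain C where C: "0 < C"
    and mem: "\<And>a c. cmod a < 1 \<Longrightarrow> (\<lambda>z. c * test_fun lam a z) \<in> morrey lam"
    and norm: "\<And>a. cmod a < 1 \<Longrightarrow> morrey_norm lam (test_fun lam a) \<le> ennreal C"
    and dmem: "\<And>a b. cmod a < 1 \<Longrightarrow> cmod b < 1 \<Longrightarrow>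
      (\<lambda>z. of_real (1 / C) * (test_fun lam a z + (- 1) * test_fun lam b z)) \<in> morrey lam"
    and dnorm: "\<And>a b. cmod a < 1 \<Longrightarrow> cmod b < 1 \<Longrightarrow>
      morrey_norm lam (\<lambda>z. of_real (1 / C) * (test_fun lam a z + (- 1) * test_fun lam b z)) \<le> 1"
    using test_fun_morrey[OF lam] by blast
  have mem1: "test_fun lam a \<in> morrey lam" if "cmod a < 1" for a using mem[OF that, of 1] by simp
  have hol: "f holomorphic_on disc" if "f \<in> morrey lam" for f
    using that by (simp add: morrey_def hardy2_def analytic_disc_def)
  have bhol: "f holomorphic_on disc" if "f \<in> bloch" for f
    using that by (simp add: bloch_def analytic_disc_def)
  have der: "(f has_field_derivative deriv f z) (at z)" if "f holomorphic_on disc" "z \<in> disc" for f z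
    by (rule holomorphic_derivI[OF that(1) open_ball that(2)])
  define \<alpha> where "\<alpha> = (1 + lam) / 2"
  have \<alpha>: "0 < 1 - \<alpha>" using lam by (simp add: \<alpha>_def)
  show ?thesis
  proof (rule that[of "2 * C"])
    show "0 < 2 * C" using C by simp
    fix g :: fn and N :: real
    assume g: "g holomorphic_on disc"
      and bop: "bounded_operator (morrey lam) (morrey_norm lam) bloch bloch_norm (T_op g)"
      and ess: "essential_norm (morrey lam) (morrey_norm lam) bloch bloch_norm (T_op g) < ennreal N"
    define W where "W z = (1 - (cmod z)\<^sup>2) powr \<alpha> * cmod (deriv g z)" for z
    \<comment> \<open>A nonpositive real becomes 0 under \<open>ennreal\<close>, and nothing lies
      strictly below 0.\<close>
    have N: "0 < N" using ess by (metis ennreal_eq_0_iff linorder_not_less not_less_zero)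
    obtain K where K: "compact_operator (morrey lam) (morrey_norm lam) bloch bloch_norm K"
      and KN: "operator_norm (morrey lam) (morrey_norm lam) bloch_norm (\<lambda>f z. T_op g f z - K f z) < ennreal N"
      using ess unfolding essential_norm_def by (auto simp: INF_less_iff)
    have lin: "linear_between (morrey lam) bloch K" using K by (simp add: compact_operator_def)
    have Kmem: "K f \<in> bloch" if "f \<in> morrey lam" for f using lin that by (simp add: linear_between_def)
    have Kadd: "K (\<lambda>z. f z + f' z) = (\<lambda>z. K f z + K f' z)" if "f \<in> morrey lam" "f' \<in> morrey lam" for f f'
      using lin that unfolding linear_between_def by blast
    have Kmult: "K (\<lambda>z. c * f z) = (\<lambda>z. c * K f z)" if "f \<in> morrey lam" for c f
      using lin that unfolding linear_between_def by blast
    have sq: "0 < 1 - (cmod z)\<^sup>2" if "z \<in> disc" for z using that by (simp add: abs_square_less_1)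
    obtain C0 where C0: "\<And>f. f \<in> morrey lam \<Longrightarrow> bloch_norm (T_op g f) \<le> ennreal C0 * morrey_norm lam f"
      using bop by (auto simp: bounded_operator_def)
    have TC: "bloch_norm (T_op g (test_fun lam a)) \<le> ennreal (max C0 0 * C)" if "cmod a < 1" for a
    proof -
      have "bloch_norm (T_op g (test_fun lam a)) \<le> ennreal C0 * morrey_norm lam (test_fun lam a)"
        by (rule C0[OF mem1[OF that]])
      also have "\<dots> \<le> ennreal (max C0 0) * ennreal C"
        by (intro mult_mono norm[OF that] ennreal_leI) auto
      finally show ?thesis using C by (simp add: ennreal_mult)
    qed
    define M where "M = max C0 0 * C"
    \<comment> \<open>Boundedness of the operator on the test functions bounds W on the whole disc.
      Since \<alpha> < 1, it follows that (1 - |z|^2) |g'(z)| is at most M (1 - |z|^2)^(1 -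
      \<alpha>), which tends to 0 at the circle.\<close>
    have M: "W z \<le> M" if z: "z \<in> disc" for z
    proof -
      have "(1 - (cmod z)\<^sup>2) * cmod (deriv (T_op g (test_fun lam z)) z) \<le> M"
        unfolding M_def using TC z C by (intro bloch_norm_le_imp) auto
      also have "deriv (T_op g (test_fun lam z)) z = test_fun lam z z * deriv g z"
        using z by (intro DERIV_imp_deriv T_op_has_field_derivative hol mem1 g) auto
      finally show ?thesis
        using test_fun_diag[of z lam] z by (simp add: W_def \<alpha>_def norm_mult flip: mult.assoc)
    qed
    show "\<exists>s<1. \<forall>z. s < cmod z \<and> cmod z < 1 \<longrightarrow> (1 - (cmod z)\<^sup>2) powr ((1 + lam) / 2) * cmod (deriv g z) \<le> 2 * C * N"
    proof (rule ccontr)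
      assume contra: "\<not> ?thesis"
      have "\<exists>z. 1 - 1 / real (Suc n) < cmod z \<and> cmod z < 1 \<and> 2 * C * N < W z" for n
        using contra[simplified not_ex, THEN spec[of _ "1 - 1 / real (Suc n)"]]
        by (auto simp: W_def \<alpha>_def not_le)
      then obtain a where a: "\<And>n. 1 - 1 / real (Suc n) < cmod (a n)" "\<And>n. cmod (a n) < 1" "\<And>n. 2 * C * N < W (a n)"
        by metis
      have a_lim: "(\<lambda>n. cmod (a n)) \<longlonglongrightarrow> 1"
      proof (rule tendsto_sandwich)
        have "(\<lambda>n. 1 - 1 / real (Suc n)) \<longlonglongrightarrow> 1 - 0"
          using LIMSEQ_Suc[OF lim_1_over_n] by (intro tendsto_diff) (auto simp: inverse_eq_divide)
        then show "(\<lambda>n. 1 - 1 / real (Suc n)) \<longlonglongrightarrow> 1" by simp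
        show "(\<lambda>_. 1::real) \<longlonglongrightarrow> 1" by simp
      qed (use a in \<open>auto intro!: always_eventually less_imp_le\<close>)
      obtain s h where s: "strict_mono (s :: nat \<Rightarrow> nat)" and h: "h \<in> bloch"
        and Klim: "(\<lambda>n. bloch_norm (\<lambda>z. K (test_fun lam (a (s n))) z - h z)) \<longlonglongrightarrow> 0"
      proof -
        have bounded: "(\<forall>n. test_fun lam (a n) \<in> morrey lam) \<and>
            (\<exists>C. \<forall>n. morrey_norm lam (test_fun lam (a n)) \<le> ennreal C)"
          using mem1 norm a by blast
        have "\<forall>F. (\<forall>n. F n \<in> morrey lam) \<and> (\<exists>C::real. \<forall>n. morrey_norm lam (F n) \<le> ennreal C) \<longrightarrow>
            (\<exists>s h. strict_mono (s :: nat \<Rightarrow> nat) \<and> h \<in> bloch \<and>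
              (\<lambda>n. bloch_norm (\<lambda>z. K (F (s n)) z - h z)) \<longlonglongrightarrow> 0)"
          using K unfolding compact_operator_def by (rule conjunct2)
        from this[THEN spec[of _ "\<lambda>n. test_fun lam (a n)"]] bounded
        have "\<exists>s h. strict_mono (s :: nat \<Rightarrow> nat) \<and> h \<in> bloch \<and>
              (\<lambda>n. bloch_norm (\<lambda>z. K (test_fun lam (a (s n))) z - h z)) \<longlonglongrightarrow> 0"
          by (rule mp)
        then show ?thesis using that by blast
      qed
      define b where "b n = a (s n)" for n
      have b: "b n \<in> disc" "2 * C * N < W (b n)" for n using a by (auto simp: b_def)
      have b1: "cmod (b n) < 1" for n using b by simp
      have b_lim: "(\<lambda>n. cmod (b n)) \<longlonglongrightarrow> 1"
        using LIMSEQ_subseq_LIMSEQ[OF a_lim s] by (simp add: b_def o_def)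
      \<comment> \<open>Three error terms of this size together with C N make up 2 C N, the value
        that W exceeds along the sequence.\<close>
      define \<epsilon> where "\<epsilon> = C * N / 3"
      have \<epsilon>: "0 < \<epsilon>" using C N by (simp add: \<epsilon>_def)
      have "eventually (\<lambda>n. bloch_norm (\<lambda>z. K (test_fun lam (b n)) z - h z) < ennreal \<epsilon>) sequentially"
        using order_tendstoD(2)[OF Klim, of "ennreal \<epsilon>"] \<epsilon> by (simp add: b_def)
      then obtain n0 where n0: "\<And>n. n \<ge> n0 \<Longrightarrow> bloch_norm (\<lambda>z. K (test_fun lam (b n)) z - h z) \<le> ennreal \<epsilon>"
        by (auto simp: eventually_sequentially intro: less_imp_le)
      have Kh: "(1 - (cmod z)\<^sup>2) * cmod (deriv (K (test_fun lam (b n))) z - deriv h z) \<le> \<epsilon>"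
        if "n \<ge> n0" "z \<in> disc" for n z
      proof -
        have "deriv (\<lambda>z. K (test_fun lam (b n)) z - h z) z = deriv (K (test_fun lam (b n))) z - deriv h z"
          using der[OF bhol[OF Kmem[OF mem1[OF b1]]] that(2)] der[OF bhol[OF h] that(2)]
          by (intro DERIV_imp_deriv) (auto intro!: derivative_eq_intros)
        then show ?thesis using bloch_norm_le_imp[OF n0[OF that(1)] less_imp_le[OF \<epsilon>] that(2)] by simp
      qed
      obtain B where B0: "0 \<le> B" and B: "\<And>z. z \<in> disc \<Longrightarrow> cmod (test_fun lam (b n0) z) \<le> B"
      proof -
        obtain B where "0 \<le> B" and "\<And>z. z \<in> cball 0 1 \<Longrightarrow>
            cmod (of_real ((1 - (cmod (b n0))\<^sup>2) powr ((1 + lam) / 2)) / (1 - cnj (b n0) * z)) \<le> B"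
          using continuous_on_compact_bound[OF compact_cball test_fun_continuous_extension[OF b1]] by blast
        then show ?thesis using that[of B] by (auto simp: test_fun_def)
      qed
      \<comment> \<open>B bounds the fixed test function and M bounds W, so B M times this power
        bounds its contribution at the point \<open>b n\<close>.\<close>
      have "((\<lambda>n. (1 - (cmod (b n))\<^sup>2) powr (1 - \<alpha>)) \<longlongrightarrow> 0) sequentially"
      proof (rule tendsto_zero_powrI)
        have "(\<lambda>n. 1 - (cmod (b n))\<^sup>2) \<longlonglongrightarrow> 1 - 1\<^sup>2" by (intro tendsto_intros b_lim)
        then show "(\<lambda>n. 1 - (cmod (b n))\<^sup>2) \<longlonglongrightarrow> 0" by simp
        show "\<forall>\<^sub>F n in sequentially. 0 \<le> 1 - (cmod (b n))\<^sup>2"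
          by (intro always_eventually allI less_imp_le sq b)
      qed (use \<alpha> in auto)
      then have "((\<lambda>n. B * M * (1 - (cmod (b n))\<^sup>2) powr (1 - \<alpha>)) \<longlongrightarrow> B * M * 0) sequentially"
        by (intro tendsto_intros)
      then have "eventually (\<lambda>n. B * M * (1 - (cmod (b n))\<^sup>2) powr (1 - \<alpha>) < \<epsilon>) sequentially"
        using \<epsilon> by (intro order_tendstoD) auto
      from eventually_conj[OF eventually_ge_at_top[of n0] this]
      obtain m where m: "m \<ge> n0" "B * M * (1 - (cmod (b m))\<^sup>2) powr (1 - \<alpha>) < \<epsilon>"
        by (auto dest: eventually_happens)
      define z where "z = b m"
      define w where "w = 1 - (cmod z)\<^sup>2"
      have z: "z \<in> disc" using b by (simp add: z_def)
      have w: "0 < w" using sq[OF z] by (simp add: w_def)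
      let ?fm = "test_fun lam (b m)" and ?fn = "test_fun lam (b n0)"
      let ?u = "\<lambda>z. of_real (1 / C) * (?fm z + (- 1) * ?fn z)"
      \<comment> \<open>K is linear only for functions known to lie in the carrier. The scaled
        difference does, so it is multiplied by C, split by additivity and divided by C
        again.\<close>
      have Ku: "K ?u = (\<lambda>z. of_real (1 / C) * (K ?fm z + (- 1) * K ?fn z))"
      proof -
        have "K (\<lambda>z. of_real C * ?u z) = (\<lambda>z. of_real C * K ?u z)"
          by (rule Kmult[OF dmem[OF b1 b1]])
        moreover have "(\<lambda>z. of_real C * ?u z) = (\<lambda>z. ?fm z + (- 1) * ?fn z)" using C by (simp add: fun_eq_iff)
        moreover have "K (\<lambda>z. ?fm z + (- 1) * ?fn z) = (\<lambda>z. K ?fm z + K (\<lambda>z. (- 1) * ?fn z) z)"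
          by (rule Kadd[OF mem1[OF b1] mem[OF b1]])
        moreover have "K (\<lambda>z. (- 1) * ?fn z) = (\<lambda>z. (- 1) * K ?fn z)"
          by (rule Kmult[OF mem1[OF b1]])
        ultimately have "(\<lambda>z. of_real C * K ?u z) = (\<lambda>z. K ?fm z + (- 1) * K ?fn z)" by simp
        then have "of_real C * K ?u z = K ?fm z + (- 1) * K ?fn z" for z by (rule fun_cong)
        then have "of_real (1 / C) * (of_real C * K ?u z) = of_real (1 / C) * (K ?fm z + (- 1) * K ?fn z)" for z
          by (simp only:)
        then show ?thesis using C by (simp add: fun_eq_iff flip: mult.assoc of_real_mult)
      qed
      have "bloch_norm (\<lambda>z. T_op g ?u z - K ?u z) \<le>
          operator_norm (morrey lam) (morrey_norm lam) bloch_norm (\<lambda>f z. T_op g f z - K f z)"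
        unfolding operator_norm_def by (rule SUP_upper) (use dmem[OF b1 b1] dnorm[OF b1 b1] in blast)
      then have "bloch_norm (\<lambda>z. T_op g ?u z - K ?u z) \<le> ennreal N" using KN by simp
      then have "w * cmod (deriv (\<lambda>z. T_op g ?u z - K ?u z) z) \<le> N"
        unfolding w_def using N z by (intro bloch_norm_le_imp) auto
      also have "deriv (\<lambda>z. T_op g ?u z - K ?u z) z =
          of_real (1 / C) * ((?fm z - ?fn z) * deriv g z - (deriv (K ?fm) z - deriv (K ?fn) z))"
      proof (rule DERIV_imp_deriv)
        have "(K ?u has_field_derivative of_real (1 / C) * (deriv (K ?fm) z + (- 1) * deriv (K ?fn) z)) (at z)"
          unfolding Ku
          by (intro DERIV_cmult DERIV_add der[OF bhol[OF Kmem[OF mem1[OF b1]]] z])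
        from DERIV_diff[OF T_op_has_field_derivative[OF hol[OF dmem[OF b1 b1]] g z] this]
        show "((\<lambda>z. T_op g ?u z - K ?u z) has_field_derivative
            of_real (1 / C) * ((?fm z - ?fn z) * deriv g z - (deriv (K ?fm) z - deriv (K ?fn) z))) (at z)"
          by (rule back_subst[where P = "\<lambda>d. (_ has_field_derivative d) _"]) (simp add: algebra_simps)
      qed
      also have "cmod \<dots> = cmod ((?fm z - ?fn z) * deriv g z - (deriv (K ?fm) z - deriv (K ?fn) z)) / C"
        using C by (simp add: norm_mult norm_divide)
      finally have est: "w * cmod ((?fm z - ?fn z) * deriv g z - (deriv (K ?fm) z - deriv (K ?fn) z)) \<le> C * N"
        using C by (simp add: field_simps)
      \<comment> \<open>The main term is A1 + A2 + A3 - A4: the value of T - K on the difference,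
        the fixed test function, and the two deviations of the images under K from h.\<close>
      define A1 A2 A3 A4 where
        "A1 = (?fm z - ?fn z) * deriv g z - (deriv (K ?fm) z - deriv (K ?fn) z)" and
        "A2 = ?fn z * deriv g z" and
        "A3 = deriv (K ?fm) z - deriv h z" and "A4 = deriv (K ?fn) z - deriv h z"
      have "cmod (?fm z * deriv g z) = cmod (A1 + A2 + A3 - A4)"
        by (simp add: A1_def A2_def A3_def A4_def algebra_simps)
      also have "\<dots> \<le> cmod A1 + cmod A2 + cmod A3 + cmod A4"
        by (intro order_trans[OF norm_triangle_ineq4] add_right_mono order_trans[OF norm_triangle_ineq] order_refl)
      finally have "w * cmod (?fm z * deriv g z) \<le> w * (cmod A1 + cmod A2 + cmod A3 + cmod A4)"
        using w by simp
      also have "\<dots> = w * cmod A1 + w * cmod A2 + w * cmod A3 + w * cmod A4" by (simp add: algebra_simps)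
      also have "\<dots> \<le> C * N + \<epsilon> + \<epsilon> + \<epsilon>"
      proof (intro add_mono)
        show "w * cmod A1 \<le> C * N" using est by (simp add: A1_def)
        show "w * cmod A3 \<le> \<epsilon>" unfolding A3_def w_def by (rule Kh[OF m(1) z])
        show "w * cmod A4 \<le> \<epsilon>" unfolding A4_def w_def by (rule Kh[OF order_refl z])
        have "w * cmod A2 = cmod (?fn z) * (w powr 1 * cmod (deriv g z))"
          using w by (simp add: A2_def norm_mult)
        also have "w powr 1 = w powr (1 - \<alpha>) * w powr \<alpha>" by (simp flip: powr_add)
        also have "cmod (?fn z) * (w powr (1 - \<alpha>) * w powr \<alpha> * cmod (deriv g z)) =
            cmod (?fn z) * (w powr (1 - \<alpha>) * W z)" by (simp add: W_def w_def)
        also have "\<dots> \<le> B * (w powr (1 - \<alpha>) * M)"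
          using B[OF z] M[OF z] B0 by (intro mult_mono mult_left_mono) (auto simp: W_def)
        also have "\<dots> \<le> \<epsilon>" using m(2) by (simp add: w_def z_def mult_ac)
        finally show "w * cmod A2 \<le> \<epsilon>" .
      qed
      also have "\<dots> = 2 * C * N" by (simp add: \<epsilon>_def)
      finally have "w * cmod (?fm z * deriv g z) \<le> 2 * C * N" .
      moreover have "w * cmod (?fm z * deriv g z) = W z"
        using test_fun_diag[OF b1, of m lam] by (simp add: w_def z_def W_def \<alpha>_def norm_mult flip: mult.assoc)
      ultimately show False using b(2)[of m] by (simp add: z_def)
    qed
  qed
qed

section \<open>Comparison with the invariant integral\<close>

text \<open>The quotient is the modulus of the derivative of the disc automorphism that interchanges
  a and 0.\<close>

definition mobius_integral :: "real \<Rightarrow> real \<Rightarrow> (complex \<Rightarrow> complex) \<Rightarrow> complex \<Rightarrow> ennreal"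
  where "mobius_integral p lam g a = area_integral disc
    (\<lambda>z. ((1 - (cmod a)\<^sup>2) / (cmod (1 - cnj a * z))\<^sup>2) powr (p + 1 - lam) *
      (cmod (deriv g z))\<^sup>2 * (1 - (cmod z)\<^sup>2) powr p)"

lemma eventually_cmod_at_left_1:
  "eventually P (filtercomap cmod (at_left 1)) \<longleftrightarrow> (\<exists>s\<ge>0. s < 1 \<and> (\<forall>z. s < cmod z \<and> cmod z < 1 \<longrightarrow> P z))"
proof
  assume "eventually P (filtercomap cmod (at_left 1))"
  then obtain Q where Q: "eventually Q (at_left (1::real))" "\<And>z. Q (cmod z) \<Longrightarrow> P z"
    by (auto simp: eventually_filtercomap)
  obtain s where "s < 1" "\<And>y. s < y \<Longrightarrow> y < 1 \<Longrightarrow> Q y"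
    using Q(1) eventually_at_left[of 0 "1::real" Q] by auto
  then show "\<exists>s\<ge>0. s < 1 \<and> (\<forall>z. s < cmod z \<and> cmod z < 1 \<longrightarrow> P z)"
    using Q(2) by (intro exI[of _ "max s 0"]) auto
next
  assume "\<exists>s\<ge>0. s < 1 \<and> (\<forall>z. s < cmod z \<and> cmod z < 1 \<longrightarrow> P z)"
  then obtain s where s: "s < 1" "\<And>z. s < cmod z \<Longrightarrow> cmod z < 1 \<Longrightarrow> P z" by auto
  have "eventually (\<lambda>x. x \<in> {s<..<1}) (at_left 1)" using s by (intro eventually_at_left_real)
  then show "eventually P (filtercomap cmod (at_left 1))"
    unfolding eventually_filtercomap using s by (intro exI[of _ "\<lambda>x. x \<in> {s<..<1}"]) auto
qed

text \<open>On the ball of radius \<delta> / 2 about a, with \<delta> = 1 - |a|, the kernel is at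
  most 3 \<delta>, so the quotient is at least 1 / (9 \<delta>) and the weight at least (\<delta> /
  2)^p. With the squared radius the powers of \<delta> add up to 1 + lam.\<close>

lemma mobius_integral_ge:
  assumes p: "1 < p" and lam: "0 < lam" "lam < 1"
  obtains k where "0 < k" "\<And>g a. g holomorphic_on disc \<Longrightarrow> cmod a < 1 \<Longrightarrow>
    ennreal ((k * ((1 - cmod a) powr ((1 + lam) / 2) * cmod (deriv g a)))\<^sup>2) \<le> mobius_integral p lam g a"
proof -
  define \<sigma> where "\<sigma> = p + 1 - lam"
  have \<sigma>: "0 < \<sigma>" using p lam by (simp add: \<sigma>_def)
  define k where "k = (1 / 9) powr \<sigma> * (1 / 2) powr p / 4"
  have k: "0 < k" by (simp add: k_def)
  show ?thesis
  proof (rule that[of "sqrt k"])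
    show "0 < sqrt k" using k by simp
    fix g :: "complex \<Rightarrow> complex" and a :: complex
    assume g: "g holomorphic_on disc" and a: "cmod a < 1"
    define \<delta> where "\<delta> = 1 - cmod a"
    have \<delta>: "0 < \<delta>" using a by (simp add: \<delta>_def)
    define c where "c = (1 / (9 * \<delta>)) powr \<sigma> * (\<delta> / 2) powr p"
    have "ennreal (c * (\<delta> / 2)\<^sup>2 * (cmod (deriv g a))\<^sup>2) \<le> mobius_integral p lam g a"
      unfolding mobius_integral_def
    proof (rule area_integral_ge_center[where F = "deriv g"])
      show "deriv g holomorphic_on ball a (\<delta> / 2)"
        using holomorphic_deriv[OF g] ball_in_disc(1)[OF a] by (auto simp: \<delta>_def intro: holomorphic_on_subset)
      show "ball a (\<delta> / 2) \<subseteq> disc" using ball_in_disc(1)[OF a] by (simp add: \<delta>_def)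
      fix z assume z: "z \<in> ball a (\<delta> / 2)"
      have zd: "z \<in> disc" using z ball_in_disc(1)[OF a] by (auto simp: \<delta>_def)
      have pos: "0 < cmod (1 - cnj a * z)" using disc_kernel_pos[OF a, of z] zd by simp
      have a2: "\<delta> \<le> 1 - (cmod a)\<^sup>2" "1 - (cmod a)\<^sup>2 \<le> 2 * \<delta>"
        using one_minus_square_bounds[of "cmod a"] a by (auto simp: \<delta>_def)
      have "1 - cnj a * z = of_real (1 - (cmod a)\<^sup>2) - cnj a * (z - a)"
        using complex_norm_square[of a] by (simp add: algebra_simps)
      then have "cmod (1 - cnj a * z) \<le> cmod (of_real (1 - (cmod a)\<^sup>2)) + cmod (cnj a * (z - a))"
        by (simp only: norm_triangle_ineq4)
      also have "\<dots> \<le> 2 * \<delta> + 1 * (\<delta> / 2)"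
      proof (rule add_mono)
        show "cmod (of_real (1 - (cmod a)\<^sup>2)) \<le> 2 * \<delta>" unfolding norm_of_real using a2 \<delta> by simp
        show "cmod (cnj a * (z - a)) \<le> 1 * (\<delta> / 2)"
          unfolding norm_mult using a z by (intro mult_mono) (auto simp: dist_norm norm_minus_commute)
      qed
      finally have "(cmod (1 - cnj a * z))\<^sup>2 \<le> (3 * \<delta>)\<^sup>2" using \<delta> by (intro power_mono) auto
      then have "1 / (9 * \<delta>) * (cmod (1 - cnj a * z))\<^sup>2 \<le> 1 / (9 * \<delta>) * (3 * \<delta>)\<^sup>2"
        using \<delta> by (intro mult_left_mono) auto
      also have "\<dots> = \<delta>" using \<delta> by (simp add: power2_eq_square)
      also note a2(1)
      finally have "1 / (9 * \<delta>) \<le> (1 - (cmod a)\<^sup>2) / (cmod (1 - cnj a * z))\<^sup>2"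
        using pos by (simp add: pos_le_divide_eq)
      then have "(1 / (9 * \<delta>)) powr \<sigma> \<le> ((1 - (cmod a)\<^sup>2) / (cmod (1 - cnj a * z))\<^sup>2) powr (p + 1 - lam)"
        unfolding \<sigma>_def[symmetric] using \<delta> \<sigma> by (intro powr_mono2) auto
      moreover have "(\<delta> / 2) powr p \<le> (1 - (cmod z)\<^sup>2) powr p"
        using ball_in_disc(2)[OF a, of z] z p \<delta> by (intro powr_mono2) (auto simp: \<delta>_def)
      ultimately have "c \<le> ((1 - (cmod a)\<^sup>2) / (cmod (1 - cnj a * z))\<^sup>2) powr (p + 1 - lam) * (1 - (cmod z)\<^sup>2) powr p"
        unfolding c_def by (intro mult_mono) auto
      then have "c * (cmod (deriv g z))\<^sup>2 \<le> ((1 - (cmod a)\<^sup>2) / (cmod (1 - cnj a * z))\<^sup>2) powr (p + 1 - lam) *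
          (1 - (cmod z)\<^sup>2) powr p * (cmod (deriv g z))\<^sup>2"
        by (rule mult_right_mono) simp
      then show "c * (cmod (deriv g z))\<^sup>2 \<le> ((1 - (cmod a)\<^sup>2) / (cmod (1 - cnj a * z))\<^sup>2) powr (p + 1 - lam) *
          (cmod (deriv g z))\<^sup>2 * (1 - (cmod z)\<^sup>2) powr p"
        by (simp only: mult_ac)
    qed (use \<delta> in \<open>auto simp: c_def\<close>)
    also have "c * (\<delta> / 2)\<^sup>2 = k * (\<delta> powr ((1 + lam) / 2))\<^sup>2"
    proof -
      have "(1 / (9 * \<delta>)) powr \<sigma> = (1 / 9) powr \<sigma> * \<delta> powr - \<sigma>"
      proof -
        have "1 / (9 * \<delta>) = 1 / 9 * \<delta> powr - 1" using \<delta> by simp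
        then show ?thesis by (simp only: powr_mult powr_powr) simp
      qed
      moreover have "(\<delta> / 2) powr p = (1 / 2) powr p * \<delta> powr p"
        using powr_mult[of "1 / 2" \<delta> p] by simp
      moreover have "(\<delta> / 2)\<^sup>2 = \<delta> powr 2 / 4" using \<delta> by (simp add: power_divide)
      ultimately have "c * (\<delta> / 2)\<^sup>2 = k * (\<delta> powr - \<sigma> * \<delta> powr p * \<delta> powr 2)"
        unfolding c_def k_def by (simp only: times_divide_eq_right times_divide_eq_left mult_ac)
      also have "\<delta> powr - \<sigma> * \<delta> powr p * \<delta> powr 2 = \<delta> powr ((1 + lam) / 2 + (1 + lam) / 2)"
        unfolding powr_add[symmetric] by (rule arg_cong[where f = "(powr) \<delta>"]) (simp add: \<sigma>_def)
      also have "\<dots> = (\<delta> powr ((1 + lam) / 2))\<^sup>2" by (simp only: powr_add power2_eq_square)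
      finally show ?thesis .
    qed
    finally show "ennreal ((sqrt k * ((1 - cmod a) powr ((1 + lam) / 2) * cmod (deriv g a)))\<^sup>2) \<le> mobius_integral p lam g a"
      using k by (simp add: power_mult_distrib \<delta>_def mult.assoc)
  qed
qed

text \<open>For |z| > s the bound on g' reduces the integrand to a Forelli-Rudin kernel, whose
  integral is bounded by a multiple of \<eta>^2 uniformly in a. The part |z| \<le> s depends on g
  but vanishes as |a| tends to 1, hence an eventual bound with a constant free of g and s.\<close>

lemma mobius_integral_eventually_le:
  assumes p: "1 < p" and lam: "0 < lam" "lam < 1"
  obtains C where "0 < C" "\<And>g \<eta> s. g holomorphic_on disc \<Longrightarrow> 0 < \<eta> \<Longrightarrow> 0 \<le> s \<Longrightarrow> s < 1 \<Longrightarrow>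
    (\<And>z. s < cmod z \<Longrightarrow> cmod z < 1 \<Longrightarrow> (1 - cmod z) powr ((1 + lam) / 2) * cmod (deriv g z) \<le> \<eta>) \<Longrightarrow>
    eventually (\<lambda>a. mobius_integral p lam g a \<le> ennreal ((C * \<eta>)\<^sup>2)) (filtercomap cmod (at_left 1))"
proof -
  define \<sigma> where "\<sigma> = p + 1 - lam"
  \<comment> \<open>The exponent left after the weight p is reduced by 1 + lam from |g'|^2. Here t +
    2 = \<sigma>, so the kernel power 2 \<sigma> returns (1 - |a|)^(-\<sigma>), cancelling the
    numerator.\<close>
  define t where "t = p - 1 - lam"
  have \<sigma>: "0 < \<sigma>" "- 1 < t" "t + 2 < 2 * \<sigma>" "t + 2 - 2 * \<sigma> = - \<sigma>" using p lam by (auto simp: \<sigma>_def t_def)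
  obtain C0 where C0: "0 < C0" "\<And>a. cmod a < 1 \<Longrightarrow>
      (\<integral>\<^sup>+z\<in>disc. ennreal ((1 - cmod z) powr t * cmod (1 - cnj a * z) powr - (2 * \<sigma>)) \<partial>lborel)
        \<le> ennreal (C0 * (1 - cmod a) powr (t + 2 - 2 * \<sigma>))"
    using forelli_rudin[OF \<sigma>(2,3)] by blast
  define k where "k = 2 powr p * 2 powr \<sigma> * C0 / pi"
  have k: "0 < k" using C0 by (simp add: k_def)
  show ?thesis
  proof (rule that[of "sqrt (k + 1)"])
    show "0 < sqrt (k + 1)" using k by simp
    fix g :: "complex \<Rightarrow> complex" and \<eta> s :: real
    assume g: "g holomorphic_on disc" and \<eta>: "0 < \<eta>" and s: "0 \<le> s" "s < 1"
      and g\<eta>: "\<And>z. s < cmod z \<Longrightarrow> cmod z < 1 \<Longrightarrow> (1 - cmod z) powr ((1 + lam) / 2) * cmod (deriv g z) \<le> \<eta>"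
    have "continuous_on (cball 0 s) (deriv g)"
      using holomorphic_deriv[OF g] s by (intro continuous_on_subset[OF holomorphic_on_imp_continuous_on]) auto
    then obtain b where b0: "0 \<le> b" and b: "\<And>z. z \<in> cball 0 s \<Longrightarrow> cmod (deriv g z) \<le> b"
      using continuous_on_compact_bound[OF compact_cball] by blast
    \<comment> \<open>For |z| \<le> s the kernel is at least 1 - s, |g'| is at most b and the weight
      at most 1; E is the resulting bound as a function of x = |a|.\<close>
    define E where "E x = ((1 - x\<^sup>2) / (1 - s)\<^sup>2) powr \<sigma> * b\<^sup>2" for x :: real
    have "eventually (\<lambda>x. E x < \<eta>\<^sup>2) (at_left 1)"
    proof (rule order_tendstoD)
      have "((\<lambda>x. (1 - x\<^sup>2) / (1 - s)\<^sup>2) \<longlongrightarrow> (1 - 1\<^sup>2) / (1 - s)\<^sup>2) (at_left (1::real))"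
        using s by (intro tendsto_intros) auto
      then have "((\<lambda>x. ((1 - x\<^sup>2) / (1 - s)\<^sup>2) powr \<sigma>) \<longlongrightarrow> 0) (at_left 1)"
      proof (intro tendsto_zero_powrI)
        have "eventually (\<lambda>x::real. x \<in> {0<..<1}) (at_left 1)" by (rule eventually_at_left_real) simp
        then show "eventually (\<lambda>x. 0 \<le> (1 - x\<^sup>2) / (1 - s)\<^sup>2) (at_left 1)"
          by eventually_elim (auto intro!: divide_nonneg_nonneg one_minus_square_bounds)
      qed (use \<sigma> in auto)
      then have "((\<lambda>x. E x) \<longlongrightarrow> 0 * b\<^sup>2) (at_left 1)" unfolding E_def by (intro tendsto_intros)
      then show "(E \<longlongrightarrow> 0) (at_left 1)" by simp
    qed (use \<eta> in simp)
    then have "eventually (\<lambda>a. E (cmod a) < \<eta>\<^sup>2) (filtercomap cmod (at_left 1))"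
      by (rule eventually_filtercomapI)
    moreover have "eventually (\<lambda>a. cmod a < 1) (filtercomap cmod (at_left 1))"
      unfolding eventually_cmod_at_left_1 by (intro exI[of _ 0]) auto
    ultimately show "eventually (\<lambda>a. mobius_integral p lam g a \<le> ennreal ((sqrt (k + 1) * \<eta>)\<^sup>2)) (filtercomap cmod (at_left 1))"
    proof eventually_elim
      case (elim a)
      define \<delta> where "\<delta> = 1 - cmod a"
      have \<delta>: "0 < \<delta>" using elim by (simp add: \<delta>_def)
      define H where "H z = (1 - cmod z) powr t * cmod (1 - cnj a * z) powr - (2 * \<sigma>)" for z
      define c where "c = \<eta>\<^sup>2 * 2 powr p * 2 powr \<sigma> * \<delta> powr \<sigma>"
      have c: "0 \<le> c" by (simp add: c_def)
      have E0: "0 \<le> E (cmod a)" by (simp add: E_def)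
      have a2: "0 \<le> 1 - (cmod a)\<^sup>2" "1 - (cmod a)\<^sup>2 \<le> 2 * \<delta>"
        using one_minus_square_bounds[of "cmod a"] elim by (auto simp: \<delta>_def)
      have [measurable]: "H \<in> borel_measurable borel" unfolding H_def[abs_def] by measurable
      \<comment> \<open>Adding both regional bounds gives one majorant on the whole disc, so the
        domain of integration need not be split.\<close>
      have pt: "((1 - (cmod a)\<^sup>2) / (cmod (1 - cnj a * z))\<^sup>2) powr (p + 1 - lam) * (cmod (deriv g z))\<^sup>2 * (1 - (cmod z)\<^sup>2) powr p
          \<le> c * H z + E (cmod a)" if z: "z \<in> disc" for z
      proof (cases "cmod z \<le> s")
        case True
        define x where "x = cmod (1 - cnj a * z)"
        have "1 - s \<le> x" using disc_kernel_pos(2)[OF elim(2), of z] z True by (simp add: x_def)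
        then have "(1 - s)\<^sup>2 \<le> x\<^sup>2" using s by (intro power_mono) auto
        then have "(1 - (cmod a)\<^sup>2) / x\<^sup>2 \<le> (1 - (cmod a)\<^sup>2) / (1 - s)\<^sup>2"
          using a2 s by (intro divide_left_mono mult_pos_pos) auto
        then have "((1 - (cmod a)\<^sup>2) / x\<^sup>2) powr \<sigma> \<le> ((1 - (cmod a)\<^sup>2) / (1 - s)\<^sup>2) powr \<sigma>"
          using a2 \<sigma> by (intro powr_mono2) auto
        moreover have "(cmod (deriv g z))\<^sup>2 \<le> b\<^sup>2" using b[of z] True by (intro power_mono) auto
        moreover have "(1 - (cmod z)\<^sup>2) powr p \<le> 1"
          using z p one_minus_square_bounds[of "cmod z"] by (intro powr_le1) auto
        ultimately have "((1 - (cmod a)\<^sup>2) / x\<^sup>2) powr \<sigma> * (cmod (deriv g z))\<^sup>2 * (1 - (cmod z)\<^sup>2) powr p \<le> E (cmod a) * 1"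
          unfolding E_def by (intro mult_mono) auto
        moreover have "0 \<le> c * H z" using c by (simp add: H_def)
        ultimately show ?thesis by (simp add: x_def \<sigma>_def)
      next
        case False
        define x y where "x = cmod (1 - cnj a * z)" and "y = 1 - cmod z"
        have x: "0 < x" using disc_kernel_pos(3)[OF elim(2), of z] z by (simp add: x_def)
        have y: "0 < y" using z by (simp add: y_def)
        have "((1 - (cmod a)\<^sup>2) / x\<^sup>2) powr \<sigma> \<le> (2 * \<delta> / x\<^sup>2) powr \<sigma>"
          using a2 \<sigma> by (intro powr_mono2 divide_right_mono) auto
        also have "\<dots> = 2 powr \<sigma> * \<delta> powr \<sigma> * x powr - (2 * \<sigma>)"
        proof -
          have "2 * \<delta> / x\<^sup>2 = 2 * \<delta> * x powr - 2" using x by (simp add: powr_minus_divide)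
          then show ?thesis by (simp only: powr_mult powr_powr) simp
        qed
        finally have 1: "((1 - (cmod a)\<^sup>2) / x\<^sup>2) powr \<sigma> \<le> 2 powr \<sigma> * \<delta> powr \<sigma> * x powr - (2 * \<sigma>)" .
        have "cmod (deriv g z) \<le> \<eta> * y powr - ((1 + lam) / 2)"
          using g\<eta>[of z] False z y by (simp add: y_def powr_minus field_simps)
        then have "(cmod (deriv g z))\<^sup>2 \<le> (\<eta> * y powr - ((1 + lam) / 2))\<^sup>2" by (intro power_mono) auto
        also have "\<dots> = \<eta>\<^sup>2 * y powr - (1 + lam)"
          by (simp add: power2_eq_square mult_ac flip: powr_add)
        finally have 2: "(cmod (deriv g z))\<^sup>2 \<le> \<eta>\<^sup>2 * y powr - (1 + lam)" .
        have "(1 - (cmod z)\<^sup>2) powr p \<le> (2 * y) powr p"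
          using z p one_minus_square_bounds[of "cmod z"] by (intro powr_mono2) (auto simp: y_def)
        then have 3: "(1 - (cmod z)\<^sup>2) powr p \<le> 2 powr p * y powr p" by (simp only: powr_mult)
        have "((1 - (cmod a)\<^sup>2) / x\<^sup>2) powr \<sigma> * (cmod (deriv g z))\<^sup>2 * (1 - (cmod z)\<^sup>2) powr p \<le>
            (2 powr \<sigma> * \<delta> powr \<sigma> * x powr - (2 * \<sigma>)) * (\<eta>\<^sup>2 * y powr - (1 + lam)) * (2 powr p * y powr p)"
          using 1 2 3 by (intro mult_mono) auto
        also have "\<dots> = c * ((y powr p * y powr - (1 + lam)) * x powr - (2 * \<sigma>))"
          by (simp only: c_def mult_ac)
        also have "y powr p * y powr - (1 + lam) = y powr t"
          unfolding powr_add[symmetric] by (rule arg_cong[where f = "(powr) y"]) (simp add: t_def)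
        also have "c * (y powr t * x powr - (2 * \<sigma>)) = c * H z" by (simp add: H_def x_def y_def)
        finally show ?thesis using E0 by (simp add: x_def \<sigma>_def)
      qed
      have H0: "0 \<le> H z" for z by (simp add: H_def)
      have "area_integral disc (\<lambda>z. c * H z) = ennreal c * area_integral disc H"
        by (rule area_integral_cmult) (use c in auto)
      also have "\<dots> \<le> ennreal c * (ennreal (1 / pi) * ennreal (C0 * \<delta> powr - \<sigma>))"
        unfolding area_integral_def H_def \<delta>_def
        by (rule mult_left_mono[OF mult_left_mono[OF C0(2)[OF elim(2), unfolded \<sigma>(4)]]]) auto
      also have "\<dots> = ennreal (c * (1 / pi * (C0 * \<delta> powr - \<sigma>)))"
        using c C0(1) by (simp flip: ennreal_mult)
      also have "c * (1 / pi * (C0 * \<delta> powr - \<sigma>)) = \<eta>\<^sup>2 * k * (\<delta> powr \<sigma> * \<delta> powr - \<sigma>)"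
        by (simp add: c_def k_def)
      also have "\<delta> powr \<sigma> * \<delta> powr - \<sigma> = 1" using \<delta> by (simp flip: powr_add)
      finally have main: "area_integral disc (\<lambda>z. c * H z) \<le> ennreal (\<eta>\<^sup>2 * k)" by simp
      have "area_integral disc (\<lambda>_. E (cmod a)) = ennreal (1 / pi) * (ennreal (E (cmod a)) * ennreal (pi * 1\<^sup>2))"
        unfolding area_integral_def
        by (subst nn_integral_cmult_indicator) (simp_all add: emeasure_lborel_complex_ball)
      also have "\<dots> = ennreal (1 / pi * (E (cmod a) * (pi * 1\<^sup>2)))"
        using E0 by (simp flip: ennreal_mult)
      also have "\<dots> \<le> ennreal (\<eta>\<^sup>2)" using elim by (intro ennreal_leI) simp
      finally have rest: "area_integral disc (\<lambda>_. E (cmod a)) \<le> ennreal (\<eta>\<^sup>2)" .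
      have "mobius_integral p lam g a \<le> area_integral disc (\<lambda>z. c * H z + E (cmod a))"
        unfolding mobius_integral_def by (intro area_integral_mono pt) auto
      also have "\<dots> = area_integral disc (\<lambda>z. c * H z) + area_integral disc (\<lambda>_. E (cmod a))"
        by (rule area_integral_add) (use c E0 H0 in auto)
      also have "\<dots> \<le> ennreal (\<eta>\<^sup>2 * k) + ennreal (\<eta>\<^sup>2)" by (rule add_mono[OF main rest])
      also have "\<dots> = ennreal ((sqrt (k + 1) * \<eta>)\<^sup>2)"
        using k by (simp add: power_mult_distrib algebra_simps flip: ennreal_plus)
      finally show ?case .
    qed
  qed
qed

text \<open>Both halves of the theorem are proved for reals N strictly above a limit superior or an
  infimum; this passes to the value itself. An infinite X makes the right side infinite.\<close>

lemma ennreal_le_cmult_dense: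
  assumes c: "0 < c" and le: "\<And>N. 0 < N \<Longrightarrow> X < ennreal N \<Longrightarrow> Y \<le> ennreal (c * N)"
  shows "Y \<le> ennreal c * X"
proof (cases X)
  case (real x)
  \<comment> \<open>One admissible N shows that Y is finite, so the limiting argument can run in the
    reals.\<close>
  have "Y \<le> ennreal (c * (x + 1))" using real by (intro le) (auto simp: ennreal_less_iff)
  then obtain y where y: "Y = ennreal y" "0 \<le> y" by (cases Y) (auto simp: top_unique)
  have "y / c \<le> x"
  proof (rule dense_ge)
    fix N assume "x < N"
    then have "Y \<le> ennreal (c * N)" using real by (intro le) (auto simp: ennreal_less_iff)
    then show "y / c \<le> N" using y c \<open>x < N\<close> real by (simp add: ennreal_le_iff field_simps)
  qed
  then show ?thesis using real y c by (simp add: field_simps ennreal_leI flip: ennreal_mult)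
qed (use c in \<open>simp add: ennreal_mult_top\<close>)

theorem theorem4p2:
  fixes p lam :: real
  assumes "0 < lam" and "lam < 1" and "1 < p"
  shows "\<exists>C::real. C > 0 \<and>
    (\<forall>g. g holomorphic_on disc \<and>
         bounded_operator (morrey lam) (morrey_norm lam) bloch bloch_norm (T_op g) \<longrightarrow>
       (let E = essential_norm (morrey lam) (morrey_norm lam) bloch bloch_norm (T_op g);
            L = Limsup (filtercomap cmod (at_left 1))
                  (\<lambda>a. esqrt (area_integral disc
                     (\<lambda>z. ((1 - (cmod a)\<^sup>2) / (cmod (1 - cnj a * z))\<^sup>2) powr (p + 1 - lam) *
                          (cmod (deriv g z))\<^sup>2 * (1 - (cmod z)\<^sup>2) powr p)))
        in ennreal (1 / C) * L \<le> E \<and> E \<le> ennreal C * L))"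
proof -
  note lam = assms(1,2)
  define F :: "complex filter" where "F = filtercomap cmod (at_left 1)"
  obtain k where k: "0 < k" and lower: "\<And>g a. g holomorphic_on disc \<Longrightarrow> cmod a < 1 \<Longrightarrow>
      ennreal ((k * ((1 - cmod a) powr ((1 + lam) / 2) * cmod (deriv g a)))\<^sup>2) \<le> mobius_integral p lam g a"
    using mobius_integral_ge[OF assms(3) lam] by blast
  obtain C1 where C1: "0 < C1" and upper: "\<And>g \<eta> s. g holomorphic_on disc \<Longrightarrow> 0 < \<eta> \<Longrightarrow> 0 \<le> s \<Longrightarrow> s < 1 \<Longrightarrow>
      (\<And>z. s < cmod z \<Longrightarrow> cmod z < 1 \<Longrightarrow> (1 - cmod z) powr ((1 + lam) / 2) * cmod (deriv g z) \<le> \<eta>) \<Longrightarrow>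
      eventually (\<lambda>a. mobius_integral p lam g a \<le> ennreal ((C1 * \<eta>)\<^sup>2)) F"
    unfolding F_def using mobius_integral_eventually_le[OF assms(3) lam] by blast
  obtain C2 where C2: "0 < C2" and ess: "\<And>g N. g holomorphic_on disc \<Longrightarrow>
      bounded_operator (morrey lam) (morrey_norm lam) bloch bloch_norm (T_op g) \<Longrightarrow>
      essential_norm (morrey lam) (morrey_norm lam) bloch bloch_norm (T_op g) < ennreal N \<Longrightarrow>
      \<exists>s<1. \<forall>z. s < cmod z \<and> cmod z < 1 \<longrightarrow> (1 - (cmod z)\<^sup>2) powr ((1 + lam) / 2) * cmod (deriv g z) \<le> C2 * N"
    using essential_norm_T_op_lower[OF lam] by blast
  define C3 where "C3 = 4 * (1 + 8 / (1 - lam)) / k"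
  have C3: "0 < C3" using k lam by (auto simp: C3_def intro!: divide_pos_pos add_pos_pos)
  \<comment> \<open>All ingredients were obtained for arbitrary g, so C depends on p and lam
    only.\<close>
  define C where "C = max (C1 * C2) C3"
  have C: "0 < C" using C3 by (simp add: C_def less_max_iff_disj)
  have main: "ennreal (1 / C) * L \<le> E \<and> E \<le> ennreal C * L"
    if g: "g holomorphic_on disc"
      and bop: "bounded_operator (morrey lam) (morrey_norm lam) bloch bloch_norm (T_op g)"
      and E: "E = essential_norm (morrey lam) (morrey_norm lam) bloch bloch_norm (T_op g)"
      and L: "L = Limsup F (\<lambda>a. esqrt (mobius_integral p lam g a))" for g E L
  proof
    have "L \<le> ennreal (C1 * C2) * E"
    proof (rule ennreal_le_cmult_dense)
      fix N :: real assume N: "0 < N" "E < ennreal N"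
      obtain s where s: "s < 1" and sz: "\<And>z. s < cmod z \<Longrightarrow> cmod z < 1 \<Longrightarrow>
          (1 - (cmod z)\<^sup>2) powr ((1 + lam) / 2) * cmod (deriv g z) \<le> C2 * N"
        using ess[OF g bop] N E by blast
      have "eventually (\<lambda>a. mobius_integral p lam g a \<le> ennreal ((C1 * (C2 * N))\<^sup>2)) F"
      proof (rule upper[OF g, of _ "max s 0"])
        fix z assume z: "max s 0 < cmod z" "cmod z < 1"
        \<comment> \<open>The lower bound for the essential norm controls the weight in 1 - |z|^2,
          the integral estimate asks for the smaller one in 1 - |z|.\<close>
        have "(1 - cmod z) powr ((1 + lam) / 2) \<le> (1 - (cmod z)\<^sup>2) powr ((1 + lam) / 2)"
          using z lam one_minus_square_bounds[of "cmod z"] by (intro powr_mono2) auto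
        then have "(1 - cmod z) powr ((1 + lam) / 2) * cmod (deriv g z) \<le>
            (1 - (cmod z)\<^sup>2) powr ((1 + lam) / 2) * cmod (deriv g z)" by (rule mult_right_mono) simp
        also have "\<dots> \<le> C2 * N" using sz z by simp
        finally show "(1 - cmod z) powr ((1 + lam) / 2) * cmod (deriv g z) \<le> C2 * N" .
      qed (use C2 N s in auto)
      then show "L \<le> ennreal (C1 * C2 * N)"
        unfolding L using C1 C2 N by (intro Limsup_bounded) (simp add: esqrt_le_iff mult.assoc)
    qed (use C1 C2 in simp)
    then have "ennreal (1 / C) * L \<le> ennreal (1 / C) * (ennreal (C1 * C2) * E)" by (rule mult_left_mono) simp
    also have "\<dots> = ennreal (C1 * C2 / C) * E"
      using C C1 C2 by (simp flip: mult.assoc ennreal_mult)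
    also have "\<dots> \<le> ennreal 1 * E"
      using C by (intro mult_right_mono ennreal_leI) (auto simp: C_def)
    finally show "ennreal (1 / C) * L \<le> E" by simp
    have "E \<le> ennreal C3 * L"
    proof (rule ennreal_le_cmult_dense[OF C3])
      fix N :: real assume N: "0 < N" "L < ennreal N"
      have "eventually (\<lambda>a. esqrt (mobius_integral p lam g a) < ennreal N) F"
        using N(2) unfolding L by (rule Limsup_lessD)
      then obtain s where s: "0 \<le> s" "s < 1" and sz: "\<And>z. s < cmod z \<Longrightarrow> cmod z < 1 \<Longrightarrow>
          esqrt (mobius_integral p lam g z) < ennreal N"
        unfolding F_def eventually_cmod_at_left_1 by auto
      have "E \<le> ennreal (4 * (1 + 8 / (1 - lam)) * (N / k))"
        unfolding E
      proof (rule essential_norm_T_op_le[OF g lam s])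
        fix z assume z: "s < cmod z" "cmod z < 1"
        have "mobius_integral p lam g z \<le> ennreal (N\<^sup>2)"
          using sz[OF z] N by (simp add: esqrt_le_iff[symmetric] less_imp_le)
        then have "ennreal ((k * ((1 - cmod z) powr ((1 + lam) / 2) * cmod (deriv g z)))\<^sup>2) \<le> ennreal (N\<^sup>2)"
          using lower[OF g z(2)] by (rule order_trans[rotated])
        then have "(k * ((1 - cmod z) powr ((1 + lam) / 2) * cmod (deriv g z)))\<^sup>2 \<le> N\<^sup>2"
          by (simp add: ennreal_le_iff)
        then have "k * ((1 - cmod z) powr ((1 + lam) / 2) * cmod (deriv g z)) \<le> N"
          using N(1) by (rule power2_le_imp_le[OF _ less_imp_le])
        then show "(1 - cmod z) powr ((1 + lam) / 2) * cmod (deriv g z) \<le> N / k"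
          using k by (simp add: field_simps)
      qed (use N k in simp)
      then show "E \<le> ennreal (C3 * N)" by (simp add: C3_def)
    qed
    also have "\<dots> \<le> ennreal C * L" by (intro mult_right_mono ennreal_leI) (auto simp: C_def)
    finally show "E \<le> ennreal C * L" .
  qed
  show ?thesis
    using C main unfolding Let_def F_def mobius_integral_def by (intro exI[of _ C]) auto
qed

end
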